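(* Let $\omega\in\mathbb R^d$ be nonresonant, let $\mathcal S:\mathbb T^d\to\mathbb R$ be smooth, put $\Sigma=\{\theta\in\mathbb T^d:\mathcal S(\theta)=0\}$ and $q(x)=\mathcal S(x\omega)$, and assume $\Sigma\ne\varnothing$ and $D_\omega\mathcal S(\theta)\neq0$ for every $\theta\in\Sigma$. Let $N_{\mathcal S,\omega}(L)=\#\{x\in[0,L]:q(x)=0\}$. Then the limit $\rho_{\mathcal S,\omega}=\lim_{L\to\infty}N_{\mathcal S,\omega}(L)/L$ exists and is given by $$\rho_{\mathcal S,\omega}=\frac1{(2\pi)^d}\int_{\mathbb T^d}\delta_0(\mathcal S(\theta))|D_\omega\mathcal S(\theta)|\,d\theta=\frac1{(2\pi)^d}\int_\Sigma|\omega\cdot n(\theta)|\,d\sigma(\theta),$$ where $n$ is a unit normal to $\Sigma$. Let $0<x_1<x_2<\cdots$ be the positive zeros of $q$, and define $\Theta_n=x_n\omega\pmod{2\pi}$ and $\mu_N=\frac1N\sum_{n=1}^N\delta_{\Theta_n}$. Then $\mu_N\rightharpoonup\mu_{\mathcal S,\omega}$ weakly in $\mathcal P(\Sigma)$ as $N\to\infty$, where $$d\mu_{\mathcal S,\omega}(\theta)=\frac1{(2\pi)^d\rho_{\mathcal S,\omega}}\frac{|D_\omega\mathcal S(\theta)|}{|\nabla\mathcal S(\theta)|}\,d\sigma(\theta).$$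
   Context: $\mathbb T^d=\mathbb R^d/(2\pi\mathbb Z)^d$. Nonresonant: $\omega\cdot\ell\neq0$ for all $\ell\in\mathbb Z^d\setminus\{0\}$. $D_\omega=\omega\cdot\nabla_\theta$. $\sigma$ is the surface ($(d-1)$-dimensional Hausdorff) measure on the hypersurface $\Sigma$; $\mathcal P(\Sigma)$ is the set of Borel probability measures on $\Sigma$. The integral with the Dirac mass $\delta_0$ is understood as $\lim_{\eta\to0}\int_{\mathbb T^d}\chi_\eta(\mathcal S(\theta))|D_\omega\mathcal S(\theta)|\,d\theta$, where $\chi_\eta(s)=\eta^{-1}\chi(s/\eta)$, $\chi\in C_c^\infty((-1,1))$, $\chi\ge0$, $\int\chi=1$. *)

theory Defs
  imports "HOL-Probability.Probability"
begin

section \<open>The torus with its flat metric and Lebesgue measure\<close>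

definition lattice_rel :: "real ^ 'n \<Rightarrow> real ^ 'n \<Rightarrow> bool" where
  "lattice_rel x y \<longleftrightarrow> (\<exists>k :: int ^ 'n. \<forall>i. x $ i - y $ i = 2 * pi * of_int (k $ i))"

lemma lattice_rel_equivp: "equivp lattice_rel"
proof (rule equivpI)
  show "reflp (lattice_rel :: real ^ 'n \<Rightarrow> _)"
    unfolding reflp_def lattice_rel_def by (auto intro!: exI[of _ 0])
  show "symp (lattice_rel :: real ^ 'n \<Rightarrow> _)"
    unfolding symp_def lattice_rel_def
  proof (intro allI impI)
    fix x y :: "real ^ 'n"
    assume "\<exists>k :: int ^ 'n. \<forall>i. x $ i - y $ i = 2 * pi * of_int (k $ i)"
    then obtain k :: "int ^ 'n" where "\<And>i. x $ i - y $ i = 2 * pi * of_int (k $ i)"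
      by blast
    then show "\<exists>k :: int ^ 'n. \<forall>i. y $ i - x $ i = 2 * pi * of_int (k $ i)"
      by (intro exI[of _ "- k"]) (auto simp: algebra_simps)
  qed
  show "transp (lattice_rel :: real ^ 'n \<Rightarrow> _)"
    unfolding transp_def lattice_rel_def
  proof (intro allI impI)
    fix x y z :: "real ^ 'n"
    assume "\<exists>k :: int ^ 'n. \<forall>i. x $ i - y $ i = 2 * pi * of_int (k $ i)"
      and "\<exists>k :: int ^ 'n. \<forall>i. y $ i - z $ i = 2 * pi * of_int (k $ i)"
    then obtain k l :: "int ^ 'n" where k: "\<And>i. x $ i - y $ i = 2 * pi * of_int (k $ i)"
      and l: "\<And>i. y $ i - z $ i = 2 * pi * of_int (l $ i)"
      by blast
    have "x $ i - z $ i = 2 * pi * of_int ((k + l) $ i)" for i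
      using k[of i] l[of i] by (simp add: distrib_left)
    then show "\<exists>k :: int ^ 'n. \<forall>i. x $ i - z $ i = 2 * pi * of_int (k $ i)"
      by blast
  qed
qed

quotient_type 'n torus = "real ^ 'n" / lattice_rel
  morphisms torus_rep torus_proj
  by (rule lattice_rel_equivp)

lemma torus_proj_eq_iff: "torus_proj x = torus_proj y \<longleftrightarrow> lattice_rel x y"
  by (rule torus.abs_eq_iff)

lemma torus_proj_rep [simp]: "torus_proj (torus_rep a) = a"
  by (rule Quotient_abs_rep[OF Quotient_torus])

lemma torus_fibre_ne: "{x. torus_proj x = a} \<noteq> {}"
  using torus_proj_rep[of a] by blast

text \<open>The distance of two points is the distance of their fibres in Euclidean space.\<close>

instantiation torus :: (finite) metric_space
begin

definition dist_torus :: "'a torus \<Rightarrow> 'a torus \<Rightarrow> real" where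
  "dist_torus a b = setdist {x. torus_proj x = a} {y. torus_proj y = b}"

definition uniformity_torus :: "('a torus \<times> 'a torus) filter" where
  "uniformity_torus = (INF e\<in>{0 <..}. principal {(x, y). dist x y < e})"

definition open_torus :: "'a torus set \<Rightarrow> bool" where
  "open_torus U \<longleftrightarrow> (\<forall>x\<in>U. eventually (\<lambda>(x', y). x' = x \<longrightarrow> y \<in> U) uniformity)"

instance
proof
  show "uniformity = (INF e\<in>{0 <..}. principal {(x, y). dist (x :: 'a torus) y < e})"
    by (rule uniformity_torus_def)
  show "open U \<longleftrightarrow> (\<forall>x\<in>U. eventually (\<lambda>(x', y). x' = x \<longrightarrow> y \<in> U) uniformity)"
    for U :: "'a torus set"
    by (rule open_torus_def)
  show "dist a b = 0 \<longleftrightarrow> a = b" for a b :: "'a torus"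
  proof
    assume "a = b"
    then show "dist a b = 0"
      by (simp add: dist_torus_def setdist_refl)
  next
    assume d0: "dist a b = 0"
    show "a = b"
    proof (rule ccontr)
      assume ne: "a \<noteq> b"
      obtain x y where a: "a = torus_proj x" and b: "b = torus_proj y"
        by (metis torus_proj_rep)
      have "\<exists>i. \<forall>k::int. x $ i - y $ i \<noteq> 2 * pi * of_int k"
      proof (rule ccontr)
        assume "\<not> ?thesis"
        then obtain k :: "'a \<Rightarrow> int" where "\<And>i. x $ i - y $ i = 2 * pi * of_int (k i)"
          by metis
        then have "lattice_rel x y"
          unfolding lattice_rel_def by (intro exI[of _ "\<chi> i. k i"]) simp
        with ne a b show False
          by (simp add: torus_proj_eq_iff)
      qed
      then obtain i where i: "\<And>k::int. x $ i - y $ i \<noteq> 2 * pi * of_int k"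
        by blast
      define t where "t = (x $ i - y $ i) / (2 * pi)"
      have t: "t \<noteq> of_int k" for k :: int
        using i[of k] by (auto simp: t_def field_simps)
      define e where "e = 2 * pi * min (frac t) (1 - frac t)"
      have "frac t > 0"
        using t[of "floor t"] frac_ge_0[of t] unfolding frac_def by linarith
      then have e: "e > 0"
        using frac_lt_1[of t] by (auto simp: e_def)
      have "e \<le> setdist {x. torus_proj x = a} {y. torus_proj y = b}"
      proof (rule le_setdistI)
        fix u v assume "u \<in> {x. torus_proj x = a}" "v \<in> {y. torus_proj y = b}"
        then have "lattice_rel u x" "lattice_rel v y"
          by (auto simp: a b torus_proj_eq_iff)
        then obtain k l :: "int ^ 'a" where k: "u $ i - x $ i = 2 * pi * of_int (k $ i)"
          and l: "v $ i - y $ i = 2 * pi * of_int (l $ i)"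
          unfolding lattice_rel_def by blast
        define m where "m = k $ i - l $ i"
        have "u $ i - v $ i = 2 * pi * (t + of_int m)"
          using k l by (simp add: t_def m_def field_simps)
        moreover have "min (frac t) (1 - frac t) \<le> \<bar>t + of_int m\<bar>"
        proof (cases "floor t + m \<ge> 0")
          case True
          then have "real_of_int (floor t) + of_int m \<ge> 0"
            by linarith
          then show ?thesis by (simp add: frac_def)
        next
          case False
          then have "real_of_int (floor t) + of_int m \<le> -1"
            by linarith
          then show ?thesis by (simp add: frac_def)
        qed
        ultimately have "e \<le> \<bar>u $ i - v $ i\<bar>"
          by (simp add: e_def abs_mult)
        also have "\<dots> \<le> dist u v"
          using dist_vec_nth_le[of u i v] by (simp add: dist_real_def)
        finally show "e \<le> dist u v" .
      qed (use torus_proj_rep in blast)+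
      with d0 e show False
        by (simp add: dist_torus_def)
    qed
  qed
  show "dist a b \<le> dist a c + dist b c" for a b c :: "'a torus"
  proof (rule field_le_epsilon)
    fix e :: real assume e: "e > 0"
    have "dist a c < dist a c + e / 2" "dist b c < dist b c + e / 2"
      using e by auto
    then obtain x z y z' where xz: "torus_proj x = a" "torus_proj z = c" "dist x z < dist a c + e / 2"
      and yz: "torus_proj y = b" "torus_proj z' = c" "dist y z' < dist b c + e / 2"
      unfolding dist_torus_def by (metis (mono_tags, lifting) mem_Collect_eq setdist_ltE torus_fibre_ne)
    define y' where "y' = y + (z - z')"
    have "lattice_rel z z'"
      using xz yz by (simp flip: torus_proj_eq_iff)
    then have "lattice_rel y' y"
      unfolding lattice_rel_def y'_def by simp
    then have y': "torus_proj y' = b"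
      using yz by (simp flip: torus_proj_eq_iff)
    have "dist a b \<le> dist x y'"
      unfolding dist_torus_def using xz y' by (intro setdist_le_dist) auto
    also have "\<dots> \<le> dist x z + dist y' z"
      by (rule dist_triangle2)
    also have "dist y' z = dist y z'"
      by (simp add: y'_def dist_norm)
    finally show "dist a b \<le> dist a c + dist b c + e"
      using xz yz by linarith
  qed
qed

end

text \<open>The measure \<open>d\<theta>\<close> is not normalised: its total mass is \<open>(2\<pi>)\<^sup>d\<close>.\<close>

definition torus_lebesgue :: "'n::finite torus measure" where
  "torus_lebesgue =
     distr (restrict_space lborel {x :: real ^ 'n. \<forall>i. 0 \<le> x $ i \<and> x $ i < 2 * pi}) borel torus_proj"

section \<open>Differential calculus\<close>

text \<open>\<open>Ck k f\<close>: the function \<open>f\<close> is \<open>k\<close> times continuously differentiable.\<close>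

fun Ck :: "nat \<Rightarrow> ('a::euclidean_space \<Rightarrow> real) \<Rightarrow> bool" where
  "Ck 0 f \<longleftrightarrow> continuous_on UNIV f"
| "Ck (Suc k) f \<longleftrightarrow> (\<forall>x. f differentiable (at x)) \<and>
     (\<forall>b\<in>Basis. Ck k (\<lambda>x. frechet_derivative f (at x) b))"

definition smooth :: "('a::euclidean_space \<Rightarrow> real) \<Rightarrow> bool" where
  "smooth f \<longleftrightarrow> (\<forall>k. Ck k f)"

definition torus_smooth :: "('n::finite torus \<Rightarrow> real) \<Rightarrow> bool" where
  "torus_smooth S \<longleftrightarrow> smooth (\<lambda>x. S (torus_proj x))"

definition torus_grad :: "('n::finite torus \<Rightarrow> real) \<Rightarrow> 'n torus \<Rightarrow> real ^ 'n" where
  "torus_grad S \<theta> =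
     (\<chi> i. frechet_derivative (\<lambda>x. S (torus_proj x)) (at (torus_rep \<theta>)) (axis i 1))"

definition D_along :: "real ^ 'n \<Rightarrow> ('n::finite torus \<Rightarrow> real) \<Rightarrow> 'n torus \<Rightarrow> real" where
  "D_along \<omega> S \<theta> = \<omega> \<bullet> torus_grad S \<theta>"

text \<open>Tangent spaces of the torus are identified with \<open>\<real>\<^sup>d\<close>; curves in the torus are
  represented by lifts to \<open>\<real>\<^sup>d\<close>.\<close>

definition tangent_vectors :: "'n::finite torus set \<Rightarrow> 'n torus \<Rightarrow> (real ^ 'n) set" where
  "tangent_vectors M \<theta> = {v. \<exists>(\<gamma> :: real \<Rightarrow> real ^ 'n) \<epsilon>. 0 < \<epsilon> \<and> torus_proj (\<gamma> 0) = \<theta> \<and>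
     (\<forall>t. \<bar>t\<bar> < \<epsilon> \<longrightarrow> torus_proj (\<gamma> t) \<in> M) \<and> (\<gamma> has_vector_derivative v) (at 0)}"

definition unit_normal :: "'n::finite torus set \<Rightarrow> ('n torus \<Rightarrow> real ^ 'n) \<Rightarrow> bool" where
  "unit_normal M n \<longleftrightarrow>
     (\<forall>\<theta>\<in>M. norm (n \<theta>) = 1 \<and> (\<forall>v\<in>tangent_vectors M \<theta>. n \<theta> \<bullet> v = 0))"

section \<open>Hausdorff measure\<close>

text \<open>With \<open>0 ^ 0 = 1\<close>, nonempty sets of diameter \<open>0\<close> contribute \<open>1\<close> when \<open>k = 0\<close>.
  Boundedness is required since \<open>diameter\<close> is unspecified on unbounded sets.\<close>

definition hausdorff_pre :: "nat \<Rightarrow> real \<Rightarrow> 'a::metric_space set \<Rightarrow> ennreal" where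
  "hausdorff_pre k \<delta> A =
     (INF U \<in> {U :: nat \<Rightarrow> 'a set. A \<subseteq> (\<Union>i. U i) \<and> (\<forall>i. bounded (U i) \<and> diameter (U i) \<le> \<delta>)}.
        \<Sum>i. if U i = {} then 0 else ennreal (diameter (U i) ^ k))"

definition hausdorff_outer :: "nat \<Rightarrow> 'a::metric_space set \<Rightarrow> ennreal" where
  "hausdorff_outer k A = (SUP \<delta>\<in>{0<..}. hausdorff_pre k \<delta> A)"

text \<open>A \<open>(d - 1)\<close>-dimensional unit cube in \<open>\<real>\<^sup>d\<close>; all choices of the coordinate give
  isometric sets.\<close>

definition unit_face :: "(real ^ 'n) set" where
  "unit_face = {x. x $ (SOME i. True) = 0 \<and> (\<forall>i. 0 \<le> x $ i \<and> x $ i \<le> 1)}"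

text \<open>The \<open>(d - 1)\<close>-dimensional Hausdorff measure on the Borel sets of the torus. As for any
  surface measure, the constant is such that a flat \<open>(d - 1)\<close>-dimensional unit cube has
  measure \<open>1\<close> (the normalisation of Burago, Burago and Ivanov, A Course in Metric Geometry,
  Section 1.7).\<close>

definition surface_measure :: "'n::finite torus measure" where
  "surface_measure = measure_of UNIV (sets borel)
     (\<lambda>A. hausdorff_outer (CARD('n) - 1) A
          / hausdorff_outer (CARD('n) - 1) (unit_face :: (real ^ 'n) set))"

section \<open>The Dirac mass of a function\<close>

definition mollifier :: "(real \<Rightarrow> real) \<Rightarrow> bool" where
  "mollifier \<phi> \<longleftrightarrow> smooth \<phi> \<and> closure {s. \<phi> s \<noteq> 0} \<subseteq> {-1<..<1} \<and> (\<forall>s. 0 \<le> \<phi> s) \<and>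
     (LINT s|lborel. \<phi> s) = 1"

text \<open>\<open>has_delta_integral S g I\<close>: the integral of \<open>\<delta>\<^sub>0(S(\<theta>)) g(\<theta>) d\<theta>\<close> over the torus is \<open>I\<close>.\<close>

definition has_delta_integral ::
  "('n::finite torus \<Rightarrow> real) \<Rightarrow> ('n torus \<Rightarrow> real) \<Rightarrow> real \<Rightarrow> bool" where
  "has_delta_integral S g I \<longleftrightarrow> (\<forall>\<phi>. mollifier \<phi> \<longrightarrow>
     ((\<lambda>\<eta>. LINT \<theta>|torus_lebesgue. (\<phi> (S \<theta> / \<eta>) / \<eta>) * g \<theta>) \<longlongrightarrow> I) (at_right 0))"

section \<open>Weak convergence of Borel probability measures on a subset\<close>

definition borel_prob :: "'a::topological_space set \<Rightarrow> 'a measure set" where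
  "borel_prob X = {M. prob_space M \<and> space M = X \<and> sets M = sets (restrict_space borel X)}"

definition weakly_converges ::
  "'a::topological_space set \<Rightarrow> (nat \<Rightarrow> 'a measure) \<Rightarrow> 'a measure \<Rightarrow> bool" where
  "weakly_converges X Ms M \<longleftrightarrow>
     (\<forall>f :: 'a \<Rightarrow> real. continuous_on X f \<and> bounded (f ` X) \<longrightarrow>
        (\<lambda>N. LINT \<theta>|Ms N. f \<theta>) \<longlonglongrightarrow> (LINT \<theta>|M. f \<theta>))"

section \<open>Zeros along the linear flow\<close>

definition nonresonant :: "real ^ 'n \<Rightarrow> bool" where
  "nonresonant \<omega> \<longleftrightarrow> (\<forall>l :: int ^ 'n. l \<noteq> 0 \<longrightarrow> (\<Sum>i\<in>UNIV. \<omega> $ i * of_int (l $ i)) \<noteq> 0)"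

definition zero_set :: "('n::finite torus \<Rightarrow> real) \<Rightarrow> 'n torus set" where
  "zero_set S = {\<theta>. S \<theta> = 0}"

definition flow_fun :: "('n::finite torus \<Rightarrow> real) \<Rightarrow> real ^ 'n \<Rightarrow> real \<Rightarrow> real" where
  "flow_fun S \<omega> x = S (torus_proj (x *\<^sub>R \<omega>))"

definition zeros_upto :: "(real \<Rightarrow> real) \<Rightarrow> real \<Rightarrow> real set" where
  "zeros_upto q L = {x\<in>{0..L}. q x = 0}"

text \<open>The sequence \<open>x 1 < x 2 < \<dots>\<close> lists the positive zeros of \<open>q\<close>; \<open>x 0\<close> is irrelevant.\<close>

definition lists_positive_zeros :: "(real \<Rightarrow> real) \<Rightarrow> (nat \<Rightarrow> real) \<Rightarrow> bool" where
  "lists_positive_zeros q x \<longleftrightarrow> strict_mono_on {1..} x \<and> x ` {1..} = {t. 0 < t \<and> q t = 0}"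

definition empirical_measure ::
  "'a::topological_space set \<Rightarrow> (nat \<Rightarrow> 'a) \<Rightarrow> nat \<Rightarrow> 'a measure" where
  "empirical_measure X \<Theta> N = measure_of X (sets (restrict_space borel X))
     (\<lambda>A. ennreal (1 / real N) * (\<Sum>n=1..N. emeasure (return (restrict_space borel X) (\<Theta> n)) A))"

definition limit_measure ::
  "('n::finite torus \<Rightarrow> real) \<Rightarrow> real ^ 'n \<Rightarrow> real \<Rightarrow> 'n torus measure" where
  "limit_measure S \<omega> \<rho> = density (restrict_space surface_measure (zero_set S))
     (\<lambda>\<theta>. ennreal (1 / ((2 * pi) ^ CARD('n) * \<rho>) * (\<bar>D_along \<omega> S \<theta>\<bar> / norm (torus_grad S \<theta>))))"

end

theory Submission
  imports Defs
begin

text \<open>Transversality makes the zeros along every flow line uniformly separated. Spread each zero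
  over a short time window by a weight of integral \<open>1\<close>: for continuous \<open>h\<close>, the sum of \<open>h\<close> over
  the zeros in \<open>[0, L]\<close> differs by a bounded amount from the integral along the orbit of the
  function \<open>smear h\<close>. The mollified densities \<open>\<phi> (S / \<eta>) / \<eta> * \<bar>D\<^sub>\<omega> S\<bar> * h\<close>, averaged along the
  flow with the same weight, converge uniformly to \<open>smear h\<close>. Hence \<open>smear h\<close> is continuous, the
  zero averages converge to its mean by equidistribution, and this mean is the Dirac mass integral.

  It remains to identify the functional \<open>h \<mapsto> \<integral> smear h\<close> with integration against
  \<open>\<bar>\<omega> \<bullet> n\<bar> d\<sigma>\<close>. It is integration against the measure \<open>flux\<close> on the zero set. Near a
  point \<open>p\<close>, the projection along \<open>\<omega>\<close> onto the tangent hyperplane is almost an isometry, so it almost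
  preserves the Hausdorff measure, while by Fubini \<open>flux\<close> is exactly \<open>\<bar>\<omega> \<bullet> n p\<bar>\<close> times the
  Lebesgue measure of the projection; on a hyperplane the two measures agree up to the normalisation
  by uniqueness of translation invariant measures. So \<open>flux\<close> and \<open>\<bar>\<omega> \<bullet> n\<bar> d\<sigma>\<close> agree up to a
  factor arbitrarily close to \<open>1\<close>.\<close>

section \<open>Hausdorff measure\<close>

text \<open>Two obstacles shape the proof. The zero count is not itself the orbit integral of a
  function on the torus, so equidistribution does not apply to it directly; and
  \<open>surface_measure\<close> is built from covers, while no coarea formula or implicit function
  theorem is invoked. The first is met by \<open>smear h\<close>, which depends on a time weight but
  not on the mollifier: the same continuous function yields the zero count and, because the flow
  preserves volume, the limit of the mollified integrals for every mollifier. For the second, all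
  that is used about the constant in \<open>surface_measure\<close> is that a unit face has positive
  finite Hausdorff measure. Its value cancels, so no isodiametric inequality enters. Determinants do
  not occur either: a linear isomorphism multiplies volume by a constant, and this constant is read
  off from the unit ball. The scale of time is set by \<open>gap\<close>, during which
  \<open>S\<close> stays strictly monotone near a zero. Hits are sought up to time
  \<open>gap / 2\<close>, but the weight lives within \<open>gap / 4\<close>; this margin is what
  makes \<open>smear h\<close> continuous although the time of the hit is not.\<close>

definition hcost :: "nat \<Rightarrow> 'a::metric_space set \<Rightarrow> ennreal" where
  "hcost k U = (if U = {} then 0 else ennreal (diameter U ^ k))"

definition hcover :: "real \<Rightarrow> 'a::metric_space set \<Rightarrow> (nat \<Rightarrow> 'a set) \<Rightarrow> bool" where
  "hcover \<delta> A U \<longleftrightarrow> A \<subseteq> (\<Union>i. U i) \<and> (\<forall>i. bounded (U i) \<and> diameter (U i) \<le> \<delta>)"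

lemma hausdorff_pre_eq: "hausdorff_pre k \<delta> A = (INF U \<in> Collect (hcover \<delta> A). \<Sum>i. hcost k (U i))"
  unfolding hausdorff_pre_def hcover_def hcost_def by simp

text \<open>The bound \<open>0 \<le> c\<close> takes care of the empty set, whose diameter is
  0.\<close>

lemma diameter_le_dist:
  assumes "0 \<le> c" "\<And>x y. x \<in> A \<Longrightarrow> y \<in> A \<Longrightarrow> dist x y \<le> c"
  shows "diameter A \<le> c"
  using assms by (auto simp: diameter_def intro!: cSUP_least)

lemma hcost_empty [simp]: "hcost k {} = 0"
  by (simp add: hcost_def)

lemma hausdorff_pre_le: "hcover \<delta> A U \<Longrightarrow> hausdorff_pre k \<delta> A \<le> (\<Sum>i. hcost k (U i))"
  unfolding hausdorff_pre_eq by (rule INF_lower) simp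

lemma hausdorff_pre_mono: "A \<subseteq> B \<Longrightarrow> hausdorff_pre k \<delta> A \<le> hausdorff_pre k \<delta> B"
  unfolding hausdorff_pre_eq by (rule INF_superset_mono) (force simp: hcover_def)+

lemma hausdorff_pre_antimono: "\<delta> \<le> \<delta>' \<Longrightarrow> hausdorff_pre k \<delta>' A \<le> hausdorff_pre k \<delta> A"
  unfolding hausdorff_pre_eq
  by (rule INF_superset_mono) (auto simp: hcover_def, meson order_trans)

lemma hausdorff_pre_empty: "0 \<le> \<delta> \<Longrightarrow> hausdorff_pre k \<delta> {} = 0"
  using hausdorff_pre_le[of \<delta> "{}" "\<lambda>_. {}" k] by (simp add: hcover_def diameter_def)

text \<open>For each \<open>A n\<close> take a cover whose cost exceeds the infimum by at most
  \<open>e / 2 ^ (n + 1)\<close>, and enumerate all the sets by \<open>prod_decode\<close>. Only a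
  finite right-hand side has to be treated, so every infimum is finite and can be strictly
  exceeded.\<close>

lemma hausdorff_pre_subadditive:
  "hausdorff_pre k \<delta> (\<Union>n. A n) \<le> (\<Sum>n. hausdorff_pre k \<delta> (A n))"
proof (rule ennreal_le_epsilon)
  fix e :: real assume "0 < e" "(\<Sum>n. hausdorff_pre k \<delta> (A n)) < top"
  then have "\<And>n. hausdorff_pre k \<delta> (A n) < hausdorff_pre k \<delta> (A n) + e * (1/2)^Suc n"
    by (auto simp add: less_top dest!: ennreal_suminf_lessD)
  then have "\<exists>U. hcover \<delta> (A n) U \<and> (\<Sum>i. hcost k (U i)) < hausdorff_pre k \<delta> (A n) + e * (1/2)^Suc n" for n
    by (subst (asm) (1) hausdorff_pre_eq) (auto simp: INF_less_iff)
  then obtain B where B: "\<And>n. hcover \<delta> (A n) (B n)"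
    and Ble: "\<And>n. (\<Sum>i. hcost k (B n i)) \<le> hausdorff_pre k \<delta> (A n) + e * (1/2)^Suc n"
    by (metis less_imp_le)
  define C where "C = case_prod B o prod_decode"
  have "hcover \<delta> (\<Union>n. A n) C"
    using B unfolding hcover_def C_def
    by (auto simp add: split_def subset_eq) (metis fst_conv prod_encode_inverse snd_conv)
  then have "hausdorff_pre k \<delta> (\<Union>n. A n) \<le> (\<Sum>i. hcost k (C i))"
    by (rule hausdorff_pre_le)
  also have "\<dots> = (\<Sum>n. \<Sum>i. hcost k (B n i))"
    unfolding C_def comp_def
    using suminf_ennreal_2dimen[of "\<lambda>n. \<Sum>i. hcost k (B n i)" "\<lambda>p. hcost k (case_prod B p)"] by simp
  also have "\<dots> \<le> (\<Sum>n. hausdorff_pre k \<delta> (A n) + e * (1/2) ^ Suc n)"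
    by (intro suminf_le Ble) auto
  also have "\<dots> = (\<Sum>n. hausdorff_pre k \<delta> (A n)) + (\<Sum>n. ennreal e * ennreal ((1/2) ^ Suc n))"
    using \<open>0 < e\<close> by (subst suminf_add[symmetric])
       (auto simp del: ennreal_suminf_cmult simp add: ennreal_mult[symmetric])
  also have "\<dots> = (\<Sum>n. hausdorff_pre k \<delta> (A n)) + e"
    unfolding ennreal_suminf_cmult
    by (subst suminf_ennreal_eq[OF zero_le_power power_half_series]) auto
  finally show "hausdorff_pre k \<delta> (\<Union>n. A n) \<le> (\<Sum>n. hausdorff_pre k \<delta> (A n)) + e" .
qed

lemma hausdorff_pre_le_outer: "0 < \<delta> \<Longrightarrow> hausdorff_pre k \<delta> A \<le> hausdorff_outer k A"
  unfolding hausdorff_outer_def by (rule SUP_upper) simp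

lemma hausdorff_outer_leI: "(\<And>\<delta>. 0 < \<delta> \<Longrightarrow> hausdorff_pre k \<delta> A \<le> c) \<Longrightarrow> hausdorff_outer k A \<le> c"
  unfolding hausdorff_outer_def by (rule SUP_least) simp

lemma hausdorff_outer_empty [simp]: "hausdorff_outer k {} = 0"
  using hausdorff_outer_leI[of k "{}" 0] by (simp add: hausdorff_pre_empty)

lemma hausdorff_outer_mono: "A \<subseteq> B \<Longrightarrow> hausdorff_outer k A \<le> hausdorff_outer k B"
  by (meson hausdorff_outer_leI hausdorff_pre_le_outer hausdorff_pre_mono order_trans)

lemma hausdorff_outer_subadditive:
  "hausdorff_outer k (\<Union>n. A n) \<le> (\<Sum>n. hausdorff_outer k (A n))"
proof (rule hausdorff_outer_leI)
  fix \<delta> :: real assume "0 < \<delta>"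
  then have "(\<Sum>n. hausdorff_pre k \<delta> (A n)) \<le> (\<Sum>n. hausdorff_outer k (A n))"
    by (intro suminf_le hausdorff_pre_le_outer) auto
  then show "hausdorff_pre k \<delta> (\<Union>n. A n) \<le> (\<Sum>n. hausdorff_outer k (A n))"
    using hausdorff_pre_subadditive order_trans by blast
qed

lemma hausdorff_outer_space: "outer_measure_space (Pow UNIV) (hausdorff_outer k)"
  unfolding outer_measure_space_def positive_def increasing_def countably_subadditive_def
  by (auto simp: hausdorff_outer_mono hausdorff_outer_subadditive)

lemma hausdorff_outer_Un_le:
  "hausdorff_outer k (A \<union> B) \<le> hausdorff_outer k A + hausdorff_outer k B"
proof -
  have "subadditive (Pow UNIV) (hausdorff_outer k :: 'a set \<Rightarrow> _)"
    using hausdorff_outer_space unfolding outer_measure_space_def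
    by (intro ring_of_sets.countably_subadditive_subadditive[of UNIV]) 
       (auto simp: ring_of_sets_Pow[of UNIV, simplified])
  moreover have "A \<union> B = A \<union> (B - A)" "hausdorff_outer k (B - A) \<le> hausdorff_outer k B"
    by (auto intro: hausdorff_outer_mono)
  ultimately show ?thesis
    unfolding subadditive_def by (metis Diff_disjoint Pow_UNIV UNIV_I add_left_mono order_trans)
qed

text \<open>Along an increasing sequence the supremum of a sum is the sum of the suprema, as
  \<open>hausdorff_outer_separated\<close> requires.\<close>

lemma hausdorff_outer_eq_SUP: "hausdorff_outer k A = (SUP n. hausdorff_pre k (1 / real (Suc n)) A)"
proof (rule antisym)
  show "hausdorff_outer k A \<le> (SUP n. hausdorff_pre k (1 / real (Suc n)) A)"
  proof (rule hausdorff_outer_leI)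
    fix \<delta> :: real assume "0 < \<delta>"
    then obtain n where "1 / real (Suc n) < \<delta>"
      using nat_approx_posE by blast
    then have "hausdorff_pre k \<delta> A \<le> hausdorff_pre k (1 / real (Suc n)) A"
      by (intro hausdorff_pre_antimono) simp
    then show "hausdorff_pre k \<delta> A \<le> (SUP n. hausdorff_pre k (1 / real (Suc n)) A)"
      by (rule SUP_upper2[rotated]) simp
  qed
qed (intro SUP_least hausdorff_pre_le_outer, simp)

text \<open>Once the mesh is finer than the gap, no set of a cover meets both parts.\<close>

lemma hausdorff_outer_separated:
  assumes d: "0 < d" and sep: "\<And>a b. a \<in> A \<Longrightarrow> b \<in> B \<Longrightarrow> d \<le> dist a b"
  shows "hausdorff_outer k A + hausdorff_outer k B \<le> hausdorff_outer k (A \<union> B)"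
proof -
  have pre: "hausdorff_pre k \<delta> A + hausdorff_pre k \<delta> B \<le> hausdorff_pre k \<delta> (A \<union> B)"
    if \<delta>: "0 < \<delta>" "\<delta> < d" for \<delta>
    unfolding hausdorff_pre_eq[of k \<delta> "A \<union> B"]
  proof (rule INF_greatest)
    fix U assume "U \<in> Collect (hcover \<delta> (A \<union> B))"
    then have U: "A \<union> B \<subseteq> (\<Union>i. U i)" "\<And>i. bounded (U i)" "\<And>i. diameter (U i) \<le> \<delta>"
      by (auto simp: hcover_def)
    define V where "V C i = (if U i \<inter> C = {} then {} else U i)" for C i
    have V: "hcover \<delta> C (V C)" if "C \<subseteq> A \<union> B" for C
      unfolding hcover_def
    proof (intro conjI allI)
      show "C \<subseteq> (\<Union>i. V C i)"
      proof
        fix x assume x: "x \<in> C"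
        with that U(1) obtain i where "x \<in> U i" by blast
        with x have "x \<in> V C i" by (auto simp: V_def)
        then show "x \<in> (\<Union>i. V C i)" by blast
      qed
      show "bounded (V C i)" "diameter (V C i) \<le> \<delta>" for i
        using U \<delta> by (auto simp: V_def)
    qed
    have "hcost k (V A i) + hcost k (V B i) \<le> hcost k (U i)" for i
    proof (cases "U i \<inter> A = {} \<or> U i \<inter> B = {}")
      case False
      then obtain a b where ab: "a \<in> U i" "a \<in> A" "b \<in> U i" "b \<in> B" by blast
      then have "dist a b \<le> diameter (U i)"
        using diameter_bounded_bound U by blast
      then show ?thesis
        using sep[of a b] ab U(3)[of i] \<delta> by auto
    qed (auto simp: V_def)
    then have "(\<Sum>i. hcost k (V A i) + hcost k (V B i)) \<le> (\<Sum>i. hcost k (U i))"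
      by (intro suminf_le) auto
    then have "(\<Sum>i. hcost k (V A i)) + (\<Sum>i. hcost k (V B i)) \<le> (\<Sum>i. hcost k (U i))"
      by (simp add: suminf_add)
    moreover have "hausdorff_pre k \<delta> A \<le> (\<Sum>i. hcost k (V A i))"
      "hausdorff_pre k \<delta> B \<le> (\<Sum>i. hcost k (V B i))"
      by (auto intro!: hausdorff_pre_le V)
    ultimately show "hausdorff_pre k \<delta> A + hausdorff_pre k \<delta> B \<le> (\<Sum>i. hcost k (U i))"
      by (meson add_mono order_trans)
  qed
  have inc: "incseq (\<lambda>n. hausdorff_pre k (1 / real (Suc n)) C)" for C :: "'a set"
    by (rule monoI, rule hausdorff_pre_antimono) (auto simp: field_simps)
  have "hausdorff_outer k A + hausdorff_outer k B
      = (SUP n. hausdorff_pre k (1 / real (Suc n)) A + hausdorff_pre k (1 / real (Suc n)) B)"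
    unfolding hausdorff_outer_eq_SUP by (rule ennreal_SUP_add[symmetric]) (rule inc)+
  also have "\<dots> \<le> hausdorff_outer k (A \<union> B)"
  proof (rule SUP_least)
    fix n
    obtain m where m: "1 / real (Suc m) < d" using d nat_approx_posE by blast
    define N where "N = max n m"
    have N: "n \<le> N" "1 / real (Suc N) < d"
    proof -
      show "n \<le> N" by (simp add: N_def)
      have "1 / real (Suc N) \<le> 1 / real (Suc m)" by (simp add: N_def field_simps)
      with m show "1 / real (Suc N) < d" by simp
    qed
    have "hausdorff_pre k (1 / real (Suc n)) A + hausdorff_pre k (1 / real (Suc n)) B
      \<le> hausdorff_pre k (1 / real (Suc N)) A + hausdorff_pre k (1 / real (Suc N)) B"
      by (intro add_mono incseqD[OF inc] N)
    also have "\<dots> \<le> hausdorff_pre k (1 / real (Suc N)) (A \<union> B)"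
      by (rule pre) (use N in auto)
    also have "\<dots> \<le> hausdorff_outer k (A \<union> B)"
      by (rule hausdorff_pre_le_outer) simp
    finally show "hausdorff_pre k (1 / real (Suc n)) A + hausdorff_pre k (1 / real (Suc n)) B
      \<le> hausdorff_outer k (A \<union> B)" .
  qed
  finally show ?thesis .
qed

text \<open>Caratheodory's criterion: the part of \<open>X\<close> outside \<open>F\<close> is exhausted by the sets \<open>D n\<close> at
  positive distance from \<open>F\<close>. The shells \<open>R n\<close> of equal parity are separated from each other, so
  their measures have a finite sum, and the tail of this sum controls what \<open>D n\<close> misses.\<close>

lemma hausdorff_outer_closed_split:
  fixes F X :: "'a::metric_space set"
  assumes F: "closed F" "F \<noteq> {}"
  shows "hausdorff_outer k (X \<inter> F) + hausdorff_outer k (X - F) \<le> hausdorff_outer k X"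
proof (cases "hausdorff_outer k X = top")
  case False
  let ?H = "hausdorff_outer k"
  define d where "d x = infdist x F" for x
  define D where "D n = {x\<in>X - F. 1 / real (Suc n) \<le> d x}" for n
  define R where "R n = D (Suc n) - D n" for n
  have dF: "d y = 0" if "y \<in> F" for y using that by (simp add: d_def)
  have dpos: "d x > 0" if "x \<in> X - F" for x
    using that F in_closed_iff_infdist_zero[of F x] infdist_nonneg[of x F] by (auto simp: d_def less_le)
  have dlip: "d x - d y \<le> dist x y" for x y
    using infdist_triangle[of x F y] by (simp add: d_def)
  have sepF: "?H (X \<inter> F) + ?H (D n) \<le> ?H X" for n
  proof -
    have "?H (X \<inter> F) + ?H (D n) \<le> ?H ((X \<inter> F) \<union> D n)"
    proof (rule hausdorff_outer_separated)
      show "1 / real (Suc n) \<le> dist a b" if "a \<in> X \<inter> F" "b \<in> D n" for a b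
        using dlip[of b a] dF[of a] that by (auto simp: D_def dist_commute)
    qed simp
    also have "\<dots> \<le> ?H X" by (rule hausdorff_outer_mono) (auto simp: D_def)
    finally show ?thesis .
  qed
  have Dmono: "D n \<subseteq> D m" if "n \<le> m" for n m
  proof -
    have "1 / real (Suc m) \<le> 1 / real (Suc n)" using that by (simp add: field_simps)
    then show ?thesis by (auto simp: D_def)
  qed
  have shells: "(\<Sum>j<m. ?H (R (2 * j + p))) \<le> ?H X" for m p
  proof -
    have "(\<Sum>j<m. ?H (R (2 * j + p))) \<le> ?H (\<Union>j<m. R (2 * j + p))"
    proof (induction m)
      case (Suc m)
      have "?H (\<Union>j<m. R (2 * j + p)) + ?H (R (2 * m + p))
          \<le> ?H ((\<Union>j<m. R (2 * j + p)) \<union> R (2 * m + p))"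
      proof (rule hausdorff_outer_separated)
        \<comment> \<open>Shells of index at most \<open>2 * m + p - 2\<close> have
          \<open>d a \<ge> 1 / (2 * m + p)\<close>, while \<open>d b < 1 / (2 * m + p + 1)\<close>.
          If \<open>2 * m + p = 0\<close>, the union over \<open>j < m\<close> is empty and any
          positive number will do; \<open>?d\<close> would then be negative because
          \<open>1 / 0 = 0\<close>.\<close>
        let ?d = "1 / real (2 * m + p) - 1 / real (Suc (2 * m + p))"
        show "(if 2 * m + p = 0 then 1 else ?d) > 0" by (auto simp: field_simps)
        fix a b assume a: "a \<in> (\<Union>j<m. R (2 * j + p))" and b: "b \<in> R (2 * m + p)"
        from a obtain j where j: "j < m" "a \<in> D (Suc (2 * j + p))" by (auto simp: R_def)
        have "D (Suc (2 * j + p)) \<subseteq> D (2 * m + p - 1)" using j by (intro Dmono) auto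
        with j have "1 / real (Suc (2 * m + p - 1)) \<le> d a" by (auto simp: D_def)
        moreover have "Suc (2 * m + p - 1) = 2 * m + p" using j by auto
        moreover have "d b < 1 / real (Suc (2 * m + p))" using b by (auto simp: R_def D_def)
        ultimately show "(if 2 * m + p = 0 then 1 else ?d) \<le> dist a b"
          using dlip[of a b] j by auto
      qed
      then show ?case
        using Suc by (simp add: lessThan_Suc Un_commute add.commute) (meson add_left_mono order_trans)
    qed simp
    also have "\<dots> \<le> ?H X" by (rule hausdorff_outer_mono) (auto simp: R_def D_def)
    finally show ?thesis .
  qed
  define S where "S = (\<Sum>j. ?H (R j))"
  have "(\<Sum>j<n. ?H (R j)) \<le> 2 * ?H X" for n
  proof -
    have "(\<Sum>j<n. ?H (R j)) \<le> (\<Sum>j<2 * n. ?H (R j))" by (intro sum_mono2) auto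
    also have "\<dots> = (\<Sum>j<n. ?H (R (2 * j + 0))) + (\<Sum>j<n. ?H (R (2 * j + 1)))"
      by (induction n) (auto simp: ac_simps)
    also have "\<dots> \<le> ?H X + ?H X" by (intro add_mono shells)
    finally show ?thesis by (simp add: mult_2)
  qed
  then have "S \<le> 2 * ?H X"
    unfolding S_def by (intro suminf_le_const) auto
  then have S: "S < top"
    using False by (auto intro!: le_less_trans[of S] simp: ennreal_mult_less_top less_top)
  have D_top: "?H (X - F) \<le> (SUP n. ?H (D n))"
  proof (rule ennreal_le_epsilon)
    fix e :: real assume e: "0 < e"
    have "(\<lambda>n. \<Sum>j<n. ?H (R j)) \<longlonglongrightarrow> S"
      unfolding S_def by (rule summable_LIMSEQ) simp
    then have lim: "(\<lambda>n. (\<Sum>j<n. ?H (R j)) + ennreal e) \<longlonglongrightarrow> S + ennreal e"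
      by (intro tendsto_intros)
    have "S < S + ennreal e" using S e by (simp add: less_top)
    from order_tendstoD(1)[OF lim this] obtain n where n: "S < (\<Sum>j<n. ?H (R j)) + ennreal e"
      unfolding eventually_sequentially by blast
    define T where "T = (\<Sum>j. ?H (R (j + n)))"
    have ST: "S = (\<Sum>j<n. ?H (R j)) + T"
      unfolding S_def T_def by (subst suminf_offset[of _ n]) (auto simp: add.commute)
    have "T \<le> ennreal e"
      using n S unfolding ST by (auto simp: ennreal_add_left_cancel_le less_top dest: less_imp_le)
    have "X - F \<subseteq> D n \<union> (\<Union>j. R (j + n))"
    proof
      fix x assume x: "x \<in> X - F"
      then obtain m where "1 / real (Suc m) < d x" using dpos nat_approx_posE by blast
      then have ex: "x \<in> D m" using x by (auto simp: D_def)
      define l where "l = (LEAST m. x \<in> D m)"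
      have l: "x \<in> D l" using ex unfolding l_def by (rule LeastI)
      show "x \<in> D n \<union> (\<Union>j. R (j + n))"
      proof (cases "l \<le> n")
        case True with l Dmono show ?thesis by blast
      next
        case False
        have "x \<notin> D (l - 1)" using not_less_Least[of "l - 1" "\<lambda>m. x \<in> D m"] False
          unfolding l_def by auto
        then have "x \<in> R (l - 1 - n + n)" using l False by (simp add: R_def)
        then show ?thesis by blast
      qed
    qed
    then have "?H (X - F) \<le> ?H (D n) + ?H (\<Union>j. R (j + n))"
      by (meson hausdorff_outer_mono hausdorff_outer_Un_le order_trans)
    also have "\<dots> \<le> (SUP n. ?H (D n)) + T"
      unfolding T_def by (intro add_mono SUP_upper hausdorff_outer_subadditive) simp
    also have "\<dots> \<le> (SUP n. ?H (D n)) + ennreal e"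
      by (intro add_left_mono) fact
    finally show "?H (X - F) \<le> (SUP n. ?H (D n)) + ennreal e" .
  qed
  have "?H (X \<inter> F) + ?H (X - F) \<le> ?H (X \<inter> F) + (SUP n. ?H (D n))"
    by (intro add_left_mono D_top)
  also have "\<dots> = (SUP n. ?H (X \<inter> F) + ?H (D n))"
    by (simp add: ennreal_SUP_add_right)
  also have "\<dots> \<le> ?H X" by (intro SUP_least sepF)
  finally show ?thesis .
qed simp

text \<open>The sets that split every set additively form a sigma-algebra on which the outer measure
  is countably additive. It contains the closed sets by \<open>hausdorff_outer_closed_split\<close>,
  hence all Borel sets.\<close>

lemma hausdorff_countably_additive:
  "countably_additive (sets borel) (hausdorff_outer k :: 'a::metric_space set \<Rightarrow> ennreal)"
proof -
  let ?H = "hausdorff_outer k :: 'a set \<Rightarrow> ennreal"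
  let ?L = "lambda_system UNIV (Pow UNIV) ?H"
  interpret sigma_algebra "UNIV :: 'a set" "Pow UNIV" by (rule sigma_algebra_Pow)
  have ms: "measure_space UNIV ?L ?H"
    using caratheodory_lemma[OF hausdorff_outer_space] .
  have closed: "F \<in> ?L" if "closed F" for F
  proof (cases "F = {}")
    case True
    then show ?thesis by (simp add: lambda_system_def)
  next
    case False
    have "?H (X \<inter> F) + ?H (X - F) = ?H X" for X
    proof (rule antisym)
      have "X \<inter> F \<union> (X - F) = X" by blast
      then show "?H X \<le> ?H (X \<inter> F) + ?H (X - F)"
        by (metis hausdorff_outer_Un_le)
    qed (rule hausdorff_outer_closed_split[OF that False])
    then show ?thesis unfolding lambda_system_eq by simp
  qed
  have "sets (borel :: 'a measure) \<subseteq> ?L"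
  proof -
    have "sigma_sets UNIV (Collect closed) \<subseteq> ?L"
      using ms closed by (intro sigma_algebra.sigma_sets_subset) (auto simp: measure_space_def)
    then show ?thesis unfolding borel_eq_closed by simp
  qed
  with ms show ?thesis
    unfolding measure_space_def countably_additive_def by (metis (no_types, lifting) subset_eq)
qed

definition hausdorff_measure :: "nat \<Rightarrow> 'a::metric_space measure" where
  "hausdorff_measure k = measure_of UNIV (sets borel) (hausdorff_outer k)"

lemma space_hausdorff_measure [simp]: "space (hausdorff_measure k) = UNIV"
  and sets_hausdorff_measure [simp, measurable_cong]: "sets (hausdorff_measure k :: 'a measure) = sets (borel :: 'a::metric_space measure)"
  using sets.sigma_sets_eq[of borel] by (auto simp: hausdorff_measure_def)

lemma emeasure_hausdorff_measure:
  assumes "A \<in> sets borel"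
  shows "emeasure (hausdorff_measure k) A = hausdorff_outer k A"
  by (rule emeasure_measure_of[OF hausdorff_measure_def])
     (use assms hausdorff_countably_additive in \<open>auto simp: positive_def\<close>)

section \<open>Hausdorff measure under Lipschitz maps\<close>

lemma INF_ennreal_cmult_le:
  assumes "0 < c"
  shows "(INF i\<in>I. ennreal c * f i) \<le> ennreal c * (INF i\<in>I. f i)"
proof -
  let ?x = "INF i\<in>I. ennreal c * f i"
  have c: "ennreal c * (ennreal (1 / c) * y) = y" "ennreal (1 / c) * (ennreal c * y) = y" for y
    using assms by (simp_all flip: ennreal_mult mult.assoc)
  have "ennreal (1 / c) * ?x \<le> (INF i\<in>I. f i)"
  proof (rule INF_greatest)
    fix i assume "i \<in> I"
    then have "ennreal (1 / c) * ?x \<le> ennreal (1 / c) * (ennreal c * f i)"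
      by (intro mult_left_mono INF_lower) auto
    then show "ennreal (1 / c) * ?x \<le> f i" by (simp only: c)
  qed
  then have "ennreal c * (ennreal (1 / c) * ?x) \<le> ennreal c * (INF i\<in>I. f i)"
    by (rule mult_left_mono) simp
  then show ?thesis by (simp only: c)
qed

text \<open>A cover of mesh \<open>\<delta> / L\<close> is carried to one of mesh
  \<open>\<delta>\<close>. Its sets are first cut down to \<open>A\<close>, where alone the
  Lipschitz bound holds.\<close>

lemma hausdorff_outer_lipschitz:
  fixes \<phi> :: "'a::metric_space \<Rightarrow> 'b::metric_space"
  assumes L: "0 < L" and lip: "\<And>x y. x \<in> A \<Longrightarrow> y \<in> A \<Longrightarrow> dist (\<phi> x) (\<phi> y) \<le> L * dist x y"
  shows "hausdorff_outer k (\<phi> ` A) \<le> ennreal (L ^ k) * hausdorff_outer k A"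
proof (rule hausdorff_outer_leI)
  fix \<delta> :: real assume \<delta>: "0 < \<delta>"
  have "hausdorff_pre k \<delta> (\<phi> ` A) \<le> (\<Sum>i. ennreal (L ^ k) * hcost k (U i))"
    if "hcover (\<delta> / L) A U" for U
  proof -
    have U: "A \<subseteq> (\<Union>i. U i)" "\<And>i. bounded (U i)" "\<And>i. diameter (U i) \<le> \<delta> / L"
      using that by (auto simp: hcover_def)
    define V where "V i = \<phi> ` (A \<inter> U i)" for i
    have dV: "dist u v \<le> L * diameter (U i)" if "u \<in> V i" "v \<in> V i" for u v i
    proof -
      from that obtain x y where xy: "x \<in> A" "x \<in> U i" "y \<in> A" "y \<in> U i" "u = \<phi> x" "v = \<phi> y"
        by (auto simp: V_def)
      then have "dist u v \<le> L * dist x y" using lip by simp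
      also have "\<dots> \<le> L * diameter (U i)"
        using diameter_bounded_bound[OF U(2)] xy L by (intro mult_left_mono) auto
      finally show ?thesis .
    qed
    have bV: "bounded (V i)" for i
      using dV[of _ i] unfolding bounded_two_points by blast
    have diam: "diameter (V i) \<le> L * diameter (U i)" for i
      using dV[of _ i] diameter_ge_0[OF U(2), of i] L by (intro diameter_le_dist) auto
    have "hcover \<delta> (\<phi> ` A) V"
      unfolding hcover_def
    proof (intro conjI allI bV)
      show "\<phi> ` A \<subseteq> (\<Union>i. V i)" using U(1) by (fastforce simp: V_def)
      show "diameter (V i) \<le> \<delta>" for i
        using diam[of i] U(3)[of i] L by (simp add: field_simps)
    qed
    then have "hausdorff_pre k \<delta> (\<phi> ` A) \<le> (\<Sum>i. hcost k (V i))"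
      by (rule hausdorff_pre_le)
    also have "\<dots> \<le> (\<Sum>i. ennreal (L ^ k) * hcost k (U i))"
    proof (intro suminf_le summableI)
      fix i
      have "ennreal (diameter (V i) ^ k) \<le> ennreal ((L * diameter (U i)) ^ k)"
        using diam diameter_ge_0[OF bV] by (intro ennreal_leI power_mono) auto
      also have "\<dots> = ennreal (L ^ k) * ennreal (diameter (U i) ^ k)"
        using L diameter_ge_0[OF U(2)] by (simp add: power_mult_distrib ennreal_mult)
      finally show "hcost k (V i) \<le> ennreal (L ^ k) * hcost k (U i)"
        by (auto simp: hcost_def V_def)
    qed
    finally show ?thesis .
  qed
  then have "hausdorff_pre k \<delta> (\<phi> ` A) \<le> (INF U \<in> Collect (hcover (\<delta> / L) A). ennreal (L ^ k) * (\<Sum>i. hcost k (U i)))"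
    by (intro INF_greatest) simp
  also have "\<dots> \<le> ennreal (L ^ k) * hausdorff_pre k (\<delta> / L) A"
    unfolding hausdorff_pre_eq using L by (intro INF_ennreal_cmult_le) simp
  also have "\<dots> \<le> ennreal (L ^ k) * hausdorff_outer k A"
    using L \<delta> by (intro mult_left_mono hausdorff_pre_le_outer) auto
  finally show "hausdorff_pre k \<delta> (\<phi> ` A) \<le> ennreal (L ^ k) * hausdorff_outer k A" .
qed

lemma hausdorff_outer_isometric:
  fixes \<phi> :: "'a::metric_space \<Rightarrow> 'b::metric_space"
  assumes iso: "\<And>x y. x \<in> A \<Longrightarrow> y \<in> A \<Longrightarrow> dist (\<phi> x) (\<phi> y) = dist x y"
  shows "hausdorff_outer k (\<phi> ` A) = hausdorff_outer k A"
proof (rule antisym)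
  show "hausdorff_outer k (\<phi> ` A) \<le> hausdorff_outer k A"
    using hausdorff_outer_lipschitz[of 1 A \<phi> k] iso by simp
  have inj: "inj_on \<phi> A" using iso by (metis dist_eq_0_iff inj_onI)
  have "inv_into A \<phi> ` \<phi> ` A = A" using inj by simp
  moreover have "hausdorff_outer k (inv_into A \<phi> ` \<phi> ` A) \<le> ennreal (1 ^ k) * hausdorff_outer k (\<phi> ` A)"
    by (rule hausdorff_outer_lipschitz) (use inj iso in auto)
  ultimately show "hausdorff_outer k A \<le> hausdorff_outer k (\<phi> ` A)" by simp
qed

section \<open>The surface measure\<close>

lemma space_surface_measure [simp]: "space surface_measure = UNIV"
  and sets_surface_measure [simp, measurable_cong]:
    "sets (surface_measure :: 'n::finite torus measure) = sets borel"
  using sets.sigma_sets_eq[of borel] by (auto simp: surface_measure_def)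

lemma emeasure_surface_measure:
  fixes A :: "'n::finite torus set"
  assumes "A \<in> sets borel"
  shows "emeasure surface_measure A = hausdorff_outer (CARD('n) - 1) A
     / hausdorff_outer (CARD('n) - 1) (unit_face :: (real ^ 'n) set)"
proof (rule emeasure_measure_of[OF surface_measure_def])
  show "countably_additive (sets (surface_measure :: 'n torus measure))
     (\<lambda>A. hausdorff_outer (CARD('n) - 1) A / hausdorff_outer (CARD('n) - 1) (unit_face :: (real ^ 'n) set))"
    using hausdorff_countably_additive[where 'a = "'n torus" and k = "CARD('n) - 1"]
    unfolding countably_additive_def divide_ennreal_def
    by (simp add: ennreal_suminf_multc)
qed (use assms in \<open>auto simp: positive_def\<close>)

section \<open>Hausdorff measure on hyperplanes\<close>

text \<open>Both sides equal the integral of \<open>indicator A x * indicator B (x + y)\<close> over \<open>M \<times> N\<close>.\<close>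

lemma translation_invariant_measures_proportional:
  fixes M N :: "'a::euclidean_space measure"
  assumes M: "sigma_finite_measure M" "sets M = sets borel"
    and N: "sigma_finite_measure N" "sets N = sets borel"
    and E: "AE x in M. x \<in> E" "AE x in N. x \<in> E"
    and Minv: "\<And>e. e \<in> E \<Longrightarrow> distr M borel ((+) e) = M"
    and Ninv: "\<And>e. e \<in> E \<Longrightarrow> distr N borel ((+) e) = N"
    and Nrefl: "distr N borel uminus = N"
    and A: "A \<in> sets borel" and B: "B \<in> sets borel"
  shows "emeasure M A * emeasure N B = emeasure M B * emeasure N A"
proof -
  interpret M: sigma_finite_measure M by fact
  interpret N: sigma_finite_measure N by fact
  interpret MN: pair_sigma_finite M N ..
  note [measurable_cong] = M(2) N(2)
  note [measurable] = A B
  have "emeasure M A * emeasure N B = (\<integral>\<^sup>+x. indicator A x * emeasure N B \<partial>M)"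
    by (simp add: nn_integral_multc)
  also have "\<dots> = (\<integral>\<^sup>+x. \<integral>\<^sup>+y. indicator A x * indicator B (x + y) \<partial>N \<partial>M)"
  proof (rule nn_integral_cong_AE, use E(1) in eventually_elim)
    fix x assume x: "x \<in> E"
    have "emeasure N B = (\<integral>\<^sup>+y. indicator B y \<partial>distr N borel ((+) x))"
      by (simp add: Ninv[OF x])
    also have "\<dots> = (\<integral>\<^sup>+y. indicator B (x + y) \<partial>N)"
      by (subst nn_integral_distr) auto
    finally show "indicator A x * emeasure N B = (\<integral>\<^sup>+y. indicator A x * indicator B (x + y) \<partial>N)"
      by (simp add: nn_integral_cmult)
  qed
  also have "\<dots> = (\<integral>\<^sup>+y. \<integral>\<^sup>+x. indicator A x * indicator B (x + y) \<partial>M \<partial>N)"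
    by (rule MN.Fubini'[symmetric]) measurable
  also have "\<dots> = (\<integral>\<^sup>+y. \<integral>\<^sup>+x. indicator A (x - y) * indicator B x \<partial>M \<partial>N)"
  proof (rule nn_integral_cong_AE, use E(2) in eventually_elim)
    fix y assume y: "y \<in> E"
    have "(\<integral>\<^sup>+x. indicator A (x - y) * indicator B x \<partial>M)
        = (\<integral>\<^sup>+x. indicator A (x - y) * indicator B x \<partial>distr M borel ((+) y))"
      by (simp add: Minv[OF y])
    also have "\<dots> = (\<integral>\<^sup>+x. indicator A x * indicator B (x + y) \<partial>M)"
      by (subst nn_integral_distr) (auto simp: add.commute)
    finally show "(\<integral>\<^sup>+x. indicator A x * indicator B (x + y) \<partial>M)
        = (\<integral>\<^sup>+x. indicator A (x - y) * indicator B x \<partial>M)" by simp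
  qed
  also have "\<dots> = (\<integral>\<^sup>+x. \<integral>\<^sup>+y. indicator A (x - y) * indicator B x \<partial>N \<partial>M)"
    by (rule MN.Fubini') measurable
  also have "\<dots> = (\<integral>\<^sup>+x. emeasure N A * indicator B x \<partial>M)"
  proof (rule nn_integral_cong_AE, use E(1) in eventually_elim)
    fix x assume x: "x \<in> E"
    have "emeasure N A = (\<integral>\<^sup>+y. indicator A y \<partial>distr N borel ((+) x))"
      by (simp add: Ninv[OF x])
    also have "\<dots> = (\<integral>\<^sup>+y. indicator A (x + y) \<partial>N)"
      by (subst nn_integral_distr) auto
    \<comment> \<open>The reflection supplies the sign with which \<open>y\<close> enters after the
      change of variables in \<open>M\<close>.\<close>
    also have "\<dots> = (\<integral>\<^sup>+y. indicator A (x + y) \<partial>distr N borel uminus)"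
      by (simp add: Nrefl)
    also have "\<dots> = (\<integral>\<^sup>+y. indicator A (x - y) \<partial>N)"
      by (subst nn_integral_distr) auto
    finally show "(\<integral>\<^sup>+y. indicator A (x - y) * indicator B x \<partial>N) = emeasure N A * indicator B x"
      by (simp add: nn_integral_multc)
  qed
  also have "\<dots> = emeasure M B * emeasure N A"
    by (simp add: nn_integral_cmult mult.commute[of "emeasure M B"])
  finally show ?thesis .
qed

text \<open>The same choice of coordinate as in \<open>unit_face\<close>, so that this face lies in
  \<open>hyperplane0\<close>.\<close>

definition coord0 :: "'n::finite" where
  "coord0 = (SOME i. True)"

definition hyperplane0 :: "(real ^ 'n) set" where
  "hyperplane0 = {x. x $ coord0 = 0}"

definition slab0 :: "(real ^ 'n) set" where
  "slab0 = {x. \<bar>x $ coord0\<bar> \<le> 1 / 2}"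

definition proj0 :: "real ^ 'n \<Rightarrow> real ^ 'n" where
  "proj0 x = x - (x $ coord0) *\<^sub>R axis coord0 1"

text \<open>The \<open>(d - 1)\<close>-dimensional Lebesgue measure of the hyperplane, obtained from the
  \<open>d\<close>-dimensional one on a slab of thickness \<open>1\<close>.\<close>

definition flat_measure :: "(real ^ 'n) measure" where
  "flat_measure = distr (restrict_space lborel slab0) borel proj0"

lemma proj0_nth: "proj0 x $ i = (if i = coord0 then 0 else x $ i)"
  by (auto simp: proj0_def axis_def)

lemma measurable_proj0 [measurable]: "proj0 \<in> borel \<rightarrow>\<^sub>M borel"
  unfolding proj0_def by (intro borel_measurable_continuous_onI continuous_intros)

lemma slab0_borel [measurable]: "slab0 \<in> sets borel"
  unfolding slab0_def by (intro borel_closed closed_Collect_le continuous_intros)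

lemma hyperplane0_borel [measurable]: "hyperplane0 \<in> sets borel"
  unfolding hyperplane0_def by (intro borel_closed closed_Collect_eq continuous_intros)

lemma space_flat_measure [simp]: "space flat_measure = UNIV"
  and sets_flat_measure [simp, measurable_cong]: "sets flat_measure = sets borel"
  by (auto simp: flat_measure_def)

lemma emeasure_flat_measure:
  assumes [measurable]: "A \<in> sets borel"
  shows "emeasure flat_measure A = emeasure lborel (slab0 \<inter> proj0 -` A)"
proof -
  have "proj0 \<in> restrict_space lborel slab0 \<rightarrow>\<^sub>M borel"
    by (rule measurable_restrict_space1) simp
  then show ?thesis
    unfolding flat_measure_def
    by (subst emeasure_distr)
       (auto simp: emeasure_restrict_space space_restrict_space Int_commute)
qed

section \<open>Cubes and the unit face\<close>

lemma emeasure_lborel_cbox_cart: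
  fixes a b :: "real ^ 'n"
  assumes "\<And>i. a $ i \<le> b $ i"
  shows "emeasure lborel (cbox a b) = ennreal (\<Prod>i\<in>UNIV. b $ i - a $ i)"
proof -
  have "cbox a b \<noteq> {}" using assms by (auto simp: interval_ne_empty_cart)
  moreover have "emeasure lborel (cbox a b) = ennreal (measure lborel (cbox a b))"
    using emeasure_lborel_cbox_finite[of a b] by (intro emeasure_eq_ennreal_measure) (auto simp: less_top)
  ultimately show ?thesis using content_cbox_cart[of a b] by simp
qed

lemma prod_coord0: "(\<Prod>i\<in>(UNIV :: 'n::finite set). if i = coord0 then 1 else c) = (c :: real) ^ (CARD('n) - 1)"
proof -
  have "(\<Prod>i\<in>(UNIV :: 'n set). if i = coord0 then 1 else c)
      = (\<Prod>i\<in>UNIV - {coord0 :: 'n}. if i = coord0 then 1 else c)"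
    by (subst prod.remove[of _ coord0]) auto
  also have "\<dots> = (\<Prod>i\<in>UNIV - {coord0 :: 'n}. c)" by (intro prod.cong) auto
  finally show ?thesis by (simp add: card_Diff_singleton)
qed

text \<open>A set of diameter \<open>r\<close> containing \<open>y\<close> lies in this cube, so the
  flat measure is controlled by the cost of covering sets. The centre need not lie on the
  hyperplane, whence only an inequality.\<close>

lemma flat_measure_cube:
  fixes y :: "real ^ 'n"
  assumes "0 \<le> r"
  shows "emeasure flat_measure (cbox (y - (\<chi> i. r)) (y + (\<chi> i. r))) \<le> ennreal ((2 * r) ^ (CARD('n) - 1))"
proof -
  let ?a = "\<chi> i. if i = coord0 then - 1 / 2 else y $ i - r"
  let ?b = "\<chi> i. if i = coord0 then 1 / 2 else y $ i + r"
  have "emeasure flat_measure (cbox (y - (\<chi> i. r)) (y + (\<chi> i. r)))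
      = emeasure lborel (slab0 \<inter> proj0 -` cbox (y - (\<chi> i. r)) (y + (\<chi> i. r)))"
    by (rule emeasure_flat_measure) simp
  also have "\<dots> \<le> emeasure lborel (cbox ?a ?b)"
  proof (rule emeasure_mono)
    show "slab0 \<inter> proj0 -` cbox (y - (\<chi> i. r)) (y + (\<chi> i. r)) \<subseteq> cbox ?a ?b"
      by (auto simp: slab0_def mem_box_cart proj0_nth abs_le_iff split: if_splits)
  qed simp
  also have "\<dots> = ennreal (\<Prod>i\<in>(UNIV :: 'n set). if i = coord0 then 1 else 2 * r)"
  proof -
    have "(\<Prod>i\<in>UNIV. ?b $ i - ?a $ i) = (\<Prod>i\<in>(UNIV :: 'n set). if i = coord0 then 1 else 2 * r)"
      by (rule prod.cong) auto
    then show ?thesis using assms by (subst emeasure_lborel_cbox_cart) auto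
  qed
  also have "\<dots> = ennreal ((2 * r) ^ (CARD('n) - 1))"
    by (simp only: prod_coord0)
  finally show ?thesis .
qed

lemma unit_face_eq: "unit_face = {x. x $ coord0 = 0 \<and> (\<forall>i. 0 \<le> x $ i \<and> x $ i \<le> 1)}"
  unfolding unit_face_def coord0_def ..

lemma unit_face_borel [measurable]: "unit_face \<in> sets (borel :: (real ^ 'n) measure)"
proof -
  have "(unit_face :: (real ^ 'n) set) = hyperplane0 \<inter> cbox 0 (\<chi> i. 1)"
    by (auto simp: unit_face_eq hyperplane0_def mem_box_cart)
  show ?thesis
    by (subst \<open>unit_face = _\<close>) (intro sets.Int hyperplane0_borel borel_closed closed_cbox)
qed

lemma flat_measure_unit_face: "emeasure flat_measure (unit_face :: (real ^ 'n) set) = 1"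
proof -
  let ?a = "(\<chi> i. if i = coord0 then - 1 / 2 else 0) :: real ^ 'n"
  let ?b = "(\<chi> i. if i = coord0 then 1 / 2 else 1) :: real ^ 'n"
  have "emeasure flat_measure (unit_face :: (real ^ 'n) set) = emeasure lborel (slab0 \<inter> proj0 -` unit_face :: (real ^ 'n) set)"
    by (rule emeasure_flat_measure) simp
  also have "slab0 \<inter> proj0 -` unit_face = cbox ?a ?b"
  proof (intro set_eqI iffI)
    fix x :: "real ^ 'n" assume "x \<in> cbox ?a ?b"
    then have x: "?a $ i \<le> x $ i \<and> x $ i \<le> ?b $ i" for i by (simp add: mem_box_cart)
    have "- 1 / 2 \<le> x $ coord0 \<and> x $ coord0 \<le> 1 / 2" using x[of coord0] by simp
    moreover have "0 \<le> x $ i \<and> x $ i \<le> 1" if "i \<noteq> coord0" for i using x[of i] that by simp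
    ultimately show "x \<in> slab0 \<inter> proj0 -` unit_face"
      by (auto simp: slab0_def unit_face_eq proj0_nth abs_le_iff)
  qed (auto simp: slab0_def mem_box_cart unit_face_eq proj0_nth abs_le_iff split: if_splits)
  also have "emeasure lborel (cbox ?a ?b) = ennreal (\<Prod>i\<in>(UNIV :: 'n set). if i = coord0 then 1 else 1)"
    by (subst emeasure_lborel_cbox_cart) (auto intro!: prod.neutral)
  finally show ?thesis by simp
qed

text \<open>The finite cover is padded with empty sets, which cost 0 even for
  \<open>k = 0\<close>.\<close>

lemma hausdorff_pre_le_finite:
  assumes J: "finite J" and cov: "A \<subseteq> (\<Union>j\<in>J. U j)" and \<delta>: "0 \<le> \<delta>"
    and U: "\<And>j. j \<in> J \<Longrightarrow> bounded (U j)" "\<And>j. j \<in> J \<Longrightarrow> diameter (U j) \<le> \<delta>"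
  shows "hausdorff_pre k \<delta> A \<le> (\<Sum>j\<in>J. hcost k (U j))"
proof -
  obtain h where h: "bij_betw h {0..<card J} J"
    using ex_bij_betw_nat_finite[OF J] by blast
  then have hJ: "i < card J \<Longrightarrow> h i \<in> J" for i by (auto simp: bij_betw_def)
  define V where "V i = (if i < card J then U (h i) else {})" for i
  have "hcover \<delta> A V"
    unfolding hcover_def
  proof (intro conjI allI)
    show "A \<subseteq> (\<Union>i. V i)"
    proof
      fix x assume "x \<in> A"
      then obtain j where "j \<in> J" "x \<in> U j" using cov by blast
      moreover then obtain i where "i < card J" "j = h i" using h by (metis atLeastLessThan_iff bij_betw_iff_bijections)
      ultimately have "x \<in> V i" by (simp add: V_def)
      then show "x \<in> (\<Union>i. V i)" by blast
    qed
    show "bounded (V i)" "diameter (V i) \<le> \<delta>" for i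
      using U[OF hJ, of i] \<delta> by (auto simp: V_def)
  qed
  then have "hausdorff_pre k \<delta> A \<le> (\<Sum>i. hcost k (V i))" by (rule hausdorff_pre_le)
  also have "\<dots> = (\<Sum>i<card J. hcost k (V i))"
    by (rule suminf_finite) (auto simp: V_def)
  also have "\<dots> = (\<Sum>i\<in>{0..<card J}. hcost k (U (h i)))"
    by (rule sum.cong) (auto simp: V_def)
  also have "\<dots> = (\<Sum>j\<in>J. hcost k (U j))"
    by (rule sum.reindex_bij_betw[OF h])
  finally show ?thesis .
qed

text \<open>Subdivide the face into \<open>m\<^sup>d\<^sup>-\<^sup>1\<close> cubes of side \<open>1 / m\<close>.\<close>

lemma hausdorff_unit_face_finite:
  "hausdorff_outer (CARD('n) - 1) (unit_face :: (real ^ 'n) set) < top"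
proof -
  let ?k = "CARD('n) - 1"
  let ?c = "real CARD('n)"
  have "hausdorff_outer ?k (unit_face :: (real ^ 'n) set) \<le> ennreal (?c ^ ?k)"
  proof (rule hausdorff_outer_leI)
    fix \<delta> :: real assume \<delta>: "0 < \<delta>"
    obtain m where m: "1 / real (Suc m) < \<delta> / ?c"
      using nat_approx_posE[of "\<delta> / ?c"] \<delta> by auto
    define M where "M = Suc m"
    have M: "0 < M" "?c / M \<le> \<delta>" using m by (auto simp: M_def field_simps)
    define J where "J = PiE (UNIV - {coord0 :: 'n}) (\<lambda>_. {..<M})"
    define U where "U f = {x :: real ^ 'n. x $ coord0 = 0 \<and>
       (\<forall>i. i \<noteq> coord0 \<longrightarrow> real (f i) / M \<le> x $ i \<and> x $ i \<le> (real (f i) + 1) / M)}" for f :: "'n \<Rightarrow> nat"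
    have J: "finite J" "card J = M ^ ?k"
      by (auto simp: J_def finite_PiE card_PiE card_Diff_singleton)
    have dist: "dist x y \<le> ?c / M" if "x \<in> U f" "y \<in> U f" for x y f
    proof -
      have "\<bar>(x - y) $ i\<bar> \<le> 1 / M" for i
      proof (cases "i = coord0")
        case False
        with that have "real (f i) / M \<le> x $ i" "x $ i \<le> (real (f i) + 1) / M"
          "real (f i) / M \<le> y $ i" "y $ i \<le> (real (f i) + 1) / M" by (auto simp: U_def)
        then show ?thesis unfolding add_divide_distrib by (simp add: abs_le_iff)
      qed (use that in \<open>auto simp: U_def\<close>)
      then have "(\<Sum>i\<in>UNIV. \<bar>(x - y) $ i\<bar>) \<le> (\<Sum>i\<in>(UNIV :: 'n set). 1 / M)"
        by (intro sum_mono)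
      then show ?thesis
        using norm_le_l1_cart[of "x - y"] by (simp add: dist_norm)
    qed
    have bd: "bounded (U f)" for f
      using dist[of _ f] unfolding bounded_two_points by blast
    have diam: "diameter (U f) \<le> ?c / M" for f
      by (rule diameter_le_dist) (use dist in auto)
    have "unit_face \<subseteq> (\<Union>f\<in>J. U f)"
    proof
      fix x :: "real ^ 'n" assume x: "x \<in> unit_face"
      have "\<exists>l<M. real l / M \<le> x $ i \<and> x $ i \<le> (real l + 1) / M" for i
      \<comment> \<open>For \<open>x $ i = 1\<close> the floor would give the index
        \<open>M\<close>; the point belongs to the last closed interval instead.\<close>
      proof (cases "x $ i = 1")
        case True
        then show ?thesis using M by (intro exI[of _ "M - 1"]) (auto simp: of_nat_diff field_simps)
      next
        case False
        with x have xi: "0 \<le> x $ i" "x $ i < 1" by (auto simp: unit_face_eq less_le)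
        define l where "l = nat \<lfloor>x $ i * M\<rfloor>"
        have l: "real l \<le> x $ i * M" "x $ i * M < real l + 1"
          using xi M by (auto simp: l_def)
        have "x $ i * M < 1 * real M" using xi M by (intro mult_strict_right_mono) auto
        with l have "l < M" by linarith
        then show ?thesis using l M by (intro exI[of _ l]) (auto simp: field_simps)
      qed
      then obtain f where f: "\<And>i. f i < M" "\<And>i. real (f i) / M \<le> x $ i" "\<And>i. x $ i \<le> (real (f i) + 1) / M"
        by metis
      have "x \<in> U (restrict f (UNIV - {coord0}))" "restrict f (UNIV - {coord0}) \<in> J"
        using f x by (auto simp: U_def J_def unit_face_eq)
      then show "x \<in> (\<Union>f\<in>J. U f)" by blast
    qed
    then have "hausdorff_pre ?k \<delta> (unit_face :: (real ^ 'n) set) \<le> (\<Sum>f\<in>J. hcost ?k (U f))"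
      by (rule hausdorff_pre_le_finite[OF J(1)]) (use \<delta> bd diam M in \<open>auto intro: order_trans\<close>)
    also have "\<dots> \<le> (\<Sum>f\<in>J. ennreal ((?c / M) ^ ?k))"
    proof (rule sum_mono)
      show "hcost ?k (U f) \<le> ennreal ((?c / M) ^ ?k)" for f
        using diam[of f] diameter_ge_0[OF bd, of f] by (auto simp: hcost_def intro!: ennreal_leI power_mono)
    qed
    also have "\<dots> = ennreal (real (M ^ ?k) * (?c / M) ^ ?k)"
      by (simp add: J(2) ennreal_of_nat_eq_real_of_nat ennreal_mult)
    also have "real (M ^ ?k) * (?c / M) ^ ?k = ?c ^ ?k"
      using M by (simp add: power_divide)
    finally show "hausdorff_pre ?k \<delta> (unit_face :: (real ^ 'n) set) \<le> ennreal (?c ^ ?k)" .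
  qed
  then show ?thesis by (rule le_less_trans) simp
qed

text \<open>Mass distribution principle: each covering set lies in a cube of half side its diameter,
  so its flat measure is at most \<open>2 ^ (CARD('n) - 1)\<close> times its cost, and the face has
  flat measure 1. This legitimises the division in \<open>surface_measure\<close>.\<close>

lemma hausdorff_unit_face_pos:
  "0 < hausdorff_outer (CARD('n) - 1) (unit_face :: (real ^ 'n) set)"
proof -
  let ?k = "CARD('n) - 1"
  have "1 \<le> ennreal (2 ^ ?k) * hausdorff_pre ?k 1 (unit_face :: (real ^ 'n) set)"
  proof -
    have "1 \<le> ennreal (2 ^ ?k) * (\<Sum>i. hcost ?k (U i))" if "hcover 1 unit_face U" for U :: "nat \<Rightarrow> (real ^ 'n) set"
    proof -
      have U: "unit_face \<subseteq> (\<Union>i. U i)" "\<And>i. bounded (U i)"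
        using that by (auto simp: hcover_def)
      define y where "y i = (SOME y. y \<in> U i)" for i
      define r :: "nat \<Rightarrow> real ^ 'n" where "r i = (\<chi> j. diameter (U i))" for i
      define C where "C i = (if U i = {} then {} else cbox (y i - r i) (y i + r i))" for i
      have UC: "U i \<subseteq> C i" for i
      proof
        fix x assume x: "x \<in> U i"
        then have "y i \<in> U i" unfolding y_def by (rule someI)
        then have "dist x (y i) \<le> diameter (U i)"
          using x U by (intro diameter_bounded_bound)
        then have "\<bar>x $ j - y i $ j\<bar> \<le> diameter (U i)" for j
          using dist_vec_nth_le[of x j "y i"] by (simp add: dist_real_def)
        then have "y i $ j - diameter (U i) \<le> x $ j \<and> x $ j \<le> y i $ j + diameter (U i)" for j
          by (metis abs_le_iff add.commute diff_le_eq minus_diff_eq)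
        then show "x \<in> C i" using x by (auto simp: C_def r_def mem_box_cart)
      qed
      have "1 = emeasure flat_measure (unit_face :: (real ^ 'n) set)" by (simp add: flat_measure_unit_face)
      also have "\<dots> \<le> emeasure flat_measure (\<Union>i. C i)"
      proof (rule emeasure_mono)
        show "unit_face \<subseteq> (\<Union>i. C i)" using U(1) UC by blast
      qed (auto simp: C_def)
      also have "\<dots> \<le> (\<Sum>i. emeasure flat_measure (C i))"
        by (intro emeasure_subadditive_countably) (auto simp: C_def)
      also have "\<dots> \<le> (\<Sum>i. ennreal (2 ^ ?k) * hcost ?k (U i))"
      proof (intro suminf_le summableI)
        show "emeasure flat_measure (C i) \<le> ennreal (2 ^ ?k) * hcost ?k (U i)" for i
          using flat_measure_cube[of "diameter (U i)" "y i"] diameter_ge_0[OF U(2), of i]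
          by (auto simp: C_def r_def hcost_def power_mult_distrib ennreal_mult)
      qed
      finally show ?thesis by simp
    qed
    then have "1 \<le> (INF U \<in> Collect (hcover 1 (unit_face :: (real ^ 'n) set)). ennreal (2 ^ ?k) * (\<Sum>i. hcost ?k (U i)))"
      by (intro INF_greatest) simp
    also have "\<dots> \<le> ennreal (2 ^ ?k) * hausdorff_pre ?k 1 (unit_face :: (real ^ 'n) set)"
      unfolding hausdorff_pre_eq by (intro INF_ennreal_cmult_le) simp
    finally show ?thesis .
  qed
  then have "hausdorff_pre ?k 1 (unit_face :: (real ^ 'n) set) \<noteq> 0" by auto
  then show ?thesis
    using hausdorff_pre_le_outer[of 1 ?k "unit_face :: (real ^ 'n) set"]
    by (metis less_le_trans not_gr_zero zero_less_one)
qed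

section \<open>Symmetries of the flat measure\<close>

lemma distr_lborel_uminus: "distr lborel borel uminus = (lborel :: 'a::euclidean_space measure)"
  using lborel_affine[of "-1" "0 :: 'a"] by (simp add: density_1)

lemma sigma_finite_flat_measure: "sigma_finite_measure (flat_measure :: (real ^ 'n) measure)"
proof
  let ?C = "\<lambda>n::nat. cbox (0 - (\<chi> i. real n)) (0 + (\<chi> i. real n)) :: (real ^ 'n) set"
  have "\<exists>n. x \<in> ?C n" for x :: "real ^ 'n"
  proof -
    obtain n :: nat where "norm x \<le> n" using real_arch_simple by blast
    then have "\<bar>x $ i\<bar> \<le> n" for i using component_le_norm_cart[of x i] by linarith
    then have "- real n \<le> x $ i \<and> x $ i \<le> n" for i by (simp add: abs_le_iff minus_le_iff)
    then show ?thesis by (auto simp: mem_box_cart)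
  qed
  then have "(\<Union>n. ?C n) = UNIV" by blast
  moreover have "emeasure flat_measure (?C n) \<noteq> \<infinity>" for n
    using flat_measure_cube[of "real n" "0 :: real ^ 'n"] by (auto simp: top_unique)
  ultimately show "\<exists>A. countable A \<and> A \<subseteq> sets (flat_measure :: (real ^ 'n) measure) \<and> \<Union> A = space flat_measure \<and>
      (\<forall>a\<in>A. emeasure flat_measure a \<noteq> \<infinity>)"
    by (intro exI[of _ "range ?C"]) auto
qed

text \<open>Applied to translations along the hyperplane and to the reflection, the symmetries that
  \<open>translation_invariant_measures_proportional\<close> asks of \<open>N\<close>.\<close>

lemma distr_flat_measure:
  fixes T :: "real ^ 'n \<Rightarrow> real ^ 'n"
  assumes [measurable]: "T \<in> borel \<rightarrow>\<^sub>M borel"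
    and T: "distr lborel borel T = lborel" and slab: "\<And>x. T x \<in> slab0 \<longleftrightarrow> x \<in> slab0"
    and comm: "\<And>x. T (proj0 x) = proj0 (T x)"
  shows "distr flat_measure borel T = flat_measure"
proof (rule measure_eqI)
  fix A assume "A \<in> sets (distr flat_measure borel T)"
  then have A [measurable]: "A \<in> sets borel" by simp
  have TA: "T -` A \<in> sets borel" using measurable_sets[OF assms(1) A] by simp
  have X: "slab0 \<inter> proj0 -` A \<in> sets borel"
    using measurable_sets[OF measurable_proj0 A] by simp
  have "emeasure (distr flat_measure borel T) A = emeasure lborel (slab0 \<inter> proj0 -` (T -` A))"
    by (subst emeasure_distr) (auto simp: emeasure_flat_measure TA)
  also have "slab0 \<inter> proj0 -` (T -` A) = T -` (slab0 \<inter> proj0 -` A)"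
    by (auto simp: slab comm)
  also have "emeasure lborel \<dots> = emeasure (distr lborel borel T) (slab0 \<inter> proj0 -` A)"
    using X by (subst emeasure_distr) auto
  also have "\<dots> = emeasure flat_measure A" by (simp add: T emeasure_flat_measure)
  finally show "emeasure (distr flat_measure borel T) A = emeasure flat_measure A" .
qed simp

text \<open>Hausdorff measure restricted to the hyperplane and \<open>flat_measure\<close> are
  invariant under translations along it, hence proportional; the factor is found at the unit face,
  where the flat measure is 1.\<close>

lemma hausdorff_hyperplane0:
  fixes A :: "(real ^ 'n) set"
  assumes A: "A \<in> sets borel"
  shows "hausdorff_outer (CARD('n) - 1) (A \<inter> hyperplane0)
     = hausdorff_outer (CARD('n) - 1) (unit_face :: (real ^ 'n) set) * emeasure flat_measure A"
proof -
  let ?k = "CARD('n) - 1"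
  let ?F = "unit_face :: (real ^ 'n) set"
  define M :: "(real ^ 'n) measure" where "M = density (hausdorff_measure ?k) (indicator hyperplane0)"
  have M: "emeasure M B = hausdorff_outer ?k (B \<inter> hyperplane0)" if "B \<in> sets borel" for B
  proof -
    have "emeasure M B = (\<integral>\<^sup>+x. indicator hyperplane0 x * indicator B x \<partial>hausdorff_measure ?k)"
      using that by (simp add: M_def emeasure_density)
    also have "\<dots> = (\<integral>\<^sup>+x. indicator (B \<inter> hyperplane0) x \<partial>hausdorff_measure ?k)"
      by (intro nn_integral_cong) (auto split: split_indicator)
    finally show ?thesis using that by (simp add: emeasure_hausdorff_measure)
  qed
  have sM: "sets M = sets borel" "space M = UNIV" by (simp_all add: M_def)
  have FE: "?F \<inter> hyperplane0 = ?F" by (auto simp: unit_face_eq hyperplane0_def)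
  have trans: "(+) e ` B \<inter> hyperplane0 = (+) e ` (B \<inter> hyperplane0)" if "e \<in> hyperplane0" for e :: "real ^ 'n" and B
    using that by (auto simp: hyperplane0_def)
  have iso: "hausdorff_outer ?k ((+) e ` B) = hausdorff_outer ?k B" for e :: "real ^ 'n" and B
    by (rule hausdorff_outer_isometric) simp
  have borel: "(+) e ` B \<in> sets borel" if "B \<in> sets borel" for e :: "real ^ 'n" and B
  proof -
    have "(+) e ` B = (\<lambda>x. x - e) -` B" by force
    also have "\<dots> \<in> sets borel" using measurable_sets[of "\<lambda>x. x - e" borel borel B] that by simp
    finally show ?thesis .
  qed
  have "emeasure M A * emeasure flat_measure ?F = emeasure M ?F * emeasure flat_measure A"
  proof (rule translation_invariant_measures_proportional[where E = hyperplane0])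
    show "sigma_finite_measure M"
    proof
      \<comment> \<open>Integer translates of the unit face cover the hyperplane, and its complement
        is null for \<open>M\<close>. Without the restriction to the hyperplane the Hausdorff
        measure of this dimension would not be sigma-finite.\<close>
      define v :: "int ^ 'n \<Rightarrow> real ^ 'n" where "v z = (\<chi> i. if i = coord0 then 0 else of_int (z $ i))" for z
      define AA where "AA = insert (- hyperplane0) (range (\<lambda>z. (+) (v z) ` ?F))"
      have v: "v z \<in> hyperplane0" for z by (simp add: v_def hyperplane0_def)
      have "x \<in> \<Union> AA" for x
      proof (cases "x \<in> hyperplane0")
        case True
        define z :: "int ^ 'n" where "z = (\<chi> i. \<lfloor>x $ i\<rfloor>)"
        have "x - v z \<in> ?F"
          using True by (auto simp: unit_face_eq v_def z_def hyperplane0_def) linarith+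
        then have "x \<in> (+) (v z) ` ?F" by (intro image_eqI[of _ _ "x - v z"]) auto
        then show ?thesis by (auto simp: AA_def)
      qed (simp add: AA_def)
      then have "\<Union> AA = space M" using sM by auto
      moreover have "emeasure M a \<noteq> \<infinity>" if "a \<in> AA" for a
      proof -
        from that consider "a = - hyperplane0" | z where "a = (+) (v z) ` ?F" by (auto simp: AA_def)
        then show ?thesis
        proof cases
          case 2
          have "emeasure M a = hausdorff_outer ?k ?F"
            by (simp only: 2 M[OF borel[OF unit_face_borel]] trans[OF v] iso FE)
          then show ?thesis using hausdorff_unit_face_finite[where 'n = 'n] by auto
        qed (simp add: M)
      qed
      moreover have "countable AA" "AA \<subseteq> sets M" by (auto simp: AA_def sM borel)
      ultimately show "\<exists>A. countable A \<and> A \<subseteq> sets M \<and> \<Union> A = space M \<and> (\<forall>a\<in>A. emeasure M a \<noteq> \<infinity>)"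
        by blast
    qed
    show "AE x in M. x \<in> hyperplane0"
      unfolding M_def by (subst AE_density) (auto simp: indicator_def)
    show "AE x in flat_measure. x \<in> (hyperplane0 :: (real ^ 'n) set)"
      by (rule AE_I[of _ _ "- hyperplane0"])
         (auto simp: emeasure_flat_measure hyperplane0_def proj0_nth vimage_def)
    fix e :: "real ^ 'n" assume e: "e \<in> hyperplane0"
    show "distr flat_measure borel ((+) e) = flat_measure"
      by (rule distr_flat_measure)
         (use e in \<open>auto simp: lborel_distr_plus slab0_def hyperplane0_def vec_eq_iff proj0_nth\<close>)
    show "distr M borel ((+) e) = M"
    proof (rule measure_eqI)
      fix B assume "B \<in> sets (distr M borel ((+) e))"
      then have B: "B \<in> sets borel" by simp
      have vim: "(+) e -` B = (+) (- e) ` B" by force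
      have "emeasure (distr M borel ((+) e)) B = emeasure M ((+) (- e) ` B)"
        using B by (subst emeasure_distr) (auto simp: sM vim measurable_cong_sets[OF sM(1) refl])
      also have "\<dots> = emeasure M B"
      proof -
        have "- e \<in> hyperplane0" using e by (simp add: hyperplane0_def)
        then show ?thesis by (simp only: M[OF borel[OF B]] M[OF B] trans iso)
      qed
      finally show "emeasure (distr M borel ((+) e)) B = emeasure M B" .
    qed (simp add: sM)
  next
    show "distr flat_measure borel uminus = (flat_measure :: (real ^ 'n) measure)"
      by (rule distr_flat_measure)
         (auto simp: distr_lborel_uminus slab0_def vec_eq_iff proj0_nth)
  qed (use A sM in \<open>simp_all add: sigma_finite_flat_measure\<close>)
  then show ?thesis
    using A by (simp add: M FE flat_measure_unit_face)
qed

text \<open>Translating by \<open>e\<close> after \<open>G\<close> is translating by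
  \<open>G' e\<close> before it, so the image of Lebesgue measure under \<open>G\<close> is again
  translation invariant. The product form leaves the factor implicit; a test set determines it
  later.\<close>

lemma distr_lborel_linear_proportional:
  fixes G G' :: "'a::euclidean_space \<Rightarrow> 'a"
  assumes G: "linear G" and G': "linear G'" "\<And>x. G (G' x) = x" "\<And>x. G' (G x) = x"
    and A: "A \<in> sets borel" and B: "B \<in> sets borel"
  shows "emeasure lborel (G -` A) * emeasure lborel B = emeasure lborel (G -` B) * emeasure lborel A"
proof -
  let ?N = "distr lborel borel G"
  have [measurable]: "G \<in> borel \<rightarrow>\<^sub>M borel"
    using G by (intro borel_measurable_continuous_onI linear_continuous_on) (simp add: linear_conv_bounded_linear)
  have N: "emeasure ?N X = emeasure lborel (G -` X)" if "X \<in> sets borel" for X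
    using that by (subst emeasure_distr) auto
  have "emeasure ?N A * emeasure lborel B = emeasure ?N B * emeasure lborel A"
  proof (rule translation_invariant_measures_proportional[where E = UNIV])
    show "sigma_finite_measure ?N"
    proof
      have "bounded (G' ` ball 0 (real n))" for n
        using G' by (intro bounded_linear_image) (auto simp: linear_conv_bounded_linear)
      moreover have "G -` ball 0 (real n) = G' ` ball 0 (real n)" for n
      proof (intro set_eqI iffI)
        fix x assume "x \<in> G -` ball 0 (real n)"
        then show "x \<in> G' ` ball 0 (real n)" by (intro image_eqI[of _ _ "G x"]) (simp_all add: G'(3))
      qed (auto simp: G'(2))
      ultimately have "emeasure ?N (ball 0 (real n)) \<noteq> \<infinity>" for n
        using emeasure_bounded_finite[of "G -` ball 0 (real n)"] by (auto simp: N)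
      moreover have "(\<Union>n. ball 0 (real n)) = (UNIV :: 'a set)"
        using reals_Archimedean2 by (auto simp: dist_norm)
      ultimately show "\<exists>A. countable A \<and> A \<subseteq> sets ?N \<and> \<Union> A = space ?N \<and> (\<forall>a\<in>A. emeasure ?N a \<noteq> \<infinity>)"
        by (intro exI[of _ "range (\<lambda>n. ball 0 (real n))"]) auto
    qed
    show "distr ?N borel ((+) e) = ?N" for e
    proof -
      have "distr ?N borel ((+) e) = distr lborel borel (G \<circ> (+) (G' e))"
        using G by (subst distr_distr) (auto simp: comp_def linear_add G'(2))
      also have "\<dots> = distr (distr lborel borel ((+) (G' e))) borel G"
        by (rule distr_distr[symmetric]) auto
      finally show ?thesis by (simp add: lborel_distr_plus)
    qed
  qed (use A B in \<open>auto simp: lborel_distr_plus distr_lborel_uminus lborel.sigma_finite_measure_axioms\<close>)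
  then show ?thesis by (simp add: N A B)
qed

lemma lborel_ball_pos_finite:
  "0 < emeasure lborel (ball (0 :: 'a::euclidean_space) 1)" "emeasure lborel (ball (0 :: 'a) 1) < top"
  by (simp_all add: emeasure_ball)

lemma lborel_ball_cancel:
  assumes "a * emeasure lborel (ball (0 :: 'a::euclidean_space) 1) = emeasure lborel (ball (0 :: 'a) 1) * b"
  shows "a = b"
proof -
  have "emeasure lborel (ball (0 :: 'a) 1) * a = emeasure lborel (ball (0 :: 'a) 1) * b"
    using assms by (subst mult.commute)
  then show ?thesis
    unfolding ennreal_mult_cancel_left using lborel_ball_pos_finite[where 'a = 'a] by auto
qed

text \<open>The factor is 1 because the unit ball is its own preimage.\<close>

lemma lborel_orthogonal_vimage:
  fixes R :: "'a::euclidean_space \<Rightarrow> 'a"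
  assumes R: "orthogonal_transformation R" and A: "A \<in> sets borel"
  shows "emeasure lborel (R -` A) = emeasure lborel A"
proof -
  have "bij R" using R by (rule orthogonal_transformation_bij)
  then have "emeasure lborel (R -` A) * emeasure lborel (ball (0 :: 'a) 1)
      = emeasure lborel (R -` ball 0 1) * emeasure lborel A"
    using R A by (intro distr_lborel_linear_proportional[where G' = "inv R"])
      (auto simp: orthogonal_transformation_linear orthogonal_transformation_inv bij_is_surj surj_f_inv_f bij_is_inj)
  also have "R -` ball 0 1 = ball (0 :: 'a) 1"
    using R by (auto simp: orthogonal_transformation_norm)
  finally show ?thesis by (rule lborel_ball_cancel)
qed

text \<open>Testing the proportionality on the preimage of the ball, whose preimage is the ball
  again, shows that the factor has square 1.\<close>

lemma lborel_involution_vimage: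
  fixes K :: "'a::euclidean_space \<Rightarrow> 'a"
  assumes K: "linear K" "\<And>x. K (K x) = x" and A: "A \<in> sets borel"
  shows "emeasure lborel (K -` A) = emeasure lborel A"
proof -
  let ?B = "ball 0 1 :: 'a set"
  have meas: "K -` ?B \<in> sets borel"
    using K(1) by (intro borel_open open_vimage linear_continuous_on) (auto simp: linear_conv_bounded_linear)
  have "K -` K -` ?B = ?B" using K(2) by auto
  then have "emeasure lborel ?B * emeasure lborel ?B = emeasure lborel (K -` ?B) * emeasure lborel (K -` ?B)"
    using distr_lborel_linear_proportional[of K K "K -` ?B" ?B] K meas by simp
  moreover have "emeasure lborel ?B < top" by (rule lborel_ball_pos_finite)
  ultimately have "emeasure lborel (K -` ?B) = emeasure lborel ?B"
    by (cases "emeasure lborel ?B"; cases "emeasure lborel (K -` ?B)")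
       (simp_all add: ennreal_power flip: power2_eq_square)
  then have "emeasure lborel (K -` A) * emeasure lborel ?B = emeasure lborel ?B * emeasure lborel A"
    using distr_lborel_linear_proportional[of K K A ?B] K A by simp
  then show ?thesis by (rule lborel_ball_cancel)
qed

text \<open>A shear is the product of two linear involutions.\<close>

lemma lborel_shear_vimage:
  fixes e :: "real ^ 'n"
  assumes e: "e $ i = 0" and A: "A \<in> sets borel"
  shows "emeasure lborel ((\<lambda>x. x - (x $ i) *\<^sub>R e) -` A) = emeasure lborel A"
proof -
  define r where "r x = x - (2 * x $ i) *\<^sub>R axis i 1" for x :: "real ^ 'n"
  define K where "K x = r x + (x $ i) *\<^sub>R e" for x :: "real ^ 'n"
  have lin: "linear r" "linear K"
    by (auto simp: r_def K_def algebra_simps intro!: linearI)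
  have inv: "r (r x) = x" "K (K x) = x" for x
    using e by (auto simp: r_def K_def vec_eq_iff axis_def)
  have "(\<lambda>x. x - (x $ i) *\<^sub>R e) -` A = r -` (K -` A)"
    by (auto simp: r_def K_def axis_def vec_eq_iff e)
  moreover have "K -` A \<in> sets borel"
    using measurable_sets[OF borel_measurable_continuous_onI A, of K] lin(2)
    by (auto intro!: linear_continuous_on simp: linear_conv_bounded_linear)
  ultimately show ?thesis
    using lborel_involution_vimage[OF lin(1) inv(1)] lborel_involution_vimage[OF lin(2) inv(2) A] by simp
qed

text \<open>The slab over \<open>B\<close> may be sheared along \<open>\<omega>\<close>, which preserves volume.\<close>

lemma hausdorff_hyperplane:
  fixes n \<omega> :: "real ^ 'n"
  assumes n: "norm n = 1" and w: "\<omega> \<bullet> n \<noteq> 0"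
    and B: "B \<in> sets borel" "\<And>x. x \<in> B \<Longrightarrow> x \<bullet> n = 0"
  shows "hausdorff_outer (CARD('n) - 1) B
     = hausdorff_outer (CARD('n) - 1) (unit_face :: (real ^ 'n) set) *
       emeasure lborel {x. \<bar>x \<bullet> n\<bar> \<le> 1 / 2 \<and> x - ((x \<bullet> n) / (\<omega> \<bullet> n)) *\<^sub>R \<omega> \<in> B}"
proof -
  obtain R :: "real ^ 'n \<Rightarrow> real ^ 'n" where R: "orthogonal_transformation R" "R n = axis coord0 1"
    using orthogonal_transformation_exists[of n "axis coord0 1"] n by (auto simp: norm_axis_1)
  have linR: "linear R" using R by (simp add: orthogonal_transformation_linear)
  have R0: "R x $ coord0 = x \<bullet> n" for x
  proof -
    have "R x $ coord0 = R x \<bullet> R n" by (simp add: R inner_axis)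
    then show ?thesis using R(1) by (metis orthogonal_transformation_def)
  qed
  have Rdist: "dist (R x) (R y) = dist x y" for x y
    using R by (simp add: orthogonal_transformation_isometry)
  have bijR: "bij R" using R(1) by (rule orthogonal_transformation_bij)
  \<comment> \<open>The shear with this \<open>e\<close> sends the image under \<open>R\<close> of
    \<open>\<omega>\<close>, scaled to height 1 over the hyperplane, to the coordinate axis.
    Dropping the coordinate \<open>coord0\<close> then amounts to projecting along
    \<open>\<omega>\<close>.\<close>
  define e where "e = R ((1 / (\<omega> \<bullet> n)) *\<^sub>R \<omega>) - axis coord0 1"
  have e0: "e $ coord0 = 0" using w by (simp add: e_def R0)
  define G where "G = (\<lambda>x. x - (x $ coord0) *\<^sub>R e) \<circ> R"
  have cont: "continuous_on UNIV (\<lambda>x :: real ^ 'n. x - (x $ coord0) *\<^sub>R e)"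
    by (intro continuous_intros)
  have meas: "(\<lambda>x. x - (x $ coord0) *\<^sub>R e) -` X \<in> sets borel" if "X \<in> sets borel" for X
    using measurable_sets[OF borel_measurable_continuous_onI[OF cont] that] by simp
  have G: "emeasure lborel (G -` X) = emeasure lborel X" if "X \<in> sets borel" for X
    using lborel_orthogonal_vimage[OF R(1) meas[OF that]] lborel_shear_vimage[OF e0 that]
    by (simp add: G_def vimage_comp)
  have G0: "G x $ coord0 = x \<bullet> n" for x by (simp add: G_def R0 e0)
  have PG: "proj0 (G x) = R (x - ((x \<bullet> n) / (\<omega> \<bullet> n)) *\<^sub>R \<omega>)" for x
    unfolding proj0_def G0
    by (simp add: G_def R0 e_def linear_diff[OF linR] linear_scale[OF linR] algebra_simps)
  have RB: "R ` B \<in> sets borel"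
  proof -
    have "R ` B = inv R -` B" using bijR by (simp add: bij_vimage_eq_inv_image inv_inv_eq bij_imp_bij_inv)
    moreover have "continuous_on UNIV (inv R)"
      using orthogonal_transformation_inv[OF R(1)]
      by (intro linear_continuous_on) (auto dest: orthogonal_transformation_linear simp: linear_conv_bounded_linear)
    ultimately show ?thesis
      using measurable_sets[OF borel_measurable_continuous_onI B(1), of "inv R"] by simp
  qed
  have "hausdorff_outer (CARD('n) - 1) B = hausdorff_outer (CARD('n) - 1) (R ` B)"
    by (rule hausdorff_outer_isometric[symmetric]) (rule Rdist)
  also have "R ` B = R ` B \<inter> hyperplane0" using B by (auto simp: hyperplane0_def R0)
  also have "hausdorff_outer (CARD('n) - 1) \<dots>
     = hausdorff_outer (CARD('n) - 1) (unit_face :: (real ^ 'n) set) * emeasure flat_measure (R ` B)"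
    by (rule hausdorff_hyperplane0[OF RB])
  also have "emeasure flat_measure (R ` B) = emeasure lborel (G -` (slab0 \<inter> proj0 -` (R ` B)))"
    using measurable_sets[OF measurable_proj0 RB] by (subst G) (auto simp: emeasure_flat_measure[OF RB])
  also have "G -` (slab0 \<inter> proj0 -` (R ` B)) = {x. \<bar>x \<bullet> n\<bar> \<le> 1 / 2 \<and> x - ((x \<bullet> n) / (\<omega> \<bullet> n)) *\<^sub>R \<omega> \<in> B}"
    by (simp add: vimage_def slab0_def G0 PG inj_image_mem_iff[OF bij_is_inj[OF bijR]] Collect_conj_eq)
  finally show ?thesis .
qed

section \<open>The torus\<close>

definition lattice_vec :: "int ^ 'n \<Rightarrow> real ^ 'n" where
  "lattice_vec k = (\<chi> i. 2 * pi * of_int (k $ i))"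

lemma lattice_vec_nth [simp]: "lattice_vec k $ i = 2 * pi * of_int (k $ i)"
  by (simp add: lattice_vec_def)

lemma torus_proj_eq: "torus_proj x = torus_proj y \<longleftrightarrow> (\<exists>k. x = y + lattice_vec k)"
  unfolding torus_proj_eq_iff lattice_rel_def
  by (auto simp: vec_eq_iff algebra_simps)

lemma torus_proj_lattice [simp]: "torus_proj (x + lattice_vec k) = torus_proj x"
  using torus_proj_eq by blast

lemma torus_cases: obtains x where "\<theta> = torus_proj x"
  by (metis torus_proj_rep)

lemma torus_rep_proj: obtains k where "torus_rep (torus_proj x) = x + lattice_vec k"
  using torus_proj_eq[of "torus_rep (torus_proj x)" x] by auto

lemma norm_lattice_vec:
  fixes k :: "int ^ 'n"
  assumes "k \<noteq> 0"
  shows "2 * pi \<le> norm (lattice_vec k)"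
proof -
  obtain i where "k $ i \<noteq> 0" using assms by (auto simp: vec_eq_iff)
  then have "1 \<le> \<bar>real_of_int (k $ i)\<bar>" by linarith
  then have "2 * pi \<le> \<bar>lattice_vec k $ i\<bar>" by (simp add: abs_mult)
  then show ?thesis using component_le_norm_cart[of "lattice_vec k" i] by linarith
qed

lemma dist_torus_proj_le: "dist (torus_proj x) (torus_proj y) \<le> dist x y"
  unfolding dist_torus_def by (rule setdist_le_dist) auto

text \<open>Other representatives change \<open>x - y\<close> by a lattice vector, which is 0 or has
  norm at least \<open>2 * pi\<close>; in the latter case the distance is at least
  \<open>2 * pi - dist x y \<ge> dist x y\<close>.\<close>

lemma dist_torus_proj_eq:
  assumes "dist x y \<le> pi"
  shows "dist (torus_proj x) (torus_proj y) = dist x y"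
proof (rule antisym[OF dist_torus_proj_le])
  show "dist x y \<le> dist (torus_proj x) (torus_proj y)"
    unfolding dist_torus_def
  proof (rule le_setdistI)
    fix u v assume "u \<in> {u. torus_proj u = torus_proj x}" "v \<in> {v. torus_proj v = torus_proj y}"
    then obtain k l where kl: "u = x + lattice_vec k" "v = y + lattice_vec l"
      by (auto simp: torus_proj_eq)
    have uv: "u - v = (x - y) + lattice_vec (k - l)"
      by (simp add: kl vec_eq_iff algebra_simps)
    show "dist x y \<le> dist u v"
    proof (cases "k = l")
      case True
      then show ?thesis by (simp add: kl)
    next
      case False
      then have "2 * pi \<le> norm (lattice_vec (k - l))" by (intro norm_lattice_vec) simp
      also have "\<dots> \<le> norm (u - v) + norm (x - y)"
        using norm_triangle_ineq4[of "u - v" "x - y"] by (simp add: uv)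
      finally show ?thesis using assms by (simp add: dist_norm)
    qed
  qed auto
qed

text \<open>Translating both representatives by the same lattice vector keeps their distance, so the
  first of them may be prescribed.\<close>

lemma torus_dist_lift:
  assumes "dist (torus_proj x) \<theta> < r"
  obtains y where "\<theta> = torus_proj y" "dist x y < r"
proof -
  obtain u v where uv: "torus_proj u = torus_proj x" "torus_proj v = \<theta>" "dist u v < r"
    using setdist_ltE[OF assms[unfolded dist_torus_def] torus_fibre_ne torus_fibre_ne] by blast
  then obtain k where k: "x = u + lattice_vec k" by (metis torus_proj_eq)
  have "dist x (v + lattice_vec k) < r" using uv by (simp add: k)
  then show ?thesis using that[of "v + lattice_vec k"] uv by simp
qed

lemma torus_proj_ball: "torus_proj ` ball x r = ball (torus_proj x) r"
proof (intro set_eqI iffI)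
  fix \<theta> assume "\<theta> \<in> ball (torus_proj x) r"
  then have "dist (torus_proj x) \<theta> < r" by simp
  then obtain y where "\<theta> = torus_proj y" "dist x y < r" by (rule torus_dist_lift)
  then show "\<theta> \<in> torus_proj ` ball x r" by auto
qed (auto intro: le_less_trans[OF dist_torus_proj_le])

lemma continuous_on_torus_proj [continuous_intros]:
  assumes "continuous_on A f"
  shows "continuous_on A (\<lambda>x. torus_proj (f x))"
proof -
  have "continuous_on UNIV (torus_proj :: real ^ 'n \<Rightarrow> _)"
    unfolding continuous_on_iff by (metis dist_torus_proj_le le_less_trans)
  then show ?thesis using continuous_on_compose2[OF _ assms, of UNIV torus_proj] by simp
qed

lemma measurable_torus_proj [measurable]: "torus_proj \<in> borel \<rightarrow>\<^sub>M borel"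
  by (intro borel_measurable_continuous_onI continuous_intros)

lemma continuous_on_torus:
  fixes F :: "'n::finite torus \<Rightarrow> 'a::metric_space"
  assumes "continuous_on UNIV (\<lambda>x. F (torus_proj x))"
  shows "continuous_on UNIV F"
  unfolding continuous_on_iff
proof (intro ballI allI impI)
  fix \<theta> :: "'n torus" and e :: real assume e: "0 < e"
  obtain x where x: "\<theta> = torus_proj x" by (rule torus_cases)
  obtain d where d: "0 < d" "\<And>y. dist y x < d \<Longrightarrow> dist (F (torus_proj y)) (F (torus_proj x)) < e"
    using assms e unfolding continuous_on_iff by (metis UNIV_I)
  have "dist (F \<theta>') (F \<theta>) < e" if "dist \<theta>' \<theta> < d" for \<theta>'
  proof -
    have "dist (torus_proj x) \<theta>' < d" using that x by (simp add: dist_commute)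
    then obtain y where "\<theta>' = torus_proj y" "dist x y < d" by (rule torus_dist_lift)
    then show ?thesis using d(2)[of y] x by (simp add: dist_commute)
  qed
  then show "\<exists>d>0. \<forall>x'\<in>UNIV. dist x' \<theta> < d \<longrightarrow> dist (F x') (F \<theta>) < e" using d(1) by blast
qed

section \<open>The fundamental cube and integration over the torus\<close>

definition fund_cube :: "(real ^ 'n) set" where
  "fund_cube = {x. \<forall>i. 0 \<le> x $ i \<and> x $ i < 2 * pi}"

lemma fund_cube_borel [measurable]: "fund_cube \<in> sets (borel :: (real ^ 'n) measure)"
proof -
  have "(fund_cube :: (real ^ 'n) set) = (\<Inter>i. {x. 0 \<le> x $ i} \<inter> {x. x $ i < 2 * pi})"
    by (auto simp: fund_cube_def)
  moreover have "(\<Inter>i. {x :: real ^ 'n. 0 \<le> x $ i} \<inter> {x. x $ i < 2 * pi}) \<in> sets borel"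
    by (intro sets.finite_INT sets.Int borel_closed borel_open closed_Collect_le open_Collect_less continuous_intros) auto
  ultimately show ?thesis by simp
qed

lemma fund_cube_translate:
  fixes x :: "real ^ 'n"
  obtains k where "x + lattice_vec k \<in> fund_cube"
proof -
  define k :: "int ^ 'n" where "k = (\<chi> i. - \<lfloor>x $ i / (2 * pi)\<rfloor>)"
  have "0 \<le> x $ i + 2 * pi * of_int (k $ i) \<and> x $ i + 2 * pi * of_int (k $ i) < 2 * pi" for i
  proof -
    have "real_of_int \<lfloor>x $ i / (2 * pi)\<rfloor> \<le> x $ i / (2 * pi)"
      "x $ i / (2 * pi) < real_of_int \<lfloor>x $ i / (2 * pi)\<rfloor> + 1" by linarith+
    then have "real_of_int \<lfloor>x $ i / (2 * pi)\<rfloor> * (2 * pi) \<le> x $ i"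
      "x $ i < (real_of_int \<lfloor>x $ i / (2 * pi)\<rfloor> + 1) * (2 * pi)"
      by (simp_all only: pos_le_divide_eq pos_divide_less_eq mult_pos_pos pi_gt_zero zero_less_numeral)
    then show ?thesis by (simp add: k_def algebra_simps)
  qed
  then show ?thesis using that[of k] by (simp add: fund_cube_def)
qed

lemma fund_cube_unique:
  assumes "x + lattice_vec k \<in> fund_cube" "x + lattice_vec l \<in> fund_cube"
  shows "k = l"
proof -
  have "k $ i = l $ i" for i
  proof -
    have "0 \<le> x $ i + 2 * pi * of_int (k $ i)" "x $ i + 2 * pi * of_int (k $ i) < 2 * pi"
      "0 \<le> x $ i + 2 * pi * of_int (l $ i)" "x $ i + 2 * pi * of_int (l $ i) < 2 * pi"
      using assms by (auto simp: fund_cube_def)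
    then have "2 * pi * (real_of_int (k $ i) - of_int (l $ i)) < 2 * pi * 1"
      "2 * pi * (real_of_int (l $ i) - of_int (k $ i)) < 2 * pi * 1"
      unfolding right_diff_distrib by linarith+
    then have "real_of_int (k $ i) - of_int (l $ i) < 1" "real_of_int (l $ i) - of_int (k $ i) < 1"
      by (subst (asm) mult_less_cancel_left_pos; simp)+
    then show ?thesis by linarith
  qed
  then show ?thesis by (simp add: vec_eq_iff)
qed

lemma compact_UNIV_torus: "compact (UNIV :: 'n::finite torus set)"
proof -
  have "\<theta> \<in> torus_proj ` cbox 0 (\<chi> i. 2 * pi)" for \<theta> :: "'n torus"
  proof -
    obtain x where x: "\<theta> = torus_proj x" by (rule torus_cases)
    obtain k where "x + lattice_vec k \<in> fund_cube" by (rule fund_cube_translate)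
    then have "x + lattice_vec k \<in> cbox 0 (\<chi> i. 2 * pi)"
      by (auto simp: fund_cube_def mem_box_cart less_imp_le)
    then show ?thesis using x torus_proj_lattice by (metis image_eqI)
  qed
  then have "(UNIV :: 'n torus set) = torus_proj ` cbox 0 (\<chi> i. 2 * pi)" by blast
  moreover have "compact (torus_proj ` cbox 0 (\<chi> i. 2 * pi) :: 'n torus set)"
    by (intro compact_continuous_image continuous_intros compact_cbox)
  ultimately show ?thesis by simp
qed

lemma lborel_translate_nn_integral:
  fixes f :: "'a::euclidean_space \<Rightarrow> ennreal"
  assumes [measurable]: "f \<in> borel_measurable borel"
  shows "(\<integral>\<^sup>+x. f (x + v) \<partial>lborel) = (\<integral>\<^sup>+x. f x \<partial>lborel)"
proof -
  have "(\<integral>\<^sup>+x. f x \<partial>lborel) = (\<integral>\<^sup>+x. f x \<partial>distr lborel borel ((+) v))"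
    by (simp add: lborel_distr_plus)
  also have "\<dots> = (\<integral>\<^sup>+x. f (v + x) \<partial>lborel)" by (subst nn_integral_distr) auto
  finally show ?thesis by (simp add: add.commute)
qed

text \<open>The lattice translates of the half-open cube tile the space. Insert the sum of their
  indicators, which is 1, exchange sum and integral, and translate each term back to the
  cube.\<close>

lemma nn_integral_unfold:
  fixes F :: "real ^ 'n \<Rightarrow> ennreal"
  assumes [measurable]: "F \<in> borel_measurable borel"
  shows "(\<integral>\<^sup>+x. F x \<partial>lborel)
     = (\<integral>\<^sup>+x. (\<integral>\<^sup>+k. F (x + lattice_vec k) \<partial>count_space UNIV) * indicator fund_cube x \<partial>lborel)"
proof -
  have one: "(\<integral>\<^sup>+k. indicator fund_cube (x + lattice_vec k) \<partial>count_space UNIV) = (1 :: ennreal)" for x :: "real ^ 'n"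
  proof -
    obtain k where k: "x + lattice_vec k \<in> fund_cube" by (rule fund_cube_translate)
    then have "(\<lambda>l. indicator fund_cube (x + lattice_vec l)) = (indicator {k} :: _ \<Rightarrow> ennreal)"
      by (auto simp: fun_eq_iff indicator_def dest: fund_cube_unique)
    then show ?thesis by simp
  qed
  have "(\<integral>\<^sup>+x. F x \<partial>lborel) = (\<integral>\<^sup>+x. (\<integral>\<^sup>+k. F x * indicator fund_cube (x + lattice_vec k) \<partial>count_space UNIV) \<partial>lborel)"
    by (simp add: nn_integral_cmult one)
  also have "\<dots> = (\<integral>\<^sup>+k. (\<integral>\<^sup>+x. F x * indicator fund_cube (x + lattice_vec k) \<partial>lborel) \<partial>count_space UNIV)"
    by (rule nn_integral_count_space_nn_integral) auto
  also have "\<dots> = (\<integral>\<^sup>+k. (\<integral>\<^sup>+x. F (x + lattice_vec (- k)) * indicator fund_cube x \<partial>lborel) \<partial>count_space UNIV)"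
  proof (rule nn_integral_cong)
    fix k :: "int ^ 'n"
    have inv: "x + lattice_vec k + lattice_vec (- k) = x" for x :: "real ^ 'n"
      by (simp add: vec_eq_iff)
    show "(\<integral>\<^sup>+x. F x * indicator fund_cube (x + lattice_vec k) \<partial>lborel)
       = (\<integral>\<^sup>+x. F (x + lattice_vec (- k)) * indicator fund_cube x \<partial>lborel)"
      using lborel_translate_nn_integral[of "\<lambda>x. F (x + lattice_vec (- k)) * indicator fund_cube x" "lattice_vec k"]
      by (simp add: inv)
  qed
  also have "\<dots> = (\<integral>\<^sup>+k. (\<integral>\<^sup>+x. F (x + lattice_vec k) * indicator fund_cube x \<partial>lborel) \<partial>count_space UNIV)"
    by (rule nn_integral_bij_count_space) (rule bij_uminus)
  also have "\<dots> = (\<integral>\<^sup>+x. (\<integral>\<^sup>+k. F (x + lattice_vec k) * indicator fund_cube x \<partial>count_space UNIV) \<partial>lborel)"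
    by (rule nn_integral_count_space_nn_integral[symmetric]) auto
  finally show ?thesis by (simp add: nn_integral_multc)
qed

lemma space_torus_lebesgue [simp]: "space torus_lebesgue = UNIV"
  and sets_torus_lebesgue [simp, measurable_cong]: "sets torus_lebesgue = sets borel"
  by (auto simp: torus_lebesgue_def)

lemma nn_integral_torus:
  fixes F :: "'n::finite torus \<Rightarrow> ennreal"
  assumes [measurable]: "F \<in> borel_measurable borel"
  shows "(\<integral>\<^sup>+\<theta>. F \<theta> \<partial>torus_lebesgue) = (\<integral>\<^sup>+x. F (torus_proj x) * indicator fund_cube x \<partial>lborel)"
proof -
  have "torus_proj \<in> restrict_space lborel (fund_cube :: (real ^ 'n) set) \<rightarrow>\<^sub>M borel"
    by (rule measurable_restrict_space1) simp
  then show ?thesis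
    unfolding torus_lebesgue_def fund_cube_def[symmetric]
    by (subst nn_integral_distr) (auto simp: nn_integral_restrict_space)
qed

section \<open>Translations of the torus\<close>

definition torus_shift :: "real ^ 'n \<Rightarrow> 'n torus \<Rightarrow> 'n torus" where
  "torus_shift v \<theta> = torus_proj (torus_rep \<theta> + v)"

lemma torus_shift_proj [simp]: "torus_shift v (torus_proj x) = torus_proj (x + v)"
proof -
  obtain k where "torus_rep (torus_proj x) = x + lattice_vec k" by (rule torus_rep_proj)
  then show ?thesis
    unfolding torus_shift_def by (metis add.assoc add.commute torus_proj_lattice)
qed

lemma continuous_on_torus_shift: "continuous_on UNIV (torus_shift v)"
  by (rule continuous_on_torus) (auto intro!: continuous_intros)

lemma measurable_torus_shift [measurable]: "torus_shift v \<in> borel \<rightarrow>\<^sub>M borel"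
  by (intro borel_measurable_continuous_onI continuous_on_torus_shift)

text \<open>Turns the integral of a periodised function into one over the whole space;
  \<open>flux_local\<close> applies it to a function supported near a single sheet of the lifted
  zero set.\<close>

lemma nn_integral_torus_unfold:
  fixes F :: "'n::finite torus \<Rightarrow> ennreal" and F' :: "real ^ 'n \<Rightarrow> ennreal"
  assumes [measurable]: "F \<in> borel_measurable borel" "F' \<in> borel_measurable borel"
    and eq: "\<And>x. F (torus_proj x) = (\<integral>\<^sup>+k. F' (x + lattice_vec k) \<partial>count_space UNIV)"
  shows "(\<integral>\<^sup>+\<theta>. F \<theta> \<partial>torus_lebesgue) = (\<integral>\<^sup>+x. F' x \<partial>lborel)"
  by (simp add: nn_integral_torus nn_integral_unfold[of F'] eq)

text \<open>A shift moves the fundamental cube off itself. After unfolding to the whole space only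
  the translation invariance of Lebesgue measure is left.\<close>

lemma nn_integral_torus_shift:
  fixes F :: "'n::finite torus \<Rightarrow> ennreal"
  assumes [measurable]: "F \<in> borel_measurable borel"
  shows "(\<integral>\<^sup>+\<theta>. F (torus_shift v \<theta>) \<partial>torus_lebesgue) = (\<integral>\<^sup>+\<theta>. F \<theta> \<partial>torus_lebesgue)"
proof -
  let ?F' = "\<lambda>x. F (torus_proj x) * indicator fund_cube x"
  have fold: "(\<integral>\<^sup>+k. ?F' (x + lattice_vec k) \<partial>count_space UNIV) = F (torus_proj x)" for x :: "real ^ 'n"
  proof -
    obtain k where k: "x + lattice_vec k \<in> fund_cube" by (rule fund_cube_translate)
    then have "(\<lambda>l. ?F' (x + lattice_vec l)) = (\<lambda>l. F (torus_proj x) * indicator {k} l)"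
      by (auto simp: fun_eq_iff indicator_def dest: fund_cube_unique)
    then show ?thesis by (simp add: nn_integral_cmult)
  qed
  have "(\<integral>\<^sup>+\<theta>. F (torus_shift v \<theta>) \<partial>torus_lebesgue) = (\<integral>\<^sup>+x. ?F' (x + v) \<partial>lborel)"
  proof (rule nn_integral_torus_unfold)
    show "F (torus_shift v (torus_proj x)) = (\<integral>\<^sup>+k. ?F' (x + lattice_vec k + v) \<partial>count_space UNIV)" for x
      using fold[of "x + v"] by (simp add: add.assoc add.commute[of v])
  qed measurable
  also have "\<dots> = (\<integral>\<^sup>+x. ?F' x \<partial>lborel)"
    by (rule lborel_translate_nn_integral) measurable
  finally show ?thesis by (simp add: nn_integral_torus)
qed

lemma distr_torus_shift: "distr torus_lebesgue borel (torus_shift v) = torus_lebesgue"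
proof (rule measure_eqI)
  fix A assume "A \<in> sets (distr torus_lebesgue borel (torus_shift v))"
  then have [measurable]: "A \<in> sets borel" by simp
  have "emeasure (distr torus_lebesgue borel (torus_shift v)) A
      = (\<integral>\<^sup>+\<theta>. indicator A \<theta> \<partial>distr torus_lebesgue borel (torus_shift v))" by simp
  also have "\<dots> = (\<integral>\<^sup>+\<theta>. indicator A (torus_shift v \<theta>) \<partial>torus_lebesgue)"
    by (subst nn_integral_distr) auto
  also have "\<dots> = emeasure torus_lebesgue A"
    by (subst nn_integral_torus_shift) auto
  finally show "emeasure (distr torus_lebesgue borel (torus_shift v)) A = emeasure torus_lebesgue A" .
qed simp

lemma integral_torus_shift:
  fixes F :: "'n::finite torus \<Rightarrow> real"
  assumes [measurable]: "F \<in> borel_measurable borel"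
  shows "(LINT \<theta>|torus_lebesgue. F (torus_shift v \<theta>)) = (LINT \<theta>|torus_lebesgue. F \<theta>)"
proof -
  have "(LINT \<theta>|torus_lebesgue. F \<theta>) = (LINT \<theta>|distr torus_lebesgue borel (torus_shift v). F \<theta>)"
    by (simp add: distr_torus_shift)
  also have "\<dots> = (LINT \<theta>|torus_lebesgue. F (torus_shift v \<theta>))"
    by (rule integral_distr) auto
  finally show ?thesis by simp
qed

lemma emeasure_torus_lebesgue_UNIV:
  "emeasure torus_lebesgue (UNIV :: 'n::finite torus set) = ennreal ((2 * pi) ^ CARD('n))"
proof -
  let ?b = "(\<chi> i. 2 * pi) :: real ^ 'n"
  have "emeasure torus_lebesgue (UNIV :: 'n torus set) = (\<integral>\<^sup>+\<theta>. 1 \<partial>(torus_lebesgue :: 'n torus measure))" by simp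
  also have "\<dots> = emeasure lborel (fund_cube :: (real ^ 'n) set)"
    by (subst nn_integral_torus) auto
  also have "\<dots> = ennreal ((2 * pi) ^ CARD('n))"
  proof (rule antisym)
    have "emeasure lborel (fund_cube :: (real ^ 'n) set) \<le> emeasure lborel (cbox 0 ?b)"
      by (rule emeasure_mono) (auto simp: fund_cube_def mem_box_cart less_imp_le)
    then show "emeasure lborel (fund_cube :: (real ^ 'n) set) \<le> ennreal ((2 * pi) ^ CARD('n))"
      by (simp add: emeasure_lborel_cbox_cart)
    have "emeasure lborel (cbox 0 ?b) = emeasure lborel (box 0 ?b)"
      by (simp add: emeasure_lborel_cbox_eq emeasure_lborel_box_eq)
    also have "\<dots> \<le> emeasure lborel (fund_cube :: (real ^ 'n) set)"
      by (rule emeasure_mono) (auto simp: fund_cube_def mem_box_cart less_imp_le)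
    finally show "ennreal ((2 * pi) ^ CARD('n)) \<le> emeasure lborel (fund_cube :: (real ^ 'n) set)"
      by (simp add: emeasure_lborel_cbox_cart)
  qed
  finally show ?thesis .
qed

lemma finite_measure_torus: "finite_measure (torus_lebesgue :: 'n::finite torus measure)"
  by (rule finite_measureI) (simp add: emeasure_torus_lebesgue_UNIV)

lemma torus_total_mass: "measure torus_lebesgue (UNIV :: 'n::finite torus set) = (2 * pi) ^ CARD('n)"
  by (simp add: measure_def emeasure_torus_lebesgue_UNIV)

lemma torus_continuous_bounded:
  fixes F :: "'n::finite torus \<Rightarrow> real"
  assumes "continuous_on UNIV F"
  obtains B where "0 < B" "\<And>\<theta>. \<bar>F \<theta>\<bar> \<le> B"
proof -
  have "bounded (range F)"
    using compact_continuous_image[OF assms compact_UNIV_torus] by (rule compact_imp_bounded)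
  then show ?thesis using that unfolding bounded_pos by auto
qed

lemma torus_continuous_integrable:
  fixes F :: "'n::finite torus \<Rightarrow> real"
  assumes "continuous_on UNIV F"
  shows "integrable torus_lebesgue F"
proof -
  obtain B where "\<And>\<theta>. \<bar>F \<theta>\<bar> \<le> B" using torus_continuous_bounded[OF assms] by blast
  then show ?thesis
    using borel_measurable_continuous_onI[OF assms]
    by (intro finite_measure.integrable_const_bound[OF finite_measure_torus, of _ B]) auto
qed

lemma torus_integral_bound:
  fixes F :: "'n::finite torus \<Rightarrow> real"
  assumes "continuous_on UNIV F" "\<And>\<theta>. \<bar>F \<theta>\<bar> \<le> B"
  shows "\<bar>LINT \<theta>|torus_lebesgue. F \<theta>\<bar> \<le> (2 * pi) ^ CARD('n) * B"
proof -
  have "\<bar>LINT \<theta>|torus_lebesgue. F \<theta>\<bar> \<le> (LINT \<theta>|torus_lebesgue. \<bar>F \<theta>\<bar>)"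
    by (rule integral_abs_bound)
  also have "\<dots> \<le> (LINT \<theta>|(torus_lebesgue :: 'n torus measure). B)"
    using assms finite_measure.integrable_const[OF finite_measure_torus]
    by (intro integral_mono torus_continuous_integrable continuous_intros) auto
  finally show ?thesis by (simp add: torus_total_mass)
qed

section \<open>Equidistribution of nonresonant lines\<close>

text \<open>The phase \<open>b\<close> accounts for sines as well, so a product of two atoms is a
  sum of two atoms. The choice made by \<open>torus_rep\<close> does not matter because the
  frequencies are integers, see \<open>cos_lattice\<close>.\<close>

inductive_set trig_poly :: "('n::finite torus \<Rightarrow> real) set" where
  atom: "(\<lambda>\<theta>. a * cos ((\<Sum>i\<in>UNIV. of_int ((l :: int ^ 'n) $ i) * torus_rep \<theta> $ i) + b)) \<in> trig_poly"
| add: "f \<in> trig_poly \<Longrightarrow> g \<in> trig_poly \<Longrightarrow> (\<lambda>\<theta>. f \<theta> + g \<theta>) \<in> trig_poly"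

lemma cos_lattice:
  fixes l :: "int ^ 'n"
  shows "cos ((\<Sum>i\<in>UNIV. of_int (l $ i) * torus_rep (torus_proj x) $ i) + b)
     = cos ((\<Sum>i\<in>UNIV. of_int (l $ i) * x $ i) + b)"
proof -
  obtain k where k: "torus_rep (torus_proj x) = x + lattice_vec k" by (rule torus_rep_proj)
  have "(\<Sum>i\<in>UNIV. of_int (l $ i) * torus_rep (torus_proj x) $ i) + b
     = ((\<Sum>i\<in>UNIV. of_int (l $ i) * x $ i) + b) + 2 * pi * of_int (\<Sum>i\<in>UNIV. l $ i * k $ i)"
    unfolding k by (simp add: algebra_simps sum.distrib sum_distrib_left)
  moreover have "cos (y + 2 * pi * of_int m) = cos y" for y :: real and m
    using sin_cos_eq_iff[of "y + 2 * pi * of_int m" y] by blast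
  ultimately show ?thesis by (simp only:)
qed

lemma trig_poly_continuous: "f \<in> trig_poly \<Longrightarrow> continuous_on UNIV f"
proof (induction rule: trig_poly.induct)
  case (atom a l b)
  show ?case
    by (rule continuous_on_torus, subst cos_lattice) (intro continuous_intros)
qed (intro continuous_intros)

lemma cos_product:
  "(a :: real) * cos x * (a' * cos y) = (a * a' / 2) * cos (x - y) + (a * a' / 2) * cos (x + y)"
  by (simp add: cos_add cos_diff algebra_simps)

lemma trig_poly_mult:
  assumes "f \<in> trig_poly" "g \<in> trig_poly"
  shows "(\<lambda>\<theta>. f \<theta> * g \<theta>) \<in> trig_poly"
  using assms(1)
proof (induction rule: trig_poly.induct)
  case (atom a l b)
  show ?case using assms(2)
  proof (induction rule: trig_poly.induct)
    case (atom a' l' b')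
    let ?s = "\<lambda>l \<theta>. \<Sum>i\<in>UNIV. of_int (l $ i) * torus_rep \<theta> $ i"
    have eq: "(\<lambda>\<theta>. a * cos (?s l \<theta> + b) * (a' * cos (?s l' \<theta> + b')))
      = (\<lambda>\<theta>. (a * a' / 2) * cos (?s (l - l') \<theta> + (b - b')) + (a * a' / 2) * cos (?s (l + l') \<theta> + (b + b')))"
    proof
      fix \<theta>
      have "?s (l - l') \<theta> + (b - b') = (?s l \<theta> + b) - (?s l' \<theta> + b')"
        "?s (l + l') \<theta> + (b + b') = (?s l \<theta> + b) + (?s l' \<theta> + b')"
        by (simp_all add: algebra_simps sum.distrib sum_subtractf)
      then show "a * cos (?s l \<theta> + b) * (a' * cos (?s l' \<theta> + b'))
        = (a * a' / 2) * cos (?s (l - l') \<theta> + (b - b')) + (a * a' / 2) * cos (?s (l + l') \<theta> + (b + b'))"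
        by (simp only: cos_product)
    qed
    show ?case unfolding eq by (rule trig_poly.add[OF trig_poly.atom trig_poly.atom])
  next
    case (add f g)
    then show ?case using trig_poly.add[OF add.IH] by (simp add: algebra_simps)
  qed
next
  case (add f g)
  then show ?case using trig_poly.add[OF add.IH] by (simp add: algebra_simps)
qed

text \<open>Stone-Weierstrass. Two points that differ modulo \<open>2 * pi\<close> in coordinate
  \<open>i\<close> are separated by the cosine of that coordinate, with the phase that makes it 1 at
  one of them.\<close>

lemma trig_poly_dense:
  fixes c :: "'n::finite torus \<Rightarrow> real"
  assumes "continuous_on UNIV c" "0 < e"
  obtains g where "g \<in> trig_poly" "\<And>\<theta>. \<bar>c \<theta> - g \<theta>\<bar> < e"
proof -
  interpret function_ring_on "trig_poly :: ('n torus \<Rightarrow> real) set" UNIV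
  proof
    show "(\<lambda>_. a) \<in> (trig_poly :: ('n torus \<Rightarrow> real) set)" for a
      using trig_poly.atom[of a 0 0] by simp
    fix \<theta> \<theta>' :: "'n torus" assume "\<theta> \<noteq> \<theta>'"
    moreover obtain x where x: "\<theta> = torus_proj x" by (rule torus_cases)
    moreover obtain y where y: "\<theta>' = torus_proj y" by (rule torus_cases)
    ultimately have ne: "\<not> lattice_rel x y" by (simp add: torus_proj_eq_iff)
    have "\<exists>i. \<forall>k::int. x $ i - y $ i \<noteq> 2 * pi * of_int k"
    proof (rule ccontr)
      assume "\<not> ?thesis"
      then obtain k :: "'n \<Rightarrow> int" where "\<And>i. x $ i - y $ i = 2 * pi * of_int (k i)" by metis
      then have "lattice_rel x y"
        unfolding lattice_rel_def by (intro exI[of _ "\<chi> i. k i"]) simp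
      with ne show False ..
    qed
    then obtain i where i: "\<And>k::int. x $ i - y $ i \<noteq> 2 * pi * of_int k" by blast
    define l :: "int ^ 'n" where "l = axis i 1"
    have l: "(\<Sum>j\<in>UNIV. of_int (l $ j) * z $ j) = z $ i" for z :: "real ^ 'n"
      by (simp add: l_def axis_def if_distrib[of of_int] if_distrib[of "\<lambda>x. x * _"] cong: if_cong)
    let ?f = "\<lambda>\<theta>. 1 * cos ((\<Sum>j\<in>UNIV. of_int (l $ j) * torus_rep \<theta> $ j) + (- y $ i))"
    have "?f \<theta>' = 1" unfolding y by (subst cos_lattice) (simp add: l)
    moreover have "?f \<theta> = cos (x $ i - y $ i)" unfolding x by (subst cos_lattice) (simp add: l)
    moreover have "cos (x $ i - y $ i) \<noteq> 1"
      using i by (auto simp: cos_one_2pi_int mult.commute mult.left_commute)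
    ultimately have "?f \<theta> \<noteq> ?f \<theta>'" by simp
    then show "\<exists>f\<in>trig_poly. f \<theta> \<noteq> f \<theta>'" by (rule bexI[where x = ?f]) (rule trig_poly.atom)
  qed ((rule compact_UNIV_torus) | (rule trig_poly_continuous, assumption) | (rule trig_poly.add, assumption, assumption) | (rule trig_poly_mult, assumption, assumption))+
  obtain g where "g \<in> trig_poly" "\<forall>\<theta>\<in>UNIV. \<bar>c \<theta> - g \<theta>\<bar> < e"
    by (rule bexE[OF Stone_Weierstrass_basic[OF assms]])
  then show ?thesis using that by blast
qed

section \<open>Time averages along lines\<close>

definition time_avg :: "real ^ 'n \<Rightarrow> ('n::finite torus \<Rightarrow> real) \<Rightarrow> real \<Rightarrow> real" where
  "time_avg \<omega> c L = (LINT t:{0..L}|lborel. c (torus_proj (t *\<^sub>R \<omega>))) / L"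

lemma line_integrable:
  fixes c :: "'n::finite torus \<Rightarrow> real"
  assumes "continuous_on UNIV c"
  shows "set_integrable lborel {a..b} (\<lambda>t. c (torus_proj (x + t *\<^sub>R \<omega>)))"
  by (rule borel_integrable_atLeastAtMost')
     (rule continuous_on_compose2[OF assms], auto intro!: continuous_intros)

lemma time_avg_close:
  fixes c g :: "'n::finite torus \<Rightarrow> real"
  assumes c: "continuous_on UNIV c" and g: "continuous_on UNIV g"
    and e: "\<And>\<theta>. \<bar>c \<theta> - g \<theta>\<bar> \<le> e" and L: "0 < L"
  shows "\<bar>time_avg \<omega> c L - time_avg \<omega> g L\<bar> \<le> e"
proof -
  note int = line_integrable[OF c, of 0 L 0 \<omega>, simplified] line_integrable[OF g, of 0 L 0 \<omega>, simplified]
  have "\<bar>(LINT t:{0..L}|lborel. c (torus_proj (t *\<^sub>R \<omega>)) - g (torus_proj (t *\<^sub>R \<omega>)))\<bar>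
      \<le> (LINT t:{0..L}|lborel. \<bar>c (torus_proj (t *\<^sub>R \<omega>)) - g (torus_proj (t *\<^sub>R \<omega>))\<bar>)"
    using set_integral_norm_bound[OF set_integral_diff(1)[OF int]] by simp
  also have "\<dots> \<le> (LINT t:{0..L}|lborel. e)"
    using set_integrable_abs[OF set_integral_diff(1)[OF int]] e
    by (intro set_integral_mono) (auto intro: borel_integrable_atLeastAtMost'[OF continuous_on_const])
  also have "\<dots> = L * e" using L by (simp add: set_lebesgue_integral_def)
  finally show ?thesis
    using L unfolding time_avg_def set_integral_diff(2)[OF int] diff_divide_distrib[symmetric] abs_divide
    by (simp add: field_simps)
qed

text \<open>For \<open>l \<noteq> 0\<close> both averages vanish: a shift by half a period changes
  the sign of the atom, and along the line the frequency is nonzero by nonresonance, so the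
  antiderivative is bounded and is divided by \<open>L\<close>.\<close>

lemma equidistribution_atom:
  fixes \<omega> :: "real ^ 'n" and l :: "int ^ 'n" and a b :: real
  assumes \<omega>: "nonresonant \<omega>"
  defines "f \<equiv> \<lambda>\<theta>. a * cos ((\<Sum>i\<in>UNIV. of_int (l $ i) * torus_rep \<theta> $ i) + b)"
  shows "(time_avg \<omega> f \<longlongrightarrow> (LINT \<theta>|torus_lebesgue. f \<theta>) / (2 * pi) ^ CARD('n)) at_top"
proof (cases "l = 0")
  case True
  have "time_avg \<omega> f L = a * cos b" if "0 < L" for L
    using that by (simp add: time_avg_def f_def True set_lebesgue_integral_def)
  then have "((\<lambda>L. time_avg \<omega> f L) \<longlongrightarrow> a * cos b) at_top"
    by (intro tendsto_eventually) (auto simp: eventually_at_top_dense intro!: exI[of _ 0])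
  then show ?thesis by (simp add: f_def True torus_total_mass)
next
  case False
  have cont: "continuous_on UNIV f"
    unfolding f_def by (rule trig_poly_continuous[OF trig_poly.atom])
  define s where "s x = (\<Sum>i\<in>UNIV. of_int (l $ i) * x $ i)" for x :: "real ^ 'n"
  have f: "f (torus_proj x) = a * cos (s x + b)" for x
    unfolding f_def s_def by (subst cos_lattice) simp
  have s: "s (x + y) = s x + s y" "s (t *\<^sub>R x) = t * s x" for x y t
    by (simp_all add: s_def algebra_simps sum.distrib sum_distrib_left)
  have "(LINT \<theta>|torus_lebesgue. f \<theta>) = 0"
  proof -
    define w :: "real ^ 'n" where "w = (\<chi> i. of_int (l $ i))"
    have "s w \<noteq> 0"
    proof
      assume "s w = 0"
      then have "w = 0" by (simp add: s_def w_def sum_nonneg_eq_0_iff vec_eq_iff)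
      then show False using False by (auto simp: w_def vec_eq_iff)
    qed
    then have "s ((pi / s w) *\<^sub>R w) = pi" by (simp add: s)
    then have "f (torus_shift ((pi / s w) *\<^sub>R w) \<theta>) = - f \<theta>" for \<theta>
      by (rule_tac torus_cases[of \<theta>]) (simp add: f s add.commute add.left_commute)
    then show ?thesis
      using integral_torus_shift[of f "(pi / s w) *\<^sub>R w"] borel_measurable_continuous_onI[OF cont] by simp
  qed
  moreover have "(time_avg \<omega> f \<longlongrightarrow> 0) at_top"
  proof -
    define m where "m = s \<omega>"
    have m: "m \<noteq> 0" using \<omega> False by (simp add: m_def s_def nonresonant_def mult.commute)
    have int: "(LINT t:{0..L}|lborel. f (torus_proj (t *\<^sub>R \<omega>))) = a * (sin (m * L + b) - sin b) / m" if "0 < L" for L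
    proof -
      have "(LINT t:{0..L}|lborel. f (torus_proj (t *\<^sub>R \<omega>))) = (LBINT t=ereal 0..ereal L. a * cos (m * t + b))"
        unfolding interval_integral_Icc[OF less_imp_le[OF that]] by (simp add: f s m_def mult.commute)
      also have "\<dots> = a * sin (m * L + b) / m - a * sin (m * 0 + b) / m"
        using m that by (intro interval_integral_FTC_finite[of 0 L "\<lambda>t. a * cos (m * t + b)" "\<lambda>t. a * sin (m * t + b) / m"])
          (auto intro!: continuous_intros derivative_eq_intros simp: has_real_derivative_iff_has_vector_derivative[symmetric])
      finally show ?thesis by (simp add: algebra_simps diff_divide_distrib)
    qed
    have "\<forall>\<^sub>F L in at_top. norm (time_avg \<omega> f L) \<le> (\<bar>a\<bar> * 2 / \<bar>m\<bar>) * (1 / L)"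
      unfolding eventually_at_top_dense
    proof (intro exI allI impI)
      fix L :: real assume L: "0 < L"
      have "\<bar>sin (m * L + b) - sin b\<bar> \<le> 2"
        using abs_sin_le_one[of "m * L + b"] abs_sin_le_one[of b] by linarith
      then have "\<bar>a\<bar> * \<bar>sin (m * L + b) - sin b\<bar> \<le> \<bar>a\<bar> * 2" by (intro mult_left_mono) auto
      then show "norm (time_avg \<omega> f L) \<le> (\<bar>a\<bar> * 2 / \<bar>m\<bar>) * (1 / L)"
        using L m by (simp add: time_avg_def int abs_mult divide_right_mono)
    qed
    moreover have "((\<lambda>L. (\<bar>a\<bar> * 2 / \<bar>m\<bar>) * (1 / L)) \<longlongrightarrow> 0) at_top"
      by (intro tendsto_mult_right_zero tendsto_divide_0[OF tendsto_const]
          filterlim_at_top_imp_at_infinity filterlim_ident)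
    ultimately show ?thesis by (rule Lim_null_comparison)
  qed
  ultimately show ?thesis by simp
qed

text \<open>Weyl's argument: space and time averages are continuous in the uniform norm, so
  trigonometric polynomials suffice.\<close>

theorem equidistribution:
  fixes \<omega> :: "real ^ 'n" and c :: "'n::finite torus \<Rightarrow> real"
  assumes \<omega>: "nonresonant \<omega>" and c: "continuous_on UNIV c"
  shows "(time_avg \<omega> c \<longlongrightarrow> (LINT \<theta>|torus_lebesgue. c \<theta>) / (2 * pi) ^ CARD('n)) at_top"
proof -
  have trig: "(time_avg \<omega> f \<longlongrightarrow> (LINT \<theta>|torus_lebesgue. f \<theta>) / (2 * pi) ^ CARD('n)) at_top"
    if "f \<in> trig_poly" for f
    using that
  proof (induction rule: trig_poly.induct)
    case (atom a l b)
    then show ?case by (rule equidistribution_atom[OF \<omega>])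
  next
    case (add f g)
    note fg = trig_poly_continuous[OF add.hyps(1)] trig_poly_continuous[OF add.hyps(2)]
    have "time_avg \<omega> (\<lambda>\<theta>. f \<theta> + g \<theta>) L = time_avg \<omega> f L + time_avg \<omega> g L" for L
      using line_integrable[OF fg(1), of 0 L 0 \<omega>] line_integrable[OF fg(2), of 0 L 0 \<omega>]
      by (simp add: time_avg_def add_divide_distrib)
    then show ?case
      using tendsto_add[OF add.IH] fg
      by (simp add: torus_continuous_integrable add_divide_distrib)
  qed
  show ?thesis
    unfolding tendsto_iff
  proof (intro allI impI)
    fix e :: real assume e: "0 < e"
    obtain g where g: "g \<in> trig_poly" "\<And>\<theta>. \<bar>c \<theta> - g \<theta>\<bar> < e / 3"
      using trig_poly_dense[OF c, of "e / 3"] e by auto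
    note cg = trig_poly_continuous[OF g(1)]
    have g2: "\<And>\<theta>. \<bar>c \<theta> - g \<theta>\<bar> \<le> e / 3" using g(2) less_imp_le by blast
    let ?m = "\<lambda>c. (LINT \<theta>|torus_lebesgue. c \<theta>) / (2 * pi) ^ CARD('n)"
    have "\<bar>LINT \<theta>|torus_lebesgue. c \<theta> - g \<theta>\<bar> \<le> (2 * pi) ^ CARD('n) * (e / 3)"
      using g(2) by (intro torus_integral_bound continuous_intros c cg) (auto intro: less_imp_le)
    then have m: "\<bar>?m c - ?m g\<bar> \<le> e / 3"
      using c cg by (simp add: torus_continuous_integrable flip: diff_divide_distrib) (simp add: field_simps)
    have "\<forall>\<^sub>F L in at_top. dist (time_avg \<omega> g L) (?m g) < e / 3"
      using trig[OF g(1)] e by (intro tendstoD) auto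
    moreover have "\<forall>\<^sub>F L in at_top. \<bar>time_avg \<omega> c L - time_avg \<omega> g L\<bar> \<le> e / 3"
      using eventually_gt_at_top[of 0]
      by eventually_elim (rule time_avg_close[OF c cg g2])
    ultimately show "\<forall>\<^sub>F L in at_top. dist (time_avg \<omega> c L) (?m c) < e"
    proof eventually_elim
      case (elim L)
      then show ?case using m unfolding dist_real_def by linarith
    qed
  qed
qed

section \<open>Second countability of the torus, and shifts as metric maps\<close>

lemma open_torus_image:
  assumes "open U"
  shows "open (torus_proj ` U)"
proof (subst open_subopen, intro ballI)
  fix \<theta> assume "\<theta> \<in> torus_proj ` U"
  then obtain x where x: "x \<in> U" "\<theta> = torus_proj x" by blast
  then obtain e where "0 < e" "ball x e \<subseteq> U" using assms open_contains_ball by blast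
  have "ball \<theta> e \<subseteq> torus_proj ` U"
    unfolding x(2) torus_proj_ball[symmetric] using \<open>ball x e \<subseteq> U\<close> by blast
  moreover have "open (ball \<theta> e)" "\<theta> \<in> ball \<theta> e" using \<open>0 < e\<close> by simp_all
  ultimately show "\<exists>T. open T \<and> \<theta> \<in> T \<and> T \<subseteq> torus_proj ` U" by blast
qed

lemma continuous_on_torus_proj_UNIV: "continuous_on UNIV torus_proj"
  using continuous_on_torus_proj[OF continuous_on_id] by simp

text \<open>The projection is open and continuous, so it carries a countable basis to a basis. This
  serves \<open>borel_prod\<close> for pairs of a time and a point, and the Lindelof cover in
  \<open>flux_compare\<close>.\<close>

instance torus :: (finite) second_countable_topology
proof
  obtain B :: "(real ^ 'a) set set" where B: "countable B" "topological_basis B"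
    using ex_countable_basis by blast
  have "topological_basis ((`) torus_proj ` B :: 'a torus set set)"
  proof (rule topological_basisI)
    show "open B'" if "B' \<in> (`) torus_proj ` B" for B' :: "'a torus set"
      using that B(2) by (auto intro: open_torus_image topological_basis_open)
    fix U :: "'a torus set" and \<theta> assume U: "open U" "\<theta> \<in> U"
    obtain x where x: "\<theta> = torus_proj x" by (rule torus_cases)
    have "open (torus_proj -` U :: (real ^ 'a) set)"
      using U(1) continuous_on_torus_proj_UNIV by (rule open_vimage)
    moreover have "x \<in> torus_proj -` U" using U x by simp
    ultimately obtain b where "b \<in> B" "x \<in> b" "b \<subseteq> torus_proj -` U"
      by (rule topological_basisE[OF B(2)])
    then show "\<exists>B'\<in>(`) torus_proj ` B. \<theta> \<in> B' \<and> B' \<subseteq> U"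
      using x by (intro bexI[of _ "torus_proj ` b"]) auto
  qed
  then show "\<exists>B :: 'a torus set set. countable B \<and> open = generate_topology B"
    using B(1) topological_basis_imp_subbasis by blast
qed

lemma dist_torus_shift_le: "dist (torus_shift v \<theta>) (torus_shift v \<theta>') \<le> dist \<theta> \<theta>'"
proof (rule field_le_epsilon)
  fix e :: real assume "0 < e"
  obtain x where x: "\<theta> = torus_proj x" by (rule torus_cases)
  have "dist (torus_proj x) \<theta>' < dist \<theta> \<theta>' + e" using \<open>0 < e\<close> x by simp
  then obtain y where y: "\<theta>' = torus_proj y" "dist x y < dist \<theta> \<theta>' + e" by (rule torus_dist_lift)
  have "dist (torus_shift v \<theta>) (torus_shift v \<theta>') \<le> dist (x + v) (y + v)"
    unfolding x y torus_shift_proj by (rule dist_torus_proj_le)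
  then show "dist (torus_shift v \<theta>) (torus_shift v \<theta>') \<le> dist \<theta> \<theta>' + e" using y by simp
qed

lemma dist_torus_shift_shift: "dist (torus_shift v \<theta>) (torus_shift w \<theta>) \<le> dist v w"
proof -
  obtain x where x: "\<theta> = torus_proj x" by (rule torus_cases)
  show ?thesis unfolding x torus_shift_proj using dist_torus_proj_le[of "x + v" "x + w"] by simp
qed

lemma torus_shift_shift: "torus_shift v (torus_shift w \<theta>) = torus_shift (v + w) \<theta>"
  by (rule torus_cases[of \<theta>]) (simp add: algebra_simps)

lemma torus_shift_0 [simp]: "torus_shift 0 \<theta> = \<theta>"
  by (rule torus_cases[of \<theta>]) simp

section \<open>Kernels\<close>

text \<open>Weaker than \<open>mollifier\<close>: continuity replaces smoothness, so that a tent
  function is admissible and can provide the time weight.\<close>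

definition bump_kernel :: "(real \<Rightarrow> real) \<Rightarrow> bool" where
  "bump_kernel \<phi> \<longleftrightarrow> continuous_on UNIV \<phi> \<and> (\<forall>s. 0 \<le> \<phi> s) \<and> (\<forall>s. 1 \<le> \<bar>s\<bar> \<longrightarrow> \<phi> s = 0) \<and>
     (LINT s|lborel. \<phi> s) = 1"

lemma kernelD:
  assumes "bump_kernel \<phi>"
  shows "continuous_on UNIV \<phi>" "0 \<le> \<phi> s" "1 \<le> \<bar>s\<bar> \<Longrightarrow> \<phi> s = 0" "(LINT s|lborel. \<phi> s) = 1" "integrable lborel \<phi>"
proof -
  \<comment> \<open>A function that is not integrable has integral 0 by convention, which
    contradicts the value 1.\<close>
  show "integrable lborel \<phi>"
    using assms not_integrable_integral_eq[of lborel \<phi>] unfolding bump_kernel_def by fastforce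
qed (use assms in \<open>auto simp: bump_kernel_def\<close>)

lemma mollifier_kernel: "mollifier \<phi> \<Longrightarrow> bump_kernel \<phi>"
proof -
  assume m: "mollifier \<phi>"
  then have "Ck 0 \<phi>" "closure {s. \<phi> s \<noteq> 0} \<subseteq> {-1<..<1}" by (auto simp: mollifier_def smooth_def)
  then have "continuous_on UNIV \<phi>" "\<And>s. \<phi> s \<noteq> 0 \<Longrightarrow> -1 < s \<and> s < 1"
    using closure_subset[of "{s. \<phi> s \<noteq> 0}"] by auto
  then show "bump_kernel \<phi>" using m unfolding bump_kernel_def mollifier_def by fastforce
qed

lemma kernel_exists: "\<exists>\<phi>. bump_kernel \<phi>"
proof -
  define b where "b s = max 0 (1 - \<bar>s\<bar>)" for s :: real
  define c where "c = (LINT s|lborel. b s)"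
  have cont: "continuous_on UNIV b" unfolding b_def by (intro continuous_intros)
  have bi: "b = (\<lambda>s. indicator {-1..1} s *\<^sub>R b s)"
  proof
    show "b s = indicator {-1..1} s *\<^sub>R b s" for s by (cases "s \<in> {-1..1}") (auto simp: b_def)
  qed
  have int: "integrable lborel b"
    using borel_integrable_atLeastAtMost'[of "-1" 1 b] continuous_on_subset[OF cont]
    unfolding set_integrable_def by (subst bi) auto
  \<comment> \<open>The tent is at least 1/2 on this interval, so its integral is positive and it
    can be normalised.\<close>
  have "(LINT s|lborel. indicator {-1/2..1/2::real} s * (1/2)) \<le> c"
    unfolding c_def
  proof (rule integral_mono[OF _ int])
    show "integrable lborel (\<lambda>s. indicator {-1/2..1/2::real} s * (1/2::real))"
      by (intro integrable_mult_left integrable_real_indicator) auto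
  qed (auto simp: b_def indicator_def)
  then have "0 < c" by simp
  then have "bump_kernel (\<lambda>s. b s / c)"
    unfolding bump_kernel_def using cont
    by (auto simp: b_def c_def intro!: continuous_intros)
  then show ?thesis by (rule exI[of _ "\<lambda>s. b s / c"])
qed

lemma kernel_interval_integral:
  assumes \<phi>: "bump_kernel \<phi>" and ab: "a \<le> -1" "1 \<le> b"
  shows "(LBINT y=ereal a..ereal b. \<phi> y) = 1"
proof -
  have "(LBINT y=ereal a..ereal b. \<phi> y) = (LBINT y:{a..b}. \<phi> y)"
    using ab by (intro interval_integral_Icc) simp
  also have "\<dots> = (LINT y|lborel. \<phi> y)"
    unfolding set_lebesgue_integral_def
  proof (intro Bochner_Integration.integral_cong refl)
    fix y
    have "1 \<le> \<bar>y\<bar>" if "y \<notin> {a..b}"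
      using that ab by (cases "a \<le> y") auto
    then show "indicator {a..b} y *\<^sub>R \<phi> y = \<phi> y"
      using kernelD(3)[OF \<phi>, of y] by (cases "y \<in> {a..b}") auto
  qed
  finally show ?thesis using kernelD(4)[OF \<phi>] by simp
qed

lemma kernel_scale_integral:
  assumes \<phi>: "bump_kernel \<phi>" and d: "0 < d"
  shows "(LINT s|lborel. \<phi> (s / d) / d) = 1" "integrable lborel (\<lambda>s. \<phi> (s / d) / d)"
proof -
  have "(LINT s|lborel. \<phi> s) = \<bar>1 / d\<bar> *\<^sub>R (LINT s|lborel. \<phi> (0 + 1 / d * s))"
    using d by (intro lborel_integral_real_affine) auto
  then show *: "(LINT s|lborel. \<phi> (s / d) / d) = 1"
    using d kernelD(4)[OF \<phi>] by simp
  show "integrable lborel (\<lambda>s. \<phi> (s / d) / d)"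
    using * not_integrable_integral_eq[of lborel "\<lambda>s. \<phi> (s / d) / d"] by fastforce
qed

text \<open>Substituting \<open>y = q u / \<eta>\<close>; the sign \<open>\<sigma>\<close> covers increasing and decreasing \<open>q\<close>.\<close>

lemma kernel_substitution:
  fixes q q' :: "real \<Rightarrow> real"
  assumes \<phi>: "bump_kernel \<phi>" and \<eta>: "0 < \<eta>" and d: "0 < d"
    and q: "\<And>u. (q has_real_derivative q' u) (at u)" and q': "continuous_on {z - d..z + d} q'"
    and \<sigma>: "\<sigma> = 1 \<or> \<sigma> = -1" and pos: "\<And>u. u \<in> {z - d..z + d} \<Longrightarrow> 0 \<le> \<sigma> * q' u"
    and ends: "\<sigma> * q (z - d) \<le> - \<eta>" "\<eta> \<le> \<sigma> * q (z + d)"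
  shows "(LINT u:{z - d..z + d}|lborel. \<phi> (q u / \<eta>) / \<eta> * \<bar>q' u\<bar>) = 1"
proof -
  have "(LINT u:{z - d..z + d}|lborel. \<phi> (q u / \<eta>) / \<eta> * \<bar>q' u\<bar>)
      = (LINT u:{z - d..z + d}|lborel. \<sigma> * (q' u / \<eta> * \<phi> (q u / \<eta>)))"
    unfolding set_lebesgue_integral_def
  proof (intro Bochner_Integration.integral_cong refl)
    fix u
    have "\<bar>q' u\<bar> = \<sigma> * q' u" if "u \<in> {z - d..z + d}"
      using pos[OF that] \<sigma> by (auto simp: abs_if)
    then show "indicator {z - d..z + d} u *\<^sub>R (\<phi> (q u / \<eta>) / \<eta> * \<bar>q' u\<bar>)
        = indicator {z - d..z + d} u *\<^sub>R (\<sigma> * (q' u / \<eta> * \<phi> (q u / \<eta>)))"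
      by (auto simp: indicator_def)
  qed
  also have "\<dots> = \<sigma> * (LBINT u=ereal (z - d)..ereal (z + d). q' u / \<eta> * \<phi> (q u / \<eta>))"
    using d by (subst interval_integral_Icc) auto
  also have "(LBINT u=ereal (z - d)..ereal (z + d). q' u / \<eta> * \<phi> (q u / \<eta>))
     = (LBINT u=ereal (z - d)..ereal (z + d). (q' u / \<eta>) *\<^sub>R \<phi> (q u / \<eta>))" by simp
  also have "\<dots> = (LBINT y=ereal (q (z - d) / \<eta>)..ereal (q (z + d) / \<eta>). \<phi> y)"
  proof (rule interval_integral_substitution_finite)
    show "((\<lambda>u. q u / \<eta>) has_real_derivative q' u / \<eta>) (at u within {z - d..z + d})" for u
      using DERIV_cdivide[OF has_field_derivative_at_within[OF q]] .
    show "continuous_on ((\<lambda>u. q u / \<eta>) ` {z - d..z + d}) \<phi>"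
      using kernelD(1)[OF \<phi>] by (rule continuous_on_subset) simp
    show "continuous_on {z - d..z + d} (\<lambda>u. q' u / \<eta>)"
      using \<eta> by (intro continuous_intros q') auto
  qed (use d in simp)
  \<comment> \<open>The end values are at least \<open>\<eta>\<close> in size and of opposite signs,
    so the image interval covers the support of \<open>\<phi>\<close>. For
    \<open>\<sigma> = -1\<close> it is traversed backwards, and the two signs cancel.\<close>
  also have "\<sigma> * \<dots> = 1"
  proof (cases "\<sigma> = 1")
    case True
    then show ?thesis
      using ends \<eta> by (subst kernel_interval_integral[OF \<phi>]) (auto simp: field_simps)
  next
    case False
    then have s: "\<sigma> = -1" using \<sigma> by simp
    have "(LBINT y=ereal (q (z + d) / \<eta>)..ereal (q (z - d) / \<eta>). \<phi> y) = 1"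
      using ends \<eta> s by (intro kernel_interval_integral[OF \<phi>]) (auto simp: field_simps)
    then show ?thesis
      using s by (subst interval_integral_endpoints_reverse) simp
  qed
  finally show ?thesis .
qed

section \<open>Zeros along the flow\<close>

locale transversal =
  fixes \<omega> :: "real ^ 'n" and S :: "'n::finite torus \<Rightarrow> real"
  assumes nonres: "nonresonant \<omega>"
    and smooth: "torus_smooth S"
    and nonempty: "zero_set S \<noteq> {}"
    and transverse: "\<And>\<theta>. S \<theta> = 0 \<Longrightarrow> D_along \<omega> S \<theta> \<noteq> 0"
begin

section \<open>The lifted function, its gradient and the flow\<close>

definition lift :: "real ^ 'n \<Rightarrow> real" where
  "lift x = S (torus_proj x)"

lemma lift_lattice [simp]: "lift (x + lattice_vec k) = lift x"
  by (simp add: lift_def)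

lemma Ck_lift: "Ck k lift"
  using smooth by (simp add: torus_smooth_def smooth_def lift_def[abs_def])

lemma lift_differentiable: "lift differentiable (at x)"
  using Ck_lift[of "Suc 0"] by simp

lemma lift_partial_continuous:
  "b \<in> Basis \<Longrightarrow> continuous_on UNIV (\<lambda>x. frechet_derivative lift (at x) b)"
  using Ck_lift[of "Suc 0"] by simp

text \<open>Makes \<open>torus_grad\<close> independent of the representative chosen by
  \<open>torus_rep\<close>.\<close>

lemma frechet_lift_lattice:
  "frechet_derivative lift (at (x + lattice_vec k)) = frechet_derivative lift (at x)"
proof -
  let ?D = "frechet_derivative lift (at (x + lattice_vec k))"
  have D: "(lift has_derivative ?D) (at (x + lattice_vec k))"
    using lift_differentiable frechet_derivative_works by blast
  have "((\<lambda>y. lift (y + lattice_vec k)) has_derivative ?D) (at x)"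
    by (rule has_derivative_compose[of "\<lambda>y. y + lattice_vec k" "\<lambda>y. y", unfolded o_def])
       (auto intro!: derivative_eq_intros D)
  then have "(lift has_derivative ?D) (at x)" by simp
  then show ?thesis by (rule frechet_derivative_at)
qed

lemma torus_grad_proj:
  "torus_grad S (torus_proj x) = (\<chi> i. frechet_derivative lift (at x) (axis i 1))"
proof -
  obtain k where "torus_rep (torus_proj x) = x + lattice_vec k" by (rule torus_rep_proj)
  then show ?thesis
    by (simp add: torus_grad_def frechet_lift_lattice flip: lift_def)
qed

lemma lift_has_derivative: "(lift has_derivative (\<lambda>v. torus_grad S (torus_proj x) \<bullet> v)) (at x)"
proof -
  let ?D = "frechet_derivative lift (at x)"
  have D: "(lift has_derivative ?D) (at x)"
    using lift_differentiable frechet_derivative_works by blast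
  have lin: "linear ?D" using D by (rule has_derivative_linear)
  have "?D v = torus_grad S (torus_proj x) \<bullet> v" for v
  proof -
    have "?D v = ?D (\<Sum>i\<in>UNIV. v $ i *\<^sub>R axis i 1)"
      by (simp flip: scalar_mult_eq_scaleR add: basis_expansion)
    also have "\<dots> = (\<Sum>i\<in>UNIV. v $ i * ?D (axis i 1))"
      by (simp add: linear_sum[OF lin] linear_scale[OF lin])
    finally show ?thesis by (simp add: torus_grad_proj inner_vec_def mult.commute)
  qed
  then have "?D = (\<lambda>v. torus_grad S (torus_proj x) \<bullet> v)" by (rule ext)
  then show ?thesis using D by simp
qed

lemma continuous_on_S: "continuous_on UNIV S"
  using Ck_lift[of 0] by (intro continuous_on_torus) (simp add: lift_def[abs_def])

lemma continuous_on_grad: "continuous_on UNIV (torus_grad S)"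
  by (rule continuous_on_torus)
     (auto simp: torus_grad_proj axis_in_Basis_iff intro!: continuous_on_vec_lambda lift_partial_continuous)

abbreviation DS :: "'n torus \<Rightarrow> real" where
  "DS \<equiv> D_along \<omega> S"

lemma continuous_on_DS: "continuous_on UNIV DS"
  unfolding D_along_def by (intro continuous_intros continuous_on_grad)

definition flow :: "real \<Rightarrow> 'n torus \<Rightarrow> 'n torus" where
  "flow t \<theta> = torus_shift (t *\<^sub>R \<omega>) \<theta>"

lemma flow_proj [simp]: "flow t (torus_proj x) = torus_proj (x + t *\<^sub>R \<omega>)"
  by (simp add: flow_def)

lemma flow_flow: "flow s (flow t \<theta>) = flow (s + t) \<theta>"
  by (simp add: flow_def torus_shift_shift scaleR_add_left)

lemma flow_0 [simp]: "flow 0 \<theta> = \<theta>"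
  by (simp add: flow_def)

lemma dist_flow_le: "dist (flow t \<theta>) (flow t' \<theta>') \<le> \<bar>t - t'\<bar> * norm \<omega> + dist \<theta> \<theta>'"
proof -
  have "dist (flow t \<theta>) (flow t' \<theta>') \<le> dist (flow t \<theta>) (flow t' \<theta>) + dist (flow t' \<theta>) (flow t' \<theta>')"
    by (rule dist_triangle)
  also have "\<dots> \<le> dist (t *\<^sub>R \<omega>) (t' *\<^sub>R \<omega>) + dist \<theta> \<theta>'"
    unfolding flow_def by (intro add_mono dist_torus_shift_shift dist_torus_shift_le)
  finally show ?thesis by (simp add: dist_norm flip: scaleR_diff_left)
qed

lemma continuous_on_flow2: "continuous_on UNIV (\<lambda>p. flow (fst p) (snd p))"
proof -
  have "((\<lambda>p. flow (fst p) (snd p)) \<longlongrightarrow> flow t \<theta>) (at (t, \<theta>))" for t \<theta>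
  proof (rule metric_tendsto_imp_tendsto[of "\<lambda>p. \<bar>fst p - t\<bar> * norm \<omega> + dist (snd p) \<theta>" 0])
    show "((\<lambda>p. \<bar>fst p - t\<bar> * norm \<omega> + dist (snd p) \<theta>) \<longlongrightarrow> 0) (at (t, \<theta>))"
      by (auto intro!: tendsto_eq_intros)
    show "\<forall>\<^sub>F p in at (t, \<theta>). dist (flow (fst p) (snd p)) (flow t \<theta>)
        \<le> dist (\<bar>fst p - t\<bar> * norm \<omega> + dist (snd p) \<theta>) 0"
      using dist_flow_le by (intro always_eventually allI) (simp add: abs_of_nonneg)
  qed
  then show ?thesis by (auto simp: continuous_on_def)
qed

lemma continuous_on_flow [continuous_intros]:
  assumes "continuous_on A t" "continuous_on A \<theta>"
  shows "continuous_on A (\<lambda>x. flow (t x) (\<theta> x))"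
  using continuous_on_compose2[OF continuous_on_flow2 continuous_on_Pair[OF assms]] by simp

lemma continuous_on_along:
  assumes "continuous_on UNIV h"
  shows "continuous_on A (\<lambda>t. h (flow t \<theta>))"
  by (rule continuous_on_compose2[OF assms]) (auto intro!: continuous_intros)

lemma S_flow_deriv: "((\<lambda>t. S (flow t \<theta>)) has_real_derivative DS (flow t \<theta>)) (at t)"
proof -
  obtain x where x: "\<theta> = torus_proj x" by (rule torus_cases)
  have "((\<lambda>t. lift (x + t *\<^sub>R \<omega>)) has_derivative
      (\<lambda>h. torus_grad S (torus_proj (x + t *\<^sub>R \<omega>)) \<bullet> (h *\<^sub>R \<omega>))) (at t)"
    by (rule has_derivative_compose[OF _ lift_has_derivative]) (auto intro!: derivative_eq_intros)
  then have "((\<lambda>t. S (flow t \<theta>)) has_derivative (\<lambda>h. h * DS (flow t \<theta>))) (at t)"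
    by (simp add: x lift_def D_along_def inner_commute)
  then show ?thesis by (simp add: has_field_derivative_def mult_commute_abs)
qed

section \<open>Uniform separation of zeros\<close>

lemma slope_bound: "\<exists>m>0. \<forall>\<theta>. \<bar>S \<theta>\<bar> < m \<longrightarrow> m \<le> \<bar>DS \<theta>\<bar>"
proof -
  \<comment> \<open>By transversality the two terms never vanish together, so on the compact torus
    the maximum has a positive minimum. Where the first term is below this minimum, the second must
    reach it.\<close>
  have "continuous_on UNIV (\<lambda>\<theta>. max \<bar>S \<theta>\<bar> \<bar>DS \<theta>\<bar>)"
    by (intro continuous_intros continuous_on_S continuous_on_DS)
  then obtain \<theta>0 where \<theta>0: "\<And>\<theta>. max \<bar>S \<theta>0\<bar> \<bar>DS \<theta>0\<bar> \<le> max \<bar>S \<theta>\<bar> \<bar>DS \<theta>\<bar>"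
    using continuous_attains_inf[OF compact_UNIV_torus] by blast
  have "0 < max \<bar>S \<theta>0\<bar> \<bar>DS \<theta>0\<bar>" using transverse[of \<theta>0] by (auto simp: less_max_iff_disj)
  moreover have "\<forall>\<theta>. \<bar>S \<theta>\<bar> < max \<bar>S \<theta>0\<bar> \<bar>DS \<theta>0\<bar> \<longrightarrow> max \<bar>S \<theta>0\<bar> \<bar>DS \<theta>0\<bar> \<le> \<bar>DS \<theta>\<bar>"
  proof (intro allI impI)
    fix \<theta>
    have "max \<bar>S \<theta>0\<bar> \<bar>DS \<theta>0\<bar> \<le> \<bar>S \<theta>\<bar> \<or> max \<bar>S \<theta>0\<bar> \<bar>DS \<theta>0\<bar> \<le> \<bar>DS \<theta>\<bar>"
      using \<theta>0[of \<theta>] by (subst (asm) le_max_iff_disj)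
    moreover assume "\<bar>S \<theta>\<bar> < max \<bar>S \<theta>0\<bar> \<bar>DS \<theta>0\<bar>"
    ultimately show "max \<bar>S \<theta>0\<bar> \<bar>DS \<theta>0\<bar> \<le> \<bar>DS \<theta>\<bar>" by linarith
  qed
  ultimately show ?thesis by blast
qed

definition slope :: real where
  "slope = (SOME m. m > 0 \<and> (\<forall>\<theta>. \<bar>S \<theta>\<bar> < m \<longrightarrow> m \<le> \<bar>DS \<theta>\<bar>))"

lemma slope: "0 < slope" "\<bar>S \<theta>\<bar> < slope \<Longrightarrow> slope \<le> \<bar>DS \<theta>\<bar>"
  using someI_ex[OF slope_bound] unfolding slope_def by blast+

lemma flow_equicontinuous:
  assumes "continuous_on UNIV (h :: 'n torus \<Rightarrow> real)" "0 < e"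
  shows "\<exists>d>0. \<forall>\<theta> t t'. \<bar>t - t'\<bar> \<le> d \<longrightarrow> \<bar>h (flow t \<theta>) - h (flow t' \<theta>)\<bar> < e"
proof -
  have "uniformly_continuous_on UNIV h"
    using assms(1) compact_UNIV_torus by (rule compact_uniformly_continuous)
  then obtain d where d: "0 < d" "\<And>\<theta> \<theta>'. dist \<theta> \<theta>' < d \<Longrightarrow> dist (h \<theta>) (h \<theta>') < e"
    unfolding uniformly_continuous_on_def using assms(2) by (metis UNIV_I dist_commute)
  define N where "N = norm \<omega> + 1"
  have pos: "0 < N" "norm \<omega> \<le> N" by (simp_all add: N_def add_nonneg_pos)
  let ?d = "d / 2 / N"
  have "\<bar>h (flow t \<theta>) - h (flow t' \<theta>)\<bar> < e" if "\<bar>t - t'\<bar> \<le> ?d" for \<theta> t t'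
  proof -
    have "dist (flow t \<theta>) (flow t' \<theta>) \<le> \<bar>t - t'\<bar> * norm \<omega>" using dist_flow_le[of t \<theta> t' \<theta>] by simp
    also have "\<dots> \<le> ?d * N" using that d pos by (intro mult_mono) auto
    also have "\<dots> = d / 2" using pos by simp
    also have "\<dots> < d" using d by simp
    finally show ?thesis using d(2) by (simp add: dist_real_def)
  qed
  then show ?thesis using d pos by (intro exI[of _ ?d]) auto
qed

text \<open>During this time \<open>DS\<close> varies by less than half of its lower bound, so near
  a zero it keeps its sign and stays at least \<open>slope / 2\<close> in size.\<close>

definition gap :: real where
  "gap = (SOME d. d > 0 \<and> (\<forall>\<theta> t t'. \<bar>t - t'\<bar> \<le> d \<longrightarrow> \<bar>DS (flow t \<theta>) - DS (flow t' \<theta>)\<bar> < slope / 2))"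

lemma gap: "0 < gap" "\<bar>t - t'\<bar> \<le> gap \<Longrightarrow> \<bar>DS (flow t \<theta>) - DS (flow t' \<theta>)\<bar> < slope / 2"
proof -
  have "\<exists>d>0. \<forall>\<theta> t t'. \<bar>t - t'\<bar> \<le> d \<longrightarrow> \<bar>DS (flow t \<theta>) - DS (flow t' \<theta>)\<bar> < slope / 2"
    using flow_equicontinuous[OF continuous_on_DS, of "slope / 2"] slope(1) by simp
  from someI_ex[OF this] show "0 < gap" "\<bar>t - t'\<bar> \<le> gap \<Longrightarrow> \<bar>DS (flow t \<theta>) - DS (flow t' \<theta>)\<bar> < slope / 2"
    unfolding gap_def by blast+
qed

text \<open>The mean value theorem with \<open>\<bar>DS\<bar> \<ge> slope / 2\<close> throughout the
  window; \<open>\<sigma>\<close> is the sign of \<open>DS\<close> there, so that increasing and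
  decreasing crossings are treated at once.\<close>

lemma flow_monotone:
  assumes "\<bar>S (flow z \<theta>)\<bar> < slope"
  obtains \<sigma> where "\<sigma> = 1 \<or> \<sigma> = -1"
    "\<forall>t. \<bar>t - z\<bar> \<le> gap \<longrightarrow> slope / 2 \<le> \<sigma> * DS (flow t \<theta>)"
    "\<forall>t. z \<le> t \<longrightarrow> t \<le> z + gap \<longrightarrow> \<sigma> * S (flow z \<theta>) + slope / 2 * (t - z) \<le> \<sigma> * S (flow t \<theta>)"
    "\<forall>t. z - gap \<le> t \<longrightarrow> t \<le> z \<longrightarrow> \<sigma> * S (flow t \<theta>) + slope / 2 * (z - t) \<le> \<sigma> * S (flow z \<theta>)"
proof -
  define \<sigma> where "\<sigma> = (if 0 \<le> DS (flow z \<theta>) then 1 else - 1 :: real)"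
  have \<sigma>: "\<sigma> = 1 \<or> \<sigma> = -1" by (simp add: \<sigma>_def)
  have z: "slope \<le> \<sigma> * DS (flow z \<theta>)" using slope(2)[OF assms] by (auto simp: \<sigma>_def)
  have D: "slope / 2 \<le> \<sigma> * DS (flow t \<theta>)" if "\<bar>t - z\<bar> \<le> gap" for t
    using \<sigma>
  proof
    assume "\<sigma> = 1"
    then have "\<sigma> * DS (flow t \<theta>) = DS (flow t \<theta>)" "\<sigma> * DS (flow z \<theta>) = DS (flow z \<theta>)" by simp_all
    then show ?thesis using gap(2)[OF that, of \<theta>] z by linarith
  next
    assume "\<sigma> = -1"
    then have "\<sigma> * DS (flow t \<theta>) = - DS (flow t \<theta>)" "\<sigma> * DS (flow z \<theta>) = - DS (flow z \<theta>)" by simp_all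
    then show ?thesis using gap(2)[OF that, of \<theta>] z by linarith
  qed
  have deriv: "((\<lambda>t. \<sigma> * S (flow t \<theta>)) has_real_derivative \<sigma> * DS (flow t \<theta>)) (at t)" for t
    by (rule DERIV_cmult[OF S_flow_deriv])
  have growth: "\<sigma> * S (flow a \<theta>) + slope / 2 * (b - a) \<le> \<sigma> * S (flow b \<theta>)"
    if "a \<le> b" "z - gap \<le> a" "b \<le> z + gap" for a b
  proof (cases "a = b")
    case False
    then have "a < b" using that by simp
    then obtain c where c: "a < c" "c < b"
      "\<sigma> * S (flow b \<theta>) - \<sigma> * S (flow a \<theta>) = (b - a) * (\<sigma> * DS (flow c \<theta>))"
      using MVT2[of a b "\<lambda>t. \<sigma> * S (flow t \<theta>)" "\<lambda>t. \<sigma> * DS (flow t \<theta>)"] that deriv by auto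
    have "(b - a) * (slope / 2) \<le> (b - a) * (\<sigma> * DS (flow c \<theta>))"
      using c that by (intro mult_left_mono D) (auto simp: abs_le_iff)
    then have "slope / 2 * (b - a) \<le> (b - a) * (\<sigma> * DS (flow c \<theta>))"
      by (simp only: mult.commute[of "slope / 2"])
    then show ?thesis using c(3) by linarith
  qed simp
  show ?thesis
    by (rule that[OF \<sigma>]) (use D growth gap(1) in auto)
qed

lemma zeros_separated:
  assumes "S (flow t \<theta>) = 0" "S (flow t' \<theta>) = 0" "\<bar>t - t'\<bar> \<le> gap"
  shows "t = t'"
proof -
  have "t' \<le> t \<Longrightarrow> t = t'" if "S (flow t \<theta>) = 0" "S (flow t' \<theta>) = 0" "\<bar>t - t'\<bar> \<le> gap" for t t'
  proof -
    assume "t' \<le> t"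
    have "\<bar>S (flow t' \<theta>)\<bar> < slope" using that slope(1) by simp
    then obtain \<sigma> where "\<sigma> = 1 \<or> \<sigma> = -1"
      "\<forall>t. \<bar>t - t'\<bar> \<le> gap \<longrightarrow> slope / 2 \<le> \<sigma> * DS (flow t \<theta>)"
      "\<forall>u. t' \<le> u \<longrightarrow> u \<le> t' + gap \<longrightarrow> \<sigma> * S (flow t' \<theta>) + slope / 2 * (u - t') \<le> \<sigma> * S (flow u \<theta>)"
      "\<forall>t. t' - gap \<le> t \<longrightarrow> t \<le> t' \<longrightarrow> \<sigma> * S (flow t \<theta>) + slope / 2 * (t' - t) \<le> \<sigma> * S (flow t' \<theta>)"
      by (rule flow_monotone)
    from this(3)[rule_format, of t] \<open>t' \<le> t\<close> that have "slope * (t - t') \<le> 0" by simp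
    then show "t = t'" using slope(1) \<open>t' \<le> t\<close> by (simp add: mult_le_0_iff)
  qed
  note le = this
  show ?thesis
  proof (cases "t' \<le> t")
    case True
    then show ?thesis using le[of t t'] assms by blast
  next
    case False
    then show ?thesis using le[of t' t] assms by (simp add: abs_minus_commute)
  qed
qed

text \<open>At growth rate \<open>slope / 2\<close>, the time \<open>2 * \<eta> / slope\<close>
  changes \<open>S\<close> by at least \<open>\<eta>\<close>, which suffices to reach 0 in one of
  the two directions; the intermediate value theorem does the rest.\<close>

lemma zero_nearby:
  assumes "\<bar>S (flow u \<theta>)\<bar> < \<eta>" "\<eta> \<le> slope" "2 * \<eta> / slope \<le> gap"
  obtains z where "S (flow z \<theta>) = 0" "\<bar>u - z\<bar> \<le> 2 * \<eta> / slope"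
proof -
  define d where "d = 2 * \<eta> / slope"
  have d: "0 < d" "d \<le> gap" "slope / 2 * d = \<eta>" using assms slope(1) by (auto simp: d_def)
  have "\<bar>S (flow u \<theta>)\<bar> < slope" using assms by simp
  then obtain \<sigma> where \<sigma>: "\<sigma> = 1 \<or> \<sigma> = -1"
    and "\<forall>t. \<bar>t - u\<bar> \<le> gap \<longrightarrow> slope / 2 \<le> \<sigma> * DS (flow t \<theta>)"
    and up: "\<forall>t. u \<le> t \<longrightarrow> t \<le> u + gap \<longrightarrow> \<sigma> * S (flow u \<theta>) + slope / 2 * (t - u) \<le> \<sigma> * S (flow t \<theta>)"
    and down: "\<forall>t. u - gap \<le> t \<longrightarrow> t \<le> u \<longrightarrow> \<sigma> * S (flow t \<theta>) + slope / 2 * (u - t) \<le> \<sigma> * S (flow u \<theta>)"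
    by (rule flow_monotone)
  have "\<bar>\<sigma> * S (flow u \<theta>)\<bar> < \<eta>" using \<sigma> assms(1) by auto
  then have "\<sigma> * S (flow (u - d) \<theta>) \<le> 0" "0 \<le> \<sigma> * S (flow (u + d) \<theta>)"
    using up[rule_format, of "u + d"] down[rule_format, of "u - d"] d by (simp_all add: abs_less_iff)
  then obtain z where z: "u - d \<le> z" "z \<le> u + d" "\<sigma> * S (flow z \<theta>) = 0"
    using IVT'[of "\<lambda>t. \<sigma> * S (flow t \<theta>)" "u - d" 0 "u + d"] d
      continuous_on_mult_left[OF continuous_on_along[OF continuous_on_S], of "{u - d..u + d}"] by auto
  then show ?thesis using that[of z] \<sigma> by (auto simp: d_def abs_le_iff)
qed

text \<open>The open window has length \<open>gap\<close>, so it contains at most one hit. It is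
  twice as wide as the support of \<open>weight\<close>, which leaves room for the distance between
  a point where \<open>S\<close> is small and the zero next to it.\<close>

definition hits :: "'n torus \<Rightarrow> real set" where
  "hits \<theta> = {u. \<bar>u\<bar> < gap / 2 \<and> S (flow u \<theta>) = 0}"

definition hit :: "'n torus \<Rightarrow> real" where
  "hit \<theta> = (SOME u. u \<in> hits \<theta>)"

lemma hits_unique:
  assumes "u \<in> hits \<theta>" "u' \<in> hits \<theta>"
  shows "u = u'"
  using assms by (intro zeros_separated[of u \<theta> u']) (auto simp: hits_def)

lemma hit_eq: "u \<in> hits \<theta> \<Longrightarrow> hit \<theta> = u"
  unfolding hit_def by (metis hits_unique someI)

lemma hit_in: "hits \<theta> \<noteq> {} \<Longrightarrow> hit \<theta> \<in> hits \<theta>"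
  unfolding hit_def by (rule someI_ex) blast

section \<open>Smearing the zeros in time\<close>

definition base_kernel :: "real \<Rightarrow> real" where
  "base_kernel = (SOME \<phi>. bump_kernel \<phi>)"

lemma base_kernel: "bump_kernel base_kernel"
  unfolding base_kernel_def by (rule someI_ex[OF kernel_exists])

definition weight :: "real \<Rightarrow> real" where
  "weight u = base_kernel (u / (gap / 4)) / (gap / 4)"

lemma weight:
  "continuous_on UNIV weight" "0 \<le> weight u" "gap / 4 \<le> \<bar>u\<bar> \<Longrightarrow> weight u = 0"
  "(LINT u|lborel. weight u) = 1" "integrable lborel weight"
proof -
  note k = kernelD[OF base_kernel] and g = gap(1)
  show "continuous_on UNIV weight"
    unfolding weight_def using g by (intro continuous_intros continuous_on_compose2[OF k(1)]) auto
  show "0 \<le> weight u" using g k(2) by (simp add: weight_def)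
  show "gap / 4 \<le> \<bar>u\<bar> \<Longrightarrow> weight u = 0"
    unfolding weight_def using g by (subst k(3)) (auto simp: field_simps abs_mult abs_divide)
  show "(LINT u|lborel. weight u) = 1" "integrable lborel weight"
    unfolding weight_def[abs_def]
    by (rule kernel_scale_integral[OF base_kernel]; use g in simp)+
qed

text \<open>\<open>hit\<close> jumps where a zero enters or leaves the window, at time
  \<open>gap / 2\<close> in absolute value, but \<open>weight\<close> vanishes from
  \<open>gap / 4\<close> on. This is how the function can be continuous.\<close>

definition smear :: "('n torus \<Rightarrow> real) \<Rightarrow> 'n torus \<Rightarrow> real" where
  "smear h \<theta> = (if hits \<theta> = {} then 0 else weight (hit \<theta>) * h (flow (hit \<theta>) \<theta>))"

definition layer :: "(real \<Rightarrow> real) \<Rightarrow> real \<Rightarrow> ('n torus \<Rightarrow> real) \<Rightarrow> 'n torus \<Rightarrow> real" where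
  "layer \<phi> \<eta> h \<theta> = \<phi> (S \<theta> / \<eta>) / \<eta> * \<bar>DS \<theta>\<bar> * h \<theta>"

definition smear_layer :: "(real \<Rightarrow> real) \<Rightarrow> real \<Rightarrow> ('n torus \<Rightarrow> real) \<Rightarrow> 'n torus \<Rightarrow> real" where
  "smear_layer \<phi> \<eta> h \<theta> = (LINT u|lborel. weight u * layer \<phi> \<eta> h (flow u \<theta>))"

lemma continuous_on_layer:
  assumes "bump_kernel \<phi>" "0 < \<eta>" "continuous_on UNIV h"
  shows "continuous_on UNIV (layer \<phi> \<eta> h)"
  unfolding layer_def using assms(2)
  by (intro continuous_intros assms(3) continuous_on_DS
      continuous_on_compose2[OF kernelD(1)[OF assms(1)]] continuous_on_S) auto

lemma integrable_weight_along:
  assumes h: "continuous_on UNIV (h :: 'n torus \<Rightarrow> real)"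
  shows "integrable lborel (\<lambda>u. weight u * h (flow u \<theta>))"
proof -
  obtain B where B0: "0 < B" and B: "\<And>\<theta>. \<bar>h \<theta>\<bar> \<le> B" using torus_continuous_bounded[OF h] by blast
  have [measurable]: "weight \<in> borel_measurable borel" "(\<lambda>u. h (flow u \<theta>)) \<in> borel_measurable borel"
    by (auto intro!: borel_measurable_continuous_onI weight(1) continuous_on_along h)
  show ?thesis
  proof (rule Bochner_Integration.integrable_bound[OF integrable_mult_left[OF weight(5), of B]])
    have "\<bar>weight u * h (flow u \<theta>)\<bar> \<le> \<bar>weight u * B\<bar>" for u
    proof -
      have "weight u * \<bar>h (flow u \<theta>)\<bar> \<le> weight u * B" by (rule mult_left_mono[OF B weight(2)])
      then show ?thesis using B0 by (simp add: abs_mult weight(2))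
    qed
    then show "AE u in lborel. norm (weight u * h (flow u \<theta>)) \<le> norm (weight u * B)" by simp
  qed measurable
qed

text \<open>For fixed \<open>u\<close> the flow does not increase distances, so the average inherits
  the uniform continuity of \<open>h\<close>.\<close>

lemma continuous_on_weight_avg:
  assumes h: "continuous_on UNIV (h :: 'n torus \<Rightarrow> real)"
  shows "continuous_on UNIV (\<lambda>\<theta>. LINT u|lborel. weight u * h (flow u \<theta>))"
  unfolding continuous_on_iff
proof (intro ballI allI impI)
  fix \<theta> :: "'n torus" and e :: real assume e: "0 < e"
  have "uniformly_continuous_on UNIV h"
    using h compact_UNIV_torus by (rule compact_uniformly_continuous)
  then obtain d where d: "0 < d" "\<And>\<theta> \<theta>'. dist \<theta> \<theta>' < d \<Longrightarrow> dist (h \<theta>) (h \<theta>') < e / 2"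
    unfolding uniformly_continuous_on_def using e by (metis UNIV_I dist_commute half_gt_zero)
  have "dist (LINT u|lborel. weight u * h (flow u \<theta>')) (LINT u|lborel. weight u * h (flow u \<theta>)) < e"
    if "dist \<theta>' \<theta> < d" for \<theta>'
  proof -
    have "\<bar>(LINT u|lborel. weight u * h (flow u \<theta>')) - (LINT u|lborel. weight u * h (flow u \<theta>))\<bar>
       = \<bar>LINT u|lborel. weight u * h (flow u \<theta>') - weight u * h (flow u \<theta>)\<bar>"
      by (subst Bochner_Integration.integral_diff) (auto intro: integrable_weight_along h)
    also have "\<dots> \<le> (LINT u|lborel. \<bar>weight u * h (flow u \<theta>') - weight u * h (flow u \<theta>)\<bar>)"
      by (rule integral_abs_bound)
    also have "\<dots> \<le> (LINT u|lborel. weight u * (e / 2))"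
    proof (rule integral_mono)
      show "\<bar>weight u * h (flow u \<theta>') - weight u * h (flow u \<theta>)\<bar> \<le> weight u * (e / 2)" for u
      proof -
        have "dist (flow u \<theta>') (flow u \<theta>) < d" using dist_flow_le[of u \<theta>' u \<theta>] that by simp
        then have "\<bar>h (flow u \<theta>') - h (flow u \<theta>)\<bar> \<le> e / 2" using d(2) by (force simp: dist_real_def)
        then have "weight u * \<bar>h (flow u \<theta>') - h (flow u \<theta>)\<bar> \<le> weight u * (e / 2)"
          by (rule mult_left_mono[OF _ weight(2)])
        then show ?thesis
          by (simp only: right_diff_distrib[symmetric] abs_mult abs_of_nonneg[OF weight(2)])
      qed
    qed (intro integrable_abs Bochner_Integration.integrable_diff integrable_weight_along h
        integrable_mult_left weight(5))+
    also have "\<dots> = e / 2" by (simp add: weight(4))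
    finally show ?thesis using e by (simp add: dist_real_def)
  qed
  then show "\<exists>d>0. \<forall>\<theta>'\<in>UNIV. dist \<theta>' \<theta> < d \<longrightarrow>
      dist (LINT u|lborel. weight u * h (flow u \<theta>')) (LINT u|lborel. weight u * h (flow u \<theta>)) < e"
    using d(1) by blast
qed

text \<open>Fubini: the flow preserves the Lebesgue measure of the torus, and the weight has
  integral 1.\<close>

lemma integral_weight_avg:
  assumes h: "continuous_on UNIV (h :: 'n torus \<Rightarrow> real)"
  shows "(LINT \<theta>|torus_lebesgue. LINT u|lborel. weight u * h (flow u \<theta>)) = (LINT \<theta>|torus_lebesgue. h \<theta>)"
proof -
  interpret T: finite_measure "torus_lebesgue :: 'n torus measure" by (rule finite_measure_torus)
  interpret P: pair_sigma_finite lborel "torus_lebesgue :: 'n torus measure" ..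
  obtain B where B: "\<And>\<theta>. \<bar>h \<theta>\<bar> \<le> B" using torus_continuous_bounded[OF h] by blast
  have [measurable]: "h \<in> borel_measurable borel" "weight \<in> borel_measurable borel"
    by (auto intro!: borel_measurable_continuous_onI h weight(1))
  have "(\<lambda>p. flow (fst p) (snd p)) \<in> borel_measurable (borel \<Otimes>\<^sub>M borel)"
    unfolding borel_prod by (rule borel_measurable_continuous_onI[OF continuous_on_flow2])
  then have [measurable]: "(\<lambda>p. flow (fst p) (snd p)) \<in> lborel \<Otimes>\<^sub>M torus_lebesgue \<rightarrow>\<^sub>M borel"
    by (simp cong: measurable_cong_sets)
  have flow_meas: "(\<lambda>\<theta>. flow u \<theta>) \<in> borel_measurable borel" for u
    by (intro borel_measurable_continuous_onI continuous_intros)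
  have int: "integrable torus_lebesgue (\<lambda>\<theta>. h (flow u \<theta>))" for u
    by (intro torus_continuous_integrable continuous_on_compose2[OF h] continuous_intros) auto
  let ?f = "\<lambda>p. weight (fst p) * h (flow (fst p) (snd p))"
  have meas: "?f \<in> borel_measurable (lborel \<Otimes>\<^sub>M torus_lebesgue)" by measurable
  have "integrable (lborel \<Otimes>\<^sub>M torus_lebesgue) ?f"
  proof (rule P.Fubini_integrable[OF meas])
    show "AE u in lborel. integrable torus_lebesgue (\<lambda>\<theta>. ?f (u, \<theta>))" using int by simp
    have "integrable lborel (\<lambda>u. weight u * (LINT \<theta>|torus_lebesgue. \<bar>h \<theta>\<bar>))"
      by (intro integrable_mult_left weight(5))
    moreover have "(LINT \<theta>|torus_lebesgue. norm (?f (u, \<theta>))) = weight u * (LINT \<theta>|torus_lebesgue. \<bar>h \<theta>\<bar>)" for u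
      using integral_torus_shift[of "\<lambda>\<theta>. \<bar>h \<theta>\<bar>" "u *\<^sub>R \<omega>"] by (simp add: abs_mult weight(2) flow_def)
    ultimately show "integrable lborel (\<lambda>u. LINT \<theta>|torus_lebesgue. norm (?f (u, \<theta>)))" by simp
  qed
  then have "(LINT \<theta>|torus_lebesgue. LINT u|lborel. weight u * h (flow u \<theta>))
     = (LINT u|lborel. LINT \<theta>|torus_lebesgue. weight u * h (flow u \<theta>))"
    using P.Fubini_integral[of "\<lambda>u \<theta>. weight u * h (flow u \<theta>)"] by (simp add: case_prod_beta')
  also have "\<dots> = (LINT u|lborel. weight u * (LINT \<theta>|torus_lebesgue. h \<theta>))"
    using integral_torus_shift[of h] by (simp add: flow_def)
  finally show ?thesis by (simp add: weight(4))
qed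

lemma weight_product_equicontinuous:
  assumes h: "continuous_on UNIV (h :: 'n torus \<Rightarrow> real)" and e: "0 < e"
  shows "\<exists>d>0. \<forall>\<theta> u u'. \<bar>u - u'\<bar> \<le> d \<longrightarrow> \<bar>weight u * h (flow u \<theta>) - weight u' * h (flow u' \<theta>)\<bar> \<le> e"
proof -
  obtain B where B: "0 < B" "\<And>\<theta>. \<bar>h \<theta>\<bar> \<le> B" using torus_continuous_bounded[OF h] by blast
  have "compact {- gap..gap}" by simp
  then have "bounded (weight ` {- gap..gap})"
    by (intro compact_imp_bounded compact_continuous_image continuous_on_subset[OF weight(1)]) auto
  then obtain C where C: "0 < C" "\<And>u. u \<in> {- gap..gap} \<Longrightarrow> \<bar>weight u\<bar> \<le> C"
    unfolding bounded_pos by auto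
  have C: "0 < C" "weight u \<le> C" for u
    using C weight(3)[of u] gap(1) by (cases "u \<in> {- gap..gap}"; force simp: abs_le_iff)+
  have "uniformly_continuous_on {- gap..gap} weight"
    by (intro compact_uniformly_continuous continuous_on_subset[OF weight(1)]) auto
  then obtain d1 where d1: "0 < d1" "\<And>u u'. u \<in> {- gap..gap} \<Longrightarrow> u' \<in> {- gap..gap} \<Longrightarrow> dist u u' < d1
      \<Longrightarrow> dist (weight u) (weight u') < e / (2 * B)"
    unfolding uniformly_continuous_on_def using e B(1)
    by (metis dist_commute divide_pos_pos mult_pos_pos zero_less_numeral)
  obtain d2 where d2: "0 < d2" "\<And>\<theta> u u'. \<bar>u - u'\<bar> \<le> d2 \<Longrightarrow> \<bar>h (flow u \<theta>) - h (flow u' \<theta>)\<bar> < e / (2 * C)"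
    using flow_equicontinuous[OF h, of "e / (2 * C)"] e C(1) by auto
  define d where "d = min (min (d1 / 2) d2) (gap / 2)"
  have w: "\<bar>weight u - weight u'\<bar> \<le> e / (2 * B)" if "\<bar>u - u'\<bar> \<le> d" for u u'
  proof (cases "\<bar>u\<bar> \<le> gap \<and> \<bar>u'\<bar> \<le> gap")
    case True
    moreover have "dist u u' < d1" using that d1(1) by (simp add: d_def dist_real_def)
    ultimately have "dist (weight u) (weight u') < e / (2 * B)"
      by (intro d1(2)) (auto simp: abs_le_iff)
    then show ?thesis by (simp add: dist_real_def)
  next
    case False
    \<comment> \<open>One of the times exceeds \<open>gap\<close> in size and the other is at most
      \<open>gap / 2\<close> away, so both weights vanish.\<close>
    then have "gap / 4 \<le> \<bar>u\<bar>" "gap / 4 \<le> \<bar>u'\<bar>" using that gap(1) unfolding d_def by linarith+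
    then show ?thesis using e B by (simp add: weight(3))
  qed
  have "\<bar>weight u * h (flow u \<theta>) - weight u' * h (flow u' \<theta>)\<bar> \<le> e" if "\<bar>u - u'\<bar> \<le> d" for \<theta> u u'
  proof -
    have "weight u * h (flow u \<theta>) - weight u' * h (flow u' \<theta>)
        = (weight u - weight u') * h (flow u \<theta>) + weight u' * (h (flow u \<theta>) - h (flow u' \<theta>))"
      by (simp add: algebra_simps)
    also have "\<bar>\<dots>\<bar> \<le> \<bar>weight u - weight u'\<bar> * \<bar>h (flow u \<theta>)\<bar> + weight u' * \<bar>h (flow u \<theta>) - h (flow u' \<theta>)\<bar>"
      by (rule order_trans[OF abs_triangle_ineq]) (simp add: abs_mult weight(2))
    also have "\<dots> \<le> e / (2 * B) * B + C * (e / (2 * C))"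
    proof (intro add_mono mult_mono)
      show "\<bar>h (flow u \<theta>) - h (flow u' \<theta>)\<bar> \<le> e / (2 * C)"
        using that by (intro less_imp_le[OF d2(2)]) (simp add: d_def)
    qed (use that w B C weight(2) e in auto)
    also have "\<dots> = e" using B C by simp
    finally show ?thesis .
  qed
  moreover have "0 < d" using d1 d2 gap by (simp add: d_def)
  ultimately show ?thesis by blast
qed

text \<open>Where the integrand does not vanish, \<open>zero_nearby\<close> puts \<open>u\<close>
  within \<open>d\<close> of the unique hit. On that interval the factor \<open>?k\<close> is a
  probability density by \<open>kernel_substitution\<close>, so \<open>smear_layer\<close> is an
  average of \<open>weight u * h (flow u \<theta>)\<close> over times close to the hit. Without a
  hit both sides are 0.\<close>

lemma smear_layer_close:
  assumes \<phi>: "bump_kernel \<phi>" and h: "continuous_on UNIV h" and e: "0 < e"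
  shows "\<exists>\<eta>0>0. \<forall>\<eta>. 0 < \<eta> \<longrightarrow> \<eta> < \<eta>0 \<longrightarrow> (\<forall>\<theta>. \<bar>smear_layer \<phi> \<eta> h \<theta> - smear h \<theta>\<bar> \<le> e)"
proof -
  obtain d0 where d0: "0 < d0" "\<And>\<theta> u u'. \<bar>u - u'\<bar> \<le> d0 \<Longrightarrow>
      \<bar>weight u * h (flow u \<theta>) - weight u' * h (flow u' \<theta>)\<bar> \<le> e"
    using weight_product_equicontinuous[OF h e] by blast
  define d where "d = min d0 (gap / 4)"
  have d: "0 < d" "d \<le> gap" "d \<le> gap / 4" using d0 gap by (auto simp: d_def)
  \<comment> \<open>The second bound does two things: zeros found by \<open>zero_nearby\<close> lie
    within \<open>d\<close>, and \<open>S\<close> has grown beyond \<open>\<eta>\<close> in size at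
    both ends of the interval of radius \<open>d\<close> around the hit.\<close>
  define \<eta>0 where "\<eta>0 = min slope (slope / 2 * d)"
  have "\<bar>smear_layer \<phi> \<eta> h \<theta> - smear h \<theta>\<bar> \<le> e" if \<eta>: "0 < \<eta>" "\<eta> < \<eta>0" for \<eta> \<theta>
  proof -
    have \<eta>': "\<eta> \<le> slope" "2 * \<eta> / slope \<le> d" "\<eta> \<le> slope / 2 * d"
      using \<eta> slope(1) by (auto simp: \<eta>0_def field_simps)
    let ?k = "\<lambda>u. \<phi> (S (flow u \<theta>) / \<eta>) / \<eta> * \<bar>DS (flow u \<theta>)\<bar>"
    have support: "hits \<theta> \<noteq> {} \<and> \<bar>u - hit \<theta>\<bar> \<le> d" if nz: "weight u \<noteq> 0" "?k u \<noteq> 0" for u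
    proof -
      have "\<bar>S (flow u \<theta>)\<bar> < \<eta>"
        using nz(2) kernelD(3)[OF \<phi>, of "S (flow u \<theta>) / \<eta>"] \<eta>(1)
        by (auto simp: abs_divide field_simps not_le[symmetric])
      moreover have "2 * \<eta> / slope \<le> gap" using \<eta>' d by linarith
      ultimately obtain z where z: "S (flow z \<theta>) = 0" "\<bar>u - z\<bar> \<le> 2 * \<eta> / slope"
        using zero_nearby \<eta>'(1) by blast
      have "\<bar>u\<bar> < gap / 4" using nz(1) weight(3)[of u] by (force simp: not_le[symmetric])
      then have "z \<in> hits \<theta>" using z \<eta>' d by (auto simp: hits_def)
      then show ?thesis using hit_eq[of z \<theta>] z \<eta>' by auto
    qed
    show ?thesis
    proof (cases "hits \<theta> = {}")
      case True
      then have zero: "weight u * layer \<phi> \<eta> h (flow u \<theta>) = 0" for u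
        using support[of u] by (auto simp: layer_def)
      have "smear_layer \<phi> \<eta> h \<theta> = 0" unfolding smear_layer_def zero by simp
      then show ?thesis using e True by (simp add: smear_def)
    next
      case False
      define z where "z = hit \<theta>"
      have z: "S (flow z \<theta>) = 0" using hit_in[OF False] by (simp add: z_def hits_def)
      have kc: "continuous_on UNIV ?k"
        using \<eta> by (intro continuous_intros continuous_on_along continuous_on_DS continuous_on_S
            continuous_on_compose2[OF kernelD(1)[OF \<phi>]]) auto
      have k0: "0 \<le> ?k u" for u using kernelD(2)[OF \<phi>] \<eta> by simp
      let ?I = "{z - d..z + d}"
      have k1: "(LINT u:?I|lborel. ?k u) = 1"
      proof -
        have "\<bar>S (flow z \<theta>)\<bar> < slope" using z slope by simp
        then obtain \<sigma> where \<sigma>: "\<sigma> = 1 \<or> \<sigma> = -1"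
          "\<forall>t. \<bar>t - z\<bar> \<le> gap \<longrightarrow> slope / 2 \<le> \<sigma> * DS (flow t \<theta>)"
          "\<forall>t. z \<le> t \<longrightarrow> t \<le> z + gap \<longrightarrow> \<sigma> * S (flow z \<theta>) + slope / 2 * (t - z) \<le> \<sigma> * S (flow t \<theta>)"
          "\<forall>t. z - gap \<le> t \<longrightarrow> t \<le> z \<longrightarrow> \<sigma> * S (flow t \<theta>) + slope / 2 * (z - t) \<le> \<sigma> * S (flow z \<theta>)"
          by (rule flow_monotone)
        show ?thesis
        proof (rule kernel_substitution[OF \<phi> \<eta>(1) d(1) S_flow_deriv _ \<sigma>(1)])
          show "continuous_on ?I (\<lambda>u. DS (flow u \<theta>))" by (intro continuous_on_along continuous_on_DS)
          show "0 \<le> \<sigma> * DS (flow u \<theta>)" if "u \<in> ?I" for u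
            using \<sigma>(2)[rule_format, of u] that d slope(1) by (force simp: abs_le_iff)
          show "\<sigma> * S (flow (z - d) \<theta>) \<le> - \<eta>" "\<eta> \<le> \<sigma> * S (flow (z + d) \<theta>)"
            using \<sigma>(3)[rule_format, of "z + d"] \<sigma>(4)[rule_format, of "z - d"] d z \<eta>' by auto
        qed
      qed
      have int: "set_integrable lborel ?I (\<lambda>u. c u * ?k u)" if "continuous_on UNIV c" for c
        by (intro borel_integrable_atLeastAtMost' continuous_on_mult continuous_on_subset[OF that]
            continuous_on_subset[OF kc]) auto
      have wh: "continuous_on UNIV (\<lambda>u. weight u * h (flow u \<theta>))"
        by (intro continuous_on_mult weight(1) continuous_on_along h)
      have "smear_layer \<phi> \<eta> h \<theta> = (LINT u:?I|lborel. weight u * h (flow u \<theta>) * ?k u)"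
        unfolding smear_layer_def set_lebesgue_integral_def
      proof (intro Bochner_Integration.integral_cong refl)
        fix u
        show "weight u * layer \<phi> \<eta> h (flow u \<theta>) = indicator ?I u *\<^sub>R (weight u * h (flow u \<theta>) * ?k u)"
          using support[of u] by (cases "u \<in> ?I") (auto simp: layer_def z_def abs_le_iff)
      qed
      moreover have "smear h \<theta> = (LINT u:?I|lborel. weight z * h (flow z \<theta>) * ?k u)"
        using False k1 by (simp add: smear_def z_def)
      ultimately have "\<bar>smear_layer \<phi> \<eta> h \<theta> - smear h \<theta>\<bar>
         = \<bar>LINT u:?I|lborel. (weight u * h (flow u \<theta>) - weight z * h (flow z \<theta>)) * ?k u\<bar>"
        using set_integral_diff(2)[OF int[OF wh] int[OF continuous_on_const]]
        by (simp only: left_diff_distrib)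
      also have "\<dots> \<le> (LINT u:?I|lborel. \<bar>(weight u * h (flow u \<theta>) - weight z * h (flow z \<theta>)) * ?k u\<bar>)"
        using set_integral_norm_bound[OF int[OF continuous_on_diff[OF wh continuous_on_const]]] by simp
      also have "\<dots> \<le> (LINT u:?I|lborel. e * ?k u)"
      proof (rule set_integral_mono)
        show "set_integrable lborel ?I (\<lambda>u. \<bar>(weight u * h (flow u \<theta>) - weight z * h (flow z \<theta>)) * ?k u\<bar>)"
          by (intro set_integrable_abs int continuous_on_diff wh continuous_on_const)
        show "set_integrable lborel ?I (\<lambda>u. e * ?k u)" by (intro int continuous_on_const)
        fix u assume u: "u \<in> ?I"
        then have "\<bar>u - z\<bar> \<le> d0" by (auto simp: d_def abs_le_iff)
        then show "\<bar>(weight u * h (flow u \<theta>) - weight z * h (flow z \<theta>)) * ?k u\<bar> \<le> e * ?k u"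
          unfolding abs_mult[of _ "?k u"] abs_of_nonneg[OF k0] by (intro mult_right_mono k0 d0(2))
      qed
      also have "\<dots> = e" using k1 by simp
      finally show ?thesis .
    qed
  qed
  moreover have "0 < \<eta>0" using slope(1) d by (simp add: \<eta>0_def)
  ultimately show ?thesis by blast
qed

lemma continuous_on_smear_layer:
  assumes "bump_kernel \<phi>" "0 < \<eta>" "continuous_on UNIV h"
  shows "continuous_on UNIV (smear_layer \<phi> \<eta> h)"
  unfolding smear_layer_def[abs_def] by (rule continuous_on_weight_avg[OF continuous_on_layer[OF assms]])

lemma continuous_on_smear:
  assumes h: "continuous_on UNIV h"
  shows "continuous_on UNIV (smear h)"
  unfolding continuous_on_iff
proof (intro ballI allI impI)
  fix \<theta> :: "'n torus" and e :: real assume e: "0 < e"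
  obtain \<eta>0 where \<eta>0: "0 < \<eta>0" "\<forall>\<eta>. 0 < \<eta> \<longrightarrow> \<eta> < \<eta>0 \<longrightarrow> (\<forall>\<theta>. \<bar>smear_layer base_kernel \<eta> h \<theta> - smear h \<theta>\<bar> \<le> e / 3)"
    using smear_layer_close[OF base_kernel h, of "e / 3"] e by auto
  define g where "g = smear_layer base_kernel (\<eta>0 / 2) h"
  have g: "\<bar>g \<theta> - smear h \<theta>\<bar> \<le> e / 3" for \<theta>
    using \<eta>0 by (simp add: g_def)
  have "continuous_on UNIV g"
    unfolding g_def using \<eta>0(1) by (intro continuous_on_smear_layer base_kernel h) simp
  then obtain d where d: "0 < d" "\<And>\<theta>'. dist \<theta>' \<theta> < d \<Longrightarrow> dist (g \<theta>') (g \<theta>) < e / 3"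
    unfolding continuous_on_iff using e by (metis UNIV_I divide_pos_pos zero_less_numeral)
  have "dist (smear h \<theta>') (smear h \<theta>) < e" if "dist \<theta>' \<theta> < d" for \<theta>'
    using d(2)[OF that] g[of \<theta>] g[of \<theta>'] unfolding dist_real_def by linarith
  then show "\<exists>d>0. \<forall>\<theta>'\<in>UNIV. dist \<theta>' \<theta> < d \<longrightarrow> dist (smear h \<theta>') (smear h \<theta>) < e"
    using d(1) by blast
qed

lemma layer_integral_tendsto:
  assumes \<phi>: "bump_kernel \<phi>" and h: "continuous_on UNIV h"
  shows "((\<lambda>\<eta>. LINT \<theta>|torus_lebesgue. layer \<phi> \<eta> h \<theta>) \<longlongrightarrow> (LINT \<theta>|torus_lebesgue. smear h \<theta>)) (at_right 0)"
  unfolding tendsto_iff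
proof (intro allI impI)
  fix e :: real assume e: "0 < e"
  define V where "V = (2 * pi) ^ CARD('n)"
  have V: "0 < V" by (simp add: V_def)
  obtain \<eta>0 where \<eta>0: "0 < \<eta>0" "\<forall>\<eta>. 0 < \<eta> \<longrightarrow> \<eta> < \<eta>0 \<longrightarrow> (\<forall>\<theta>. \<bar>smear_layer \<phi> \<eta> h \<theta> - smear h \<theta>\<bar> \<le> e / (2 * V))"
    using smear_layer_close[OF \<phi> h, of "e / (2 * V)"] e V by auto
  have "dist (LINT \<theta>|torus_lebesgue. layer \<phi> \<eta> h \<theta>) (LINT \<theta>|torus_lebesgue. smear h \<theta>) < e"
    if "0 < \<eta>" "\<eta> < \<eta>0" for \<eta>
  proof -
    note c = continuous_on_smear_layer[OF \<phi> that(1) h] continuous_on_smear[OF h]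
    have "(LINT \<theta>|torus_lebesgue. layer \<phi> \<eta> h \<theta>) = (LINT \<theta>|torus_lebesgue. smear_layer \<phi> \<eta> h \<theta>)"
      unfolding smear_layer_def by (rule integral_weight_avg[OF continuous_on_layer[OF \<phi> that(1) h], symmetric])
    then have "(LINT \<theta>|torus_lebesgue. layer \<phi> \<eta> h \<theta>) - (LINT \<theta>|torus_lebesgue. smear h \<theta>)
       = (LINT \<theta>|torus_lebesgue. smear_layer \<phi> \<eta> h \<theta> - smear h \<theta>)"
      by (simp add: torus_continuous_integrable c)
    moreover have "\<bar>LINT \<theta>|torus_lebesgue. smear_layer \<phi> \<eta> h \<theta> - smear h \<theta>\<bar> \<le> (2 * pi) ^ CARD('n) * (e / (2 * V))"
      by (rule torus_integral_bound) (use c \<eta>0(2) that in \<open>auto intro!: continuous_intros\<close>)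
    moreover have "(2 * pi) ^ CARD('n) * (e / (2 * V)) = e / 2" unfolding V_def[symmetric] using V by simp
    ultimately show ?thesis using e by (simp add: dist_real_def)
  qed
  then show "\<forall>\<^sub>F \<eta> in at_right 0. dist (LINT \<theta>|torus_lebesgue. layer \<phi> \<eta> h \<theta>) (LINT \<theta>|torus_lebesgue. smear h \<theta>) < e"
    using \<eta>0(1) unfolding eventually_at_right_field by blast
qed

definition mass :: real where
  "mass = (LINT \<theta>|torus_lebesgue. smear (\<lambda>_. 1) \<theta>)"

text \<open>\<open>mass\<close> is defined through \<open>smear\<close>, which does not involve
  \<open>\<phi>\<close>, so the limit is the same for all mollifiers.\<close>

lemma has_delta_integral_mass: "has_delta_integral S (\<lambda>\<theta>. \<bar>DS \<theta>\<bar>) mass"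
  unfolding has_delta_integral_def mass_def
proof (intro allI impI)
  fix \<phi> assume "mollifier \<phi>"
  then show "((\<lambda>\<eta>. LINT \<theta>|torus_lebesgue. \<phi> (S \<theta> / \<eta>) / \<eta> * \<bar>DS \<theta>\<bar>) \<longlongrightarrow> (LINT \<theta>|torus_lebesgue. smear (\<lambda>_. 1) \<theta>)) (at_right 0)"
    using layer_integral_tendsto[OF mollifier_kernel, of \<phi> "\<lambda>_. 1"] by (simp add: layer_def)
qed

section \<open>Counting zeros along an orbit\<close>

definition zeros_in :: "'n torus \<Rightarrow> real \<Rightarrow> real \<Rightarrow> real set" where
  "zeros_in \<theta> a b = {t\<in>{a..b}. S (flow t \<theta>) = 0}"

text \<open>Cells of length \<open>gap\<close> contain at most one zero each, so zeros are told
  apart by the integer \<open>\<lfloor>t / gap\<rfloor>\<close>.\<close>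

lemma finite_zeros_in: "finite (zeros_in \<theta> a b)"
proof (rule inj_on_finite)
  show "inj_on (\<lambda>t. \<lfloor>t / gap\<rfloor>) (zeros_in \<theta> a b)"
  proof (rule inj_onI)
    fix t t' assume t: "t \<in> zeros_in \<theta> a b" "t' \<in> zeros_in \<theta> a b" "\<lfloor>t / gap\<rfloor> = \<lfloor>t' / gap\<rfloor>"
    then have "\<bar>t / gap - t' / gap\<bar> < 1" by linarith
    then have "\<bar>t - t'\<bar> / gap < 1" using gap(1) by (simp add: diff_divide_distrib[symmetric])
    then have "\<bar>t - t'\<bar> \<le> gap" using gap(1) by simp
    then show "t = t'" using t zeros_separated[of t \<theta> t'] by (simp add: zeros_in_def)
  qed
  show "(\<lambda>t. \<lfloor>t / gap\<rfloor>) ` zeros_in \<theta> a b \<subseteq> {\<lfloor>a / gap\<rfloor>..\<lfloor>b / gap\<rfloor>}"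
    using gap(1) by (auto simp: zeros_in_def intro!: floor_mono divide_right_mono)
qed simp

lemma card_zeros_in_short:
  assumes "Z \<subseteq> zeros_in \<theta> a b" "b - a \<le> gap"
  shows "card Z \<le> 1"
proof -
  have "t = t'" if "t \<in> Z" "t' \<in> Z" for t t'
  proof (rule zeros_separated)
    have "a \<le> t" "t \<le> b" "a \<le> t'" "t' \<le> b" using that assms(1) by (auto simp: zeros_in_def)
    then show "\<bar>t - t'\<bar> \<le> gap" using assms(2) by linarith
  qed (use that assms(1) in \<open>auto simp: zeros_in_def\<close>)
  then have "finite Z \<and> card Z \<le> Suc 0" by (subst card_le_Suc0_iff_eq) (auto intro: finite_subset[OF assms(1) finite_zeros_in])
  then show ?thesis by simp
qed

text \<open>The weight kills every zero outside the window around \<open>t\<close>, and the window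
  holds at most one. Extending the interval by \<open>gap\<close> at both ends catches hits that lie
  outside \<open>{0..L}\<close>.\<close>

lemma smear_flow_sum:
  assumes t: "t \<in> {0..L}"
  shows "smear h (flow t \<theta>) = (\<Sum>z\<in>zeros_in \<theta> (- gap) (L + gap). weight (z - t) * h (flow z \<theta>))"
proof -
  let ?Z = "zeros_in \<theta> (- gap) (L + gap)"
  have hits: "u \<in> hits (flow t \<theta>) \<longleftrightarrow> \<bar>u\<bar> < gap / 2 \<and> S (flow (u + t) \<theta>) = 0" for u
    by (simp add: hits_def flow_flow)
  have off: "weight (z - t) = 0" if "z \<in> ?Z" "z - t \<notin> hits (flow t \<theta>)" for z
  proof (rule weight(3))
    have "\<not> \<bar>z - t\<bar> < gap / 2" using that by (auto simp: hits zeros_in_def)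
    then show "gap / 4 \<le> \<bar>z - t\<bar>" using gap(1) by linarith
  qed
  show ?thesis
  proof (cases "hits (flow t \<theta>) = {}")
    case True
    then show ?thesis using off by (auto simp: smear_def intro!: sum.neutral[symmetric])
  next
    case False
    define z where "z = hit (flow t \<theta>) + t"
    have z: "z - t \<in> hits (flow t \<theta>)" using hit_in[OF False] by (simp add: z_def)
    then have "\<bar>z - t\<bar> < gap / 2" "S (flow z \<theta>) = 0" by (auto simp: hits)
    moreover from this have "- gap \<le> z" "z \<le> L + gap"
      using t gap(1) unfolding atLeastAtMost_iff by linarith+
    ultimately have zZ: "z \<in> ?Z" by (simp add: zeros_in_def)
    have "(\<Sum>z\<in>?Z. weight (z - t) * h (flow z \<theta>)) = (\<Sum>z\<in>{z}. weight (z - t) * h (flow z \<theta>))"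
    proof (rule sum.mono_neutral_right)
      show "\<forall>y\<in>?Z - {z}. weight (y - t) * h (flow y \<theta>) = 0"
      proof
        fix y assume y: "y \<in> ?Z - {z}"
        then have "y - t \<notin> hits (flow t \<theta>)" using hits_unique[OF _ z, of "y - t"] by auto
        then show "weight (y - t) * h (flow y \<theta>) = 0" using off[of y] y by simp
      qed
    qed (use zZ finite_zeros_in in auto)
    then show ?thesis using False by (simp add: smear_def flow_flow z_def)
  qed
qed

lemma weight_reflect:
  "(LINT t|lborel. weight (z - t)) = 1" "integrable lborel (\<lambda>t. weight (z - t))"
proof -
  have "(LINT t|lborel. weight t) = \<bar>- 1\<bar> *\<^sub>R (LINT t|lborel. weight (z + (- 1) * t))"
    by (rule lborel_integral_real_affine) simp
  then show 1: "(LINT t|lborel. weight (z - t)) = 1" by (simp add: weight(4))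
  then show "integrable lborel (\<lambda>t. weight (z - t))"
    using not_integrable_integral_eq[of lborel "\<lambda>t. weight (z - t)"] by fastforce
qed

lemma weight_window:
  fixes L z :: real
  defines "W \<equiv> (LINT t:{0..L}|lborel. weight (z - t))"
  shows "0 \<le> W" "W \<le> 1" "gap / 4 \<le> z \<Longrightarrow> z \<le> L - gap / 4 \<Longrightarrow> W = 1"
    "z \<le> - (gap / 4) \<or> L + gap / 4 \<le> z \<Longrightarrow> W = 0"
proof -
  show "0 \<le> W" unfolding W_def set_lebesgue_integral_def by (simp add: weight(2))
  have "W \<le> (LINT t|lborel. weight (z - t))"
    unfolding W_def set_lebesgue_integral_def
  proof (rule integral_mono[OF _ weight_reflect(2)])
    show "integrable lborel (\<lambda>t. indicator {0..L} t *\<^sub>R weight (z - t))"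
      by (intro integrable_mult_indicator weight_reflect(2)) simp
  qed (auto simp: weight(2) indicator_def)
  then show "W \<le> 1" by (simp add: weight_reflect)
  show "W = 1" if "gap / 4 \<le> z" "z \<le> L - gap / 4"
  proof -
    have "W = (LINT t|lborel. weight (z - t))"
      unfolding W_def set_lebesgue_integral_def
    proof (intro Bochner_Integration.integral_cong refl)
      fix t
      have "gap / 4 \<le> \<bar>z - t\<bar>" if "t \<notin> {0..L}"
      proof -
        have "t < 0 \<or> L < t" using that by auto
        then show ?thesis using \<open>gap / 4 \<le> z\<close> \<open>z \<le> L - gap / 4\<close> by linarith
      qed
      then show "indicator {0..L} t *\<^sub>R weight (z - t) = weight (z - t)"
        using weight(3)[of "z - t"] by (cases "t \<in> {0..L}") auto
    qed
    then show ?thesis by (simp add: weight_reflect)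
  qed
  show "W = 0" if "z \<le> - (gap / 4) \<or> L + gap / 4 \<le> z"
  proof -
    have "indicator {0..L} t *\<^sub>R weight (z - t) = 0" for t
    proof (cases "t \<in> {0..L}")
      case True
      then have "gap / 4 \<le> \<bar>z - t\<bar>" using that unfolding atLeastAtMost_iff by linarith
      then show ?thesis by (simp add: weight(3))
    qed simp
    then show ?thesis unfolding W_def set_lebesgue_integral_def by (simp only: integral_zero)
  qed
qed

text \<open>Only the zeros within \<open>gap / 4\<close> of the two ends are counted wrongly, at most one at each end.\<close>

lemma smear_integral_count:
  assumes L: "0 \<le> L" and h: "continuous_on UNIV h" and B: "\<And>\<theta>. \<bar>h \<theta>\<bar> \<le> B"
  shows "\<bar>(LINT t:{0..L}|lborel. smear h (flow t \<theta>)) - (\<Sum>z\<in>zeros_in \<theta> 0 L. h (flow z \<theta>))\<bar> \<le> 2 * B"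
proof -
  let ?Z = "zeros_in \<theta> (- gap) (L + gap)"
  let ?h = "\<lambda>z. h (flow z \<theta>)"
  let ?W = "\<lambda>z. LINT t:{0..L}|lborel. weight (z - t)"
  let ?one = "\<lambda>z. if z \<in> zeros_in \<theta> 0 L then 1 else 0 :: real"
  note fin = finite_zeros_in[of \<theta>]
  have int: "set_integrable lborel {0..L} (\<lambda>t. weight (z - t))" for z
    by (intro borel_integrable_atLeastAtMost' continuous_on_compose2[OF weight(1)] continuous_intros) auto
  have "(LINT t:{0..L}|lborel. smear h (flow t \<theta>)) = (LINT t:{0..L}|lborel. \<Sum>z\<in>?Z. weight (z - t) * ?h z)"
    unfolding set_lebesgue_integral_def
    by (intro Bochner_Integration.integral_cong refl) (auto simp: indicator_def smear_flow_sum)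
  also have "\<dots> = (\<Sum>z\<in>?Z. LINT t:{0..L}|lborel. weight (z - t) * ?h z)"
    using int unfolding set_lebesgue_integral_def set_integrable_def
    by (simp add: sum_distrib_left mult.assoc[symmetric])
  also have "\<dots> = (\<Sum>z\<in>?Z. ?W z * ?h z)" by simp
  finally have 1: "(LINT t:{0..L}|lborel. smear h (flow t \<theta>)) = (\<Sum>z\<in>?Z. ?W z * ?h z)" .
  have "(\<Sum>z\<in>zeros_in \<theta> 0 L. ?h z) = (\<Sum>z\<in>zeros_in \<theta> 0 L. ?one z * ?h z)" by simp
  also have "\<dots> = (\<Sum>z\<in>?Z. ?one z * ?h z)"
    using gap(1) by (intro sum.mono_neutral_left fin) (auto simp: zeros_in_def)
  finally have 2: "(\<Sum>z\<in>zeros_in \<theta> 0 L. ?h z) = (\<Sum>z\<in>?Z. ?one z * ?h z)" .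
  let ?E1 = "zeros_in \<theta> (- (gap / 4)) (gap / 4)" and ?E2 = "zeros_in \<theta> (L - gap / 4) (L + gap / 4)"
  have eq: "?W z = ?one z" if "z \<in> ?Z" "z \<notin> ?E1 \<union> ?E2" for z
  proof -
    have S0: "S (flow z \<theta>) = 0" using that by (simp add: zeros_in_def)
    have "\<not> (- (gap / 4) \<le> z \<and> z \<le> gap / 4)" "\<not> (L - gap / 4 \<le> z \<and> z \<le> L + gap / 4)"
      using that by (auto simp: zeros_in_def)
    then consider "z \<le> - (gap / 4) \<or> L + gap / 4 \<le> z" | "gap / 4 \<le> z" "z \<le> L - gap / 4" by linarith
    then show ?thesis
    proof cases
      case 1
      then have "z \<notin> zeros_in \<theta> 0 L" using gap(1) by (auto simp: zeros_in_def)
      then show ?thesis using weight_window(4)[OF 1] by simp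
    next
      case 2
      then have "z \<in> zeros_in \<theta> 0 L" using gap(1) S0 by (auto simp: zeros_in_def)
      then show ?thesis using weight_window(3)[OF 2] by simp
    qed
  qed
  have "\<bar>(\<Sum>z\<in>?Z. ?W z * ?h z) - (\<Sum>z\<in>?Z. ?one z * ?h z)\<bar> = \<bar>\<Sum>z\<in>?Z. (?W z - ?one z) * ?h z\<bar>"
    by (simp only: left_diff_distrib sum_subtractf)
  also have "\<dots> \<le> (\<Sum>z\<in>?Z. \<bar>(?W z - ?one z) * ?h z\<bar>)" by (rule sum_abs)
  also have "\<dots> \<le> (\<Sum>z\<in>?Z. if z \<in> ?E1 \<union> ?E2 then B else 0)"
  proof (rule sum_mono)
    fix z assume z: "z \<in> ?Z"
    show "\<bar>(?W z - ?one z) * ?h z\<bar> \<le> (if z \<in> ?E1 \<union> ?E2 then B else 0)"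
    proof (cases "z \<in> ?E1 \<union> ?E2")
      case True
      have "\<bar>?W z - ?one z\<bar> \<le> 1" using weight_window(1,2)[where z = z and L = L] by auto
      then have "\<bar>?W z - ?one z\<bar> * \<bar>?h z\<bar> \<le> 1 * B" by (intro mult_mono B) auto
      then show ?thesis using True by (simp add: abs_mult)
    qed (use eq[OF z] in simp)
  qed
  also have "\<dots> = (\<Sum>z\<in>?Z \<inter> (?E1 \<union> ?E2). B)"
    by (subst sum.inter_restrict[OF fin]) simp
  also have "\<dots> \<le> real (card (?E1 \<union> ?E2)) * B"
  proof -
    have "0 \<le> B" using B[of \<theta>] by linarith
    then show ?thesis using fin by (simp add: mult_right_mono card_mono)
  qed
  also have "\<dots> \<le> 2 * B"
  proof (rule mult_right_mono)
    have "card ?E1 \<le> 1" "card ?E2 \<le> 1"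
      by (rule card_zeros_in_short[OF order_refl], use gap(1) in simp)+
    then show "real (card (?E1 \<union> ?E2)) \<le> 2" using card_Un_le[of ?E1 ?E2] by simp
    show "0 \<le> B" using B[of \<theta>] by linarith
  qed
  finally show ?thesis unfolding 1 2 .
qed

lemma flow_fun_eq: "flow_fun S \<omega> t = S (flow t (torus_proj 0))"
  by (simp add: flow_fun_def)

lemma zeros_upto_eq: "zeros_upto (flow_fun S \<omega>) L = zeros_in (torus_proj 0) 0 L"
  by (simp add: zeros_upto_def zeros_in_def flow_fun_eq)

lemma zero_average_tendsto:
  assumes h: "continuous_on UNIV h"
  shows "((\<lambda>L. (\<Sum>z\<in>zeros_upto (flow_fun S \<omega>) L. h (torus_proj (z *\<^sub>R \<omega>))) / L)
    \<longlongrightarrow> (LINT \<theta>|torus_lebesgue. smear h \<theta>) / (2 * pi) ^ CARD('n)) at_top"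
proof -
  obtain B where B: "\<And>\<theta>. \<bar>h \<theta>\<bar> \<le> B" using torus_continuous_bounded[OF h] by blast
  let ?s = "\<lambda>L. (\<Sum>z\<in>zeros_upto (flow_fun S \<omega>) L. h (torus_proj (z *\<^sub>R \<omega>))) / L"
  have lim: "(time_avg \<omega> (smear h) \<longlongrightarrow> (LINT \<theta>|torus_lebesgue. smear h \<theta>) / (2 * pi) ^ CARD('n)) at_top"
    by (rule equidistribution[OF nonres continuous_on_smear[OF h]])
  have "((\<lambda>L. ?s L - time_avg \<omega> (smear h) L) \<longlongrightarrow> 0) at_top"
  proof (rule Lim_null_comparison)
    show "\<forall>\<^sub>F L in at_top. norm (?s L - time_avg \<omega> (smear h) L) \<le> 2 * B * (1 / L)"
      using eventually_gt_at_top[of 0]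
    proof eventually_elim
      case (elim L)
      then have "\<bar>(LINT t:{0..L}|lborel. smear h (torus_proj (t *\<^sub>R \<omega>)))
          - (\<Sum>z\<in>zeros_upto (flow_fun S \<omega>) L. h (torus_proj (z *\<^sub>R \<omega>)))\<bar> \<le> 2 * B"
        using smear_integral_count[OF _ h B, of L "torus_proj 0"] by (simp add: zeros_upto_eq)
      then show ?case
        using elim by (simp add: time_avg_def abs_minus_commute divide_right_mono flip: diff_divide_distrib)
    qed
    show "((\<lambda>L. 2 * B * (1 / L)) \<longlongrightarrow> 0) at_top"
      by (intro tendsto_mult_right_zero tendsto_divide_0[OF tendsto_const]
          filterlim_at_top_imp_at_infinity filterlim_ident)
  qed
  from tendsto_add[OF this lim] show ?thesis by simp
qed

lemma zero_density: "((\<lambda>L. real (card (zeros_upto (flow_fun S \<omega>) L)) / L) \<longlongrightarrow> mass / (2 * pi) ^ CARD('n)) at_top"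
  using zero_average_tendsto[of "\<lambda>_. 1"] by (simp add: mass_def)

text \<open>If the preimage were null in the fundamental cube, it would by periodicity be null in
  the whole space, which is impossible for a nonempty open set.\<close>

lemma torus_open_measure_pos:
  assumes U: "open (U :: 'n torus set)" "U \<noteq> {}"
  shows "emeasure torus_lebesgue U \<noteq> 0"
proof
  assume null: "emeasure torus_lebesgue U = 0"
  have [measurable]: "U \<in> sets borel" using U by simp
  let ?U = "torus_proj -` U :: (real ^ 'n) set"
  have oU: "open ?U" using U(1) continuous_on_torus_proj_UNIV by (rule open_vimage)
  then have [measurable]: "?U \<in> sets borel" by simp
  obtain x where "x \<in> ?U" using U(2) torus_cases by (metis ex_in_conv vimageI)
  have "(\<integral>\<^sup>+x. indicator U (torus_proj x) * indicator fund_cube x \<partial>lborel) = 0"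
    using nn_integral_torus[of "indicator U"] null by simp
  then have "AE x in lborel. indicator U (torus_proj x) * indicator fund_cube x = (0 :: ennreal)"
    by (subst (asm) nn_integral_0_iff_AE) auto
  then have "AE x in lborel. (\<integral>\<^sup>+k. indicator ?U (x + lattice_vec k) \<partial>count_space UNIV) * indicator fund_cube x = (0 :: ennreal)"
    by eventually_elim (auto simp: indicator_def)
  then have "(\<integral>\<^sup>+x. (\<integral>\<^sup>+k. indicator ?U (x + lattice_vec k) \<partial>count_space UNIV) * indicator fund_cube x \<partial>lborel) = 0"
    by (subst nn_integral_cong_AE[where v = "\<lambda>_. 0"]) auto
  then have "emeasure lborel ?U = 0"
    using nn_integral_unfold[of "indicator ?U"] by simp
  then have "?U \<in> null_sets lebesgue" by (simp add: null_sets_def)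
  then show False using open_not_negligible[OF oU] \<open>x \<in> ?U\<close> by (auto simp: negligible_iff_null_sets)
qed

text \<open>Flowing back from a point of the zero set by a time of positive weight reaches a point
  where the nonnegative continuous function \<open>?g\<close> is positive.\<close>

lemma mass_pos: "0 < mass"
proof -
  let ?g = "smear (\<lambda>_. 1)"
  have c: "continuous_on UNIV ?g" by (rule continuous_on_smear) simp
  have nn: "0 \<le> ?g \<theta>" for \<theta> by (simp add: smear_def weight(2))
  obtain p where p: "S p = 0" using nonempty by (auto simp: zero_set_def)
  have "\<exists>u. weight u \<noteq> 0"
  proof (rule ccontr)
    assume "\<not> ?thesis"
    then have "(LINT u|lborel. weight u) = 0" by simp
    then show False by (simp add: weight(4))
  qed
  then obtain u where u: "weight u \<noteq> 0" by blast
  have "\<bar>u\<bar> < gap / 4" using u weight(3)[of u] by (force simp: not_le[symmetric])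
  then have "u \<in> hits (flow (- u) p)" using p gap(1) by (simp add: hits_def flow_flow)
  then have pos: "?g (flow (- u) p) \<noteq> 0" using u hit_eq by (auto simp: smear_def)
  have "mass \<noteq> 0"
  proof
    assume "mass = 0"
    then have "AE \<theta> in torus_lebesgue. ?g \<theta> = 0"
      unfolding mass_def using nn by (subst (asm) integral_nonneg_eq_0_iff_AE) (auto intro: torus_continuous_integrable c)
    moreover have op: "open (?g -` (- {0}))" by (intro open_vimage c open_Compl) simp
    ultimately have "emeasure torus_lebesgue (?g -` (- {0})) = 0"
      by (subst (asm) AE_iff_measurable[where N = "?g -` (- {0})"]) auto
    then show False using torus_open_measure_pos[OF op] pos by blast
  qed
  moreover have "0 \<le> mass" unfolding mass_def using nn by simp
  ultimately show ?thesis by simp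
qed

end

section \<open>The flux measure and the surface measure\<close>

lemma ennreal_le_of_le_mult:
  fixes x y :: ennreal
  assumes "\<And>c. 1 < c \<Longrightarrow> x \<le> ennreal c * y"
  shows "x \<le> y"
proof (cases y)
  case (real r)
  show ?thesis
  proof (rule ennreal_le_epsilon)
    fix e :: real assume e: "0 < e"
    \<comment> \<open>The denominator is \<open>r + 1\<close> because \<open>r\<close> may be 0; the
      excess \<open>e / (r + 1) * r\<close> is still at most \<open>e\<close>.\<close>
    have "x \<le> ennreal (1 + e / (r + 1)) * y" using e real by (intro assms) simp
    also have "\<dots> = ennreal ((1 + e / (r + 1)) * r)" unfolding real(2) by (rule ennreal_mult[symmetric]) (use e real in auto)
    also have "\<dots> \<le> ennreal (r + e)" using e real by (intro ennreal_leI) (simp add: field_simps)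
    also have "\<dots> = y + ennreal e" using e real by simp
    finally show "x \<le> y + ennreal e" .
  qed
qed simp

text \<open>Each line in direction \<open>\<omega>\<close> meets the slab in a segment of duration \<open>1 / \<bar>\<omega> \<bullet> n\<bar>\<close>.\<close>

lemma nn_integral_slab:
  fixes F :: "'a::euclidean_space \<Rightarrow> ennreal" and n \<omega> :: 'a
  assumes [measurable]: "F \<in> borel_measurable borel" and w: "\<omega> \<bullet> n \<noteq> 0"
  shows "(\<integral>\<^sup>+x. F x \<partial>lborel) = ennreal \<bar>\<omega> \<bullet> n\<bar> *
    (\<integral>\<^sup>+x. indicator {x. \<bar>x \<bullet> n\<bar> \<le> 1 / 2} x * (\<integral>\<^sup>+u. F (x - u *\<^sub>R \<omega>) \<partial>lborel) \<partial>lborel)"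
proof -
  let ?D = "{x. \<bar>x \<bullet> n\<bar> \<le> 1 / 2}" and ?a = "\<omega> \<bullet> n"
  have "closed ?D" by (intro closed_Collect_le continuous_intros)
  then have [measurable]: "?D \<in> sets borel" by (rule borel_closed)
  have [measurable]: "(\<lambda>p. fst p - snd p *\<^sub>R \<omega>) \<in> borel \<Otimes>\<^sub>M borel \<rightarrow>\<^sub>M borel"
    "(\<lambda>p. fst p + snd p *\<^sub>R \<omega>) \<in> borel \<Otimes>\<^sub>M borel \<rightarrow>\<^sub>M borel"
    by measurable
  have seg: "ennreal \<bar>?a\<bar> * (\<integral>\<^sup>+u. indicator ?D (x + u *\<^sub>R \<omega>) \<partial>lborel) = 1" for x
  proof -
    define l where "l = (if 0 < ?a then (- 1 / 2 - x \<bullet> n) / ?a else (1 / 2 - x \<bullet> n) / ?a)"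
    define r where "r = (if 0 < ?a then (1 / 2 - x \<bullet> n) / ?a else (- 1 / 2 - x \<bullet> n) / ?a)"
    have lr: "r - l = 1 / \<bar>?a\<bar>" "l \<le> r"
      using w by (auto simp: l_def r_def field_simps)
    have "indicator ?D (x + u *\<^sub>R \<omega>) = (indicator {l..r} u :: ennreal)" for u
    proof -
      have "\<bar>x \<bullet> n + u * ?a\<bar> \<le> 1 / 2 \<longleftrightarrow> l \<le> u \<and> u \<le> r"
      proof -
        have abs: "\<bar>z\<bar> \<le> 1 / 2 \<longleftrightarrow> - 1 / 2 \<le> z \<and> z \<le> 1 / 2" for z :: real by linarith
        consider "0 < ?a" | "?a < 0" using w by linarith
        then show ?thesis
        proof cases
          case 1
          then show ?thesis unfolding abs l_def r_def by (auto simp: pos_divide_le_eq pos_le_divide_eq)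
        next
          case 2
          then show ?thesis unfolding abs l_def r_def by (auto simp: neg_divide_le_eq neg_le_divide_eq)
        qed
      qed
      then show ?thesis by (simp add: indicator_def inner_add_left)
    qed
    then have "(\<integral>\<^sup>+u. indicator ?D (x + u *\<^sub>R \<omega>) \<partial>lborel) = ennreal (1 / \<bar>?a\<bar>)"
      using lr by simp
    then show ?thesis using w by (simp flip: ennreal_mult)
  qed
  \<comment> \<open>Insert the normalised time spent in the slab, which is 1, exchange the
    integrals, translate by \<open>u *\<^sub>R \<omega>\<close> for fixed \<open>u\<close>, and
    exchange again.\<close>
  have "(\<integral>\<^sup>+x. F x \<partial>lborel) = (\<integral>\<^sup>+x. ennreal \<bar>?a\<bar> * (\<integral>\<^sup>+u. F x * indicator ?D (x + u *\<^sub>R \<omega>) \<partial>lborel) \<partial>lborel)"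
  proof (rule nn_integral_cong)
    fix x
    have "ennreal \<bar>?a\<bar> * (\<integral>\<^sup>+u. F x * indicator ?D (x + u *\<^sub>R \<omega>) \<partial>lborel)
       = F x * (ennreal \<bar>?a\<bar> * (\<integral>\<^sup>+u. indicator ?D (x + u *\<^sub>R \<omega>) \<partial>lborel))"
      by (subst nn_integral_cmult) (simp_all add: ac_simps)
    then show "F x = ennreal \<bar>?a\<bar> * (\<integral>\<^sup>+u. F x * indicator ?D (x + u *\<^sub>R \<omega>) \<partial>lborel)" by (simp only: seg mult_1_right)
  qed
  also have "\<dots> = ennreal \<bar>?a\<bar> * (\<integral>\<^sup>+x. (\<integral>\<^sup>+u. F x * indicator ?D (x + u *\<^sub>R \<omega>) \<partial>lborel) \<partial>lborel)"
    by (rule nn_integral_cmult) measurable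
  also have "(\<integral>\<^sup>+x. (\<integral>\<^sup>+u. F x * indicator ?D (x + u *\<^sub>R \<omega>) \<partial>lborel) \<partial>lborel)
     = (\<integral>\<^sup>+u. (\<integral>\<^sup>+x. F x * indicator ?D (x + u *\<^sub>R \<omega>) \<partial>lborel) \<partial>lborel)"
    by (rule lborel_pair.Fubini'[symmetric]) measurable
  also have "\<dots> = (\<integral>\<^sup>+u. (\<integral>\<^sup>+x. F (x - u *\<^sub>R \<omega>) * indicator ?D x \<partial>lborel) \<partial>lborel)"
  proof (rule nn_integral_cong)
    fix u :: real
    show "(\<integral>\<^sup>+x. F x * indicator ?D (x + u *\<^sub>R \<omega>) \<partial>lborel) = (\<integral>\<^sup>+x. F (x - u *\<^sub>R \<omega>) * indicator ?D x \<partial>lborel)"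
      using lborel_translate_nn_integral[of "\<lambda>x. F (x - u *\<^sub>R \<omega>) * indicator ?D x" "u *\<^sub>R \<omega>"] by simp
  qed
  also have "\<dots> = (\<integral>\<^sup>+x. (\<integral>\<^sup>+u. F (x - u *\<^sub>R \<omega>) * indicator ?D x \<partial>lborel) \<partial>lborel)"
    by (rule lborel_pair.Fubini') measurable
  also have "\<dots> = (\<integral>\<^sup>+x. indicator ?D x * (\<integral>\<^sup>+u. F (x - u *\<^sub>R \<omega>) \<partial>lborel) \<partial>lborel)"
    by (simp add: nn_integral_multc mult.commute)
  finally show ?thesis .
qed

lemma hausdorff_outer_expansion:
  fixes \<phi> :: "'a::metric_space \<Rightarrow> 'b::metric_space"
  assumes L: "0 < L" and exp: "\<And>x y. x \<in> A \<Longrightarrow> y \<in> A \<Longrightarrow> dist x y \<le> L * dist (\<phi> x) (\<phi> y)"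
  shows "inj_on \<phi> A" "hausdorff_outer k A \<le> ennreal (L ^ k) * hausdorff_outer k (\<phi> ` A)"
proof -
  show inj: "inj_on \<phi> A"
  proof (rule inj_onI)
    show "x = y" if "x \<in> A" "y \<in> A" "\<phi> x = \<phi> y" for x y using exp[OF that(1,2)] that(3) by simp
  qed
  have "hausdorff_outer k (inv_into A \<phi> ` \<phi> ` A) \<le> ennreal (L ^ k) * hausdorff_outer k (\<phi> ` A)"
    by (rule hausdorff_outer_lipschitz[OF L]) (use exp inj in auto)
  then show "hausdorff_outer k A \<le> ennreal (L ^ k) * hausdorff_outer k (\<phi> ` A)" using inj by simp
qed

text \<open>On a compact set the inverse of a continuous injection is continuous, so the image of
  \<open>A\<close> is a preimage under a continuous map.\<close>

lemma injective_image_borel: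
  fixes P :: "'a::t2_space \<Rightarrow> 'b::t2_space"
  assumes K: "compact K" and P: "continuous_on K P" "inj_on P K" and A: "A \<in> sets borel" "A \<subseteq> K"
  shows "P ` A \<in> sets borel"
proof -
  define G where "G = inv_into K P"
  have G: "G (P x) = x" if "x \<in> K" for x using that P(2) by (simp add: G_def)
  have PK: "P ` K \<in> sets borel" using K P(1) by (intro borel_closed compact_imp_closed compact_continuous_image)
  have "continuous_on (P ` K) G" using P(1) K G by (intro continuous_on_inv) auto
  then have "G \<in> restrict_space borel (P ` K) \<rightarrow>\<^sub>M borel" by (rule borel_measurable_continuous_on_restrict)
  then have "G -` A \<inter> P ` K \<in> sets (restrict_space borel (P ` K))"
    using measurable_sets[OF _ A(1), of G "restrict_space borel (P ` K)"] by (simp add: space_restrict_space)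
  then have "G -` A \<inter> P ` K \<in> sets borel" using PK by (simp add: sets_restrict_space_iff)
  moreover have "P ` A = G -` A \<inter> P ` K" using A(2) G by force
  ultimately show ?thesis by simp
qed

context transversal begin

section \<open>The flux measure\<close>

definition tube :: "'n torus set" where
  "tube = {\<theta>. hits \<theta> \<noteq> {}}"

definition foot :: "'n torus \<Rightarrow> 'n torus" where
  "foot \<theta> = flow (hit \<theta>) \<theta>"

lemma foot_zero: "\<theta> \<in> tube \<Longrightarrow> S (foot \<theta>) = 0"
  using hit_in[of \<theta>] by (simp add: tube_def foot_def hits_def)

lemma smear_foot: "smear h \<theta> = weight (hit \<theta>) * indicator tube \<theta> * h (foot \<theta>)"
  by (simp add: smear_def tube_def foot_def)

text \<open>The projection of a compact set of pairs of a time and a point.\<close>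

lemma closed_hit_interval: "closed {\<theta>. \<exists>u\<in>{a..b}. S (flow u \<theta>) = 0}"
proof -
  let ?K = "({a..b} \<times> UNIV) \<inter> {p. S (flow (fst p) (snd p)) = 0}"
  have "closed {p. S (flow (fst p) (snd p)) = 0}"
    by (intro closed_Collect_eq continuous_on_compose2[OF continuous_on_S continuous_on_flow2] continuous_intros) auto
  then have "compact ?K" by (intro compact_Int_closed compact_Times compact_UNIV_torus compact_Icc)
  then have "compact (snd ` ?K)" by (intro compact_continuous_image continuous_intros)
  moreover have "snd ` ?K = {\<theta>. \<exists>u\<in>{a..b}. S (flow u \<theta>) = 0}" by force
  ultimately show ?thesis by (simp add: compact_imp_closed)
qed

text \<open>The open window is exhausted by the closed intervals of
  \<open>closed_hit_interval\<close>; since hits are unique, a hit in one of these intervals is the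
  value of \<open>hit\<close>.\<close>

lemma hit_le_borel: "{\<theta>\<in>tube. hit \<theta> \<le> a} \<in> sets borel"
proof -
  let ?T = "\<lambda>n::nat. {\<theta>. \<exists>u\<in>{- (gap / 2) + 1 / Suc n..min a (gap / 2 - 1 / Suc n)}. S (flow u \<theta>) = 0}"
  have "{\<theta>\<in>tube. hit \<theta> \<le> a} = (\<Union>n. ?T n)"
  proof (intro set_eqI iffI)
    fix \<theta> assume "\<theta> \<in> {\<theta>\<in>tube. hit \<theta> \<le> a}"
    then have \<theta>: "hit \<theta> \<in> hits \<theta>" "hit \<theta> \<le> a" using hit_in[of \<theta>] by (auto simp: tube_def)
    then have "0 < gap / 2 - \<bar>hit \<theta>\<bar>" by (simp add: hits_def)
    then obtain n where "1 / real (Suc n) < gap / 2 - \<bar>hit \<theta>\<bar>" using nat_approx_posE by blast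
    then have "- (gap / 2) + 1 / real (Suc n) \<le> hit \<theta>" "hit \<theta> \<le> gap / 2 - 1 / real (Suc n)" by linarith+
    then have "\<theta> \<in> ?T n" using \<theta> by (auto simp: hits_def)
    then show "\<theta> \<in> (\<Union>n. ?T n)" by blast
  next
    fix \<theta> assume "\<theta> \<in> (\<Union>n. ?T n)"
    then obtain n u where u: "- (gap / 2) + 1 / real (Suc n) \<le> u" "u \<le> a" "u \<le> gap / 2 - 1 / real (Suc n)" "S (flow u \<theta>) = 0"
      by auto
    moreover have "0 < 1 / real (Suc n)" by simp
    ultimately have "\<bar>u\<bar> < gap / 2" by linarith
    then have "u \<in> hits \<theta>" using u by (simp add: hits_def)
    then show "\<theta> \<in> {\<theta>\<in>tube. hit \<theta> \<le> a}" using u hit_eq by (auto simp: tube_def)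
  qed
  moreover have "?T n \<in> sets borel" for n by (rule borel_closed[OF closed_hit_interval])
  ultimately show ?thesis by simp
qed

lemma tube_borel [measurable]: "tube \<in> sets borel"
proof -
  have "tube = {\<theta>\<in>tube. hit \<theta> \<le> gap}"
    using hit_in by (force simp: tube_def hits_def abs_less_iff)
  then show ?thesis using hit_le_borel[of gap] by simp
qed

text \<open>Off the tube, \<open>hit\<close> takes the constant junk value \<open>SOME u. False\<close>.\<close>

lemma hit_measurable [measurable]: "hit \<in> borel_measurable borel"
proof (subst borel_measurable_iff_le, intro allI)
  fix a
  define c where "c = (SOME u :: real. False)"
  have "hit \<theta> = c" if "\<theta> \<notin> tube" for \<theta> using that by (simp add: hit_def tube_def c_def)
  then have "{\<theta> \<in> space borel. hit \<theta> \<le> a} = {\<theta>\<in>tube. hit \<theta> \<le> a} \<union> (if c \<le> a then - tube else {})"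
    by auto
  then show "{\<theta> \<in> space borel. hit \<theta> \<le> a} \<in> sets borel" using hit_le_borel[of a] by auto
qed

lemma foot_measurable [measurable]: "foot \<in> borel \<rightarrow>\<^sub>M borel"
proof -
  have "(\<lambda>p. flow (fst p) (snd p)) \<in> borel \<Otimes>\<^sub>M borel \<rightarrow>\<^sub>M borel"
    unfolding borel_prod by (rule borel_measurable_continuous_onI[OF continuous_on_flow2])
  moreover have "(\<lambda>\<theta>. (hit \<theta>, \<theta>)) \<in> borel \<rightarrow>\<^sub>M borel \<Otimes>\<^sub>M borel" by measurable
  ultimately have "(\<lambda>\<theta>. flow (fst (hit \<theta>, \<theta>)) (snd (hit \<theta>, \<theta>))) \<in> borel \<rightarrow>\<^sub>M borel"
    by (rule measurable_compose[rotated])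
  then show ?thesis by (simp add: foot_def[abs_def])
qed

lemma weight_measurable [measurable]: "weight \<in> borel_measurable borel"
  by (rule borel_measurable_continuous_onI[OF weight(1)])

text \<open>The volume that the flow carries across the zero set per unit of time, recorded at the
  point of crossing; the unit of time is spread by the weight.\<close>

definition flux :: "'n torus measure" where
  "flux = distr (density torus_lebesgue (\<lambda>\<theta>. ennreal (weight (hit \<theta>) * indicator tube \<theta>))) borel foot"

lemma space_flux [simp]: "space flux = UNIV" and sets_flux [simp, measurable_cong]: "sets flux = sets borel"
  by (auto simp: flux_def)

lemma integral_flux:
  fixes h :: "'n torus \<Rightarrow> real"
  assumes [measurable]: "h \<in> borel_measurable borel"
  shows "(LINT \<theta>|flux. h \<theta>) = (LINT \<theta>|torus_lebesgue. smear h \<theta>)"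
proof -
  have "(LINT \<theta>|flux. h \<theta>) = (LINT \<theta>|density torus_lebesgue (\<lambda>\<theta>. ennreal (weight (hit \<theta>) * indicator tube \<theta>)). h (foot \<theta>))"
    unfolding flux_def by (rule integral_distr) measurable
  also have "\<dots> = (LINT \<theta>|torus_lebesgue. (weight (hit \<theta>) * indicator tube \<theta>) *\<^sub>R h (foot \<theta>))"
    by (rule integral_density) (auto simp: weight(2))
  finally show ?thesis by (simp add: smear_foot[abs_def])
qed

lemma emeasure_flux:
  assumes [measurable]: "A \<in> sets borel"
  shows "emeasure flux A = (\<integral>\<^sup>+\<theta>. ennreal (weight (hit \<theta>) * indicator tube \<theta>) * indicator A (foot \<theta>) \<partial>torus_lebesgue)"
proof -
  have "emeasure flux A = (\<integral>\<^sup>+\<theta>. indicator A \<theta> \<partial>flux)" by simp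
  also have "\<dots> = (\<integral>\<^sup>+\<theta>. indicator A (foot \<theta>) \<partial>density torus_lebesgue (\<lambda>\<theta>. ennreal (weight (hit \<theta>) * indicator tube \<theta>)))"
    unfolding flux_def by (rule nn_integral_distr) measurable
  finally show ?thesis by (simp add: nn_integral_density)
qed

lemma zero_set_closed: "closed (zero_set S)"
  unfolding zero_set_def by (intro closed_Collect_eq continuous_on_S continuous_intros)

lemma zero_set_borel [measurable]: "zero_set S \<in> sets borel"
  using zero_set_closed by simp

lemma flux_off_zero_set: "emeasure flux (- zero_set S) = 0"
proof -
  have zero: "ennreal (weight (hit \<theta>) * indicator tube \<theta>) * indicator (- zero_set S) (foot \<theta>) = 0" for \<theta>
    using foot_zero[of \<theta>] by (auto simp: indicator_def zero_set_def)
  have "- zero_set S \<in> sets borel" by (rule borel_comp[OF zero_set_borel])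
  then show ?thesis by (simp only: emeasure_flux zero nn_integral_0_iff) simp
qed

section \<open>Normal speed and projection along the flow\<close>

lemma omega_nz: "\<omega> \<noteq> 0"
  using nonempty transverse by (auto simp: zero_set_def D_along_def)

lemma grad_nz: "S \<theta> = 0 \<Longrightarrow> torus_grad S \<theta> \<noteq> 0"
  using transverse[of \<theta>] by (auto simp: D_along_def)

text \<open>On the zero set this is the normal component of \<open>\<omega>\<close>, see
  \<open>unit_normal_speed\<close>.\<close>

definition speed :: "'n torus \<Rightarrow> real" where
  "speed \<theta> = \<bar>DS \<theta>\<bar> / norm (torus_grad S \<theta>)"

lemma speed_measurable [measurable]: "speed \<in> borel_measurable borel"
proof -
  have [measurable]: "DS \<in> borel_measurable borel" "torus_grad S \<in> borel_measurable borel"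
    by (auto intro!: borel_measurable_continuous_onI continuous_on_DS continuous_on_grad)
  show ?thesis unfolding speed_def[abs_def] by measurable
qed

definition oblique_proj :: "real ^ 'n \<Rightarrow> real ^ 'n \<Rightarrow> real ^ 'n" where
  "oblique_proj n x = x - ((x \<bullet> n) / (\<omega> \<bullet> n)) *\<^sub>R \<omega>"

lemma oblique_proj_line: "oblique_proj n x = oblique_proj n y \<longleftrightarrow> x - y = (((x - y) \<bullet> n) / (\<omega> \<bullet> n)) *\<^sub>R \<omega>"
  unfolding oblique_proj_def by (auto simp: inner_diff_left diff_divide_distrib scaleR_diff_left algebra_simps)

lemma oblique_proj_add: "\<omega> \<bullet> n \<noteq> 0 \<Longrightarrow> oblique_proj n (x + u *\<^sub>R \<omega>) = oblique_proj n x"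
  by (simp add: oblique_proj_def inner_add_left add_divide_distrib scaleR_add_left)

lemma oblique_proj_inner: "\<omega> \<bullet> n \<noteq> 0 \<Longrightarrow> oblique_proj n x \<bullet> n = 0"
  by (simp add: oblique_proj_def inner_diff_left)

text \<open>The zero set is tangent to \<open>n\<^sup>\<bottom>\<close>, so the projection along \<open>\<omega>\<close> onto this hyperplane is
  almost an isometry near \<open>x0\<close>.\<close>

lemma oblique_proj_near_isometry:
  assumes x0: "lift x0 = 0" and c: "1 < c"
  defines "n \<equiv> torus_grad S (torus_proj x0) /\<^sub>R norm (torus_grad S (torus_proj x0))"
  shows "\<exists>r>0. \<forall>x y. x \<in> cball x0 r \<longrightarrow> y \<in> cball x0 r \<longrightarrow> lift x = 0 \<longrightarrow> lift y = 0 \<longrightarrow>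
     dist (oblique_proj n x) (oblique_proj n y) \<le> c * dist x y \<and>
     dist x y \<le> c * dist (oblique_proj n x) (oblique_proj n y)"
proof -
  define g where "g = torus_grad S (torus_proj x0)"
  have S0: "S (torus_proj x0) = 0" using x0 by (simp add: lift_def)
  have g: "g \<noteq> 0" using grad_nz[OF S0] by (simp add: g_def)
  have wg: "\<omega> \<bullet> g \<noteq> 0" using transverse[OF S0] by (simp add: D_along_def g_def)
  \<comment> \<open>A relative error \<open>\<delta>\<close> then costs at most a factor
    \<open>c\<close> in both directions, since \<open>1 + \<delta> \<le> c\<close> and
    \<open>1 / (1 - \<delta>) = c\<close>.\<close>
  define \<delta> where "\<delta> = 1 - 1 / c"
  have \<delta>: "0 < \<delta>" "1 + \<delta> \<le> c" "1 - \<delta> = 1 / c"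
  proof -
    have "0 \<le> (c - 1) * (c - 1) / c" using c by simp
    also have "\<dots> = c - (1 + \<delta>)" using c by (simp add: \<delta>_def field_simps)
    finally show "1 + \<delta> \<le> c" by simp
  qed (use c in \<open>simp_all add: \<delta>_def\<close>)
  \<comment> \<open>The projection moves \<open>x - y\<close> by
    \<open>\<bar>(x - y) \<bullet> g\<bar>\<close> times
    \<open>norm \<omega> / \<bar>\<omega> \<bullet> g\<bar>\<close>; with this \<open>B\<close> the
    result is \<open>\<delta> * norm (x - y)\<close>.\<close>
  define B where "B = \<delta> * \<bar>\<omega> \<bullet> g\<bar> / norm \<omega>"
  have B: "0 < B" using \<delta> wg omega_nz by (simp add: B_def)
  have "continuous_on UNIV (\<lambda>x. torus_grad S (torus_proj x))"
    by (intro continuous_on_compose2[OF continuous_on_grad] continuous_on_torus_proj_UNIV) auto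
  then obtain d where d: "0 < d" "\<And>x. dist x x0 < d \<Longrightarrow> dist (torus_grad S (torus_proj x)) g < B"
    unfolding continuous_on_iff g_def using B by (metis UNIV_I)
  \<comment> \<open>On the ball the gradient stays within \<open>B\<close> of \<open>g\<close>, so
    \<open>lift x - g \<bullet> x\<close> is Lipschitz with constant \<open>B\<close>; at two zeros
    of \<open>lift\<close> only the linear term remains.\<close>
  have key: "\<bar>(x - y) \<bullet> g\<bar> \<le> B * norm (x - y)"
    if xy: "x \<in> cball x0 (d / 2)" "y \<in> cball x0 (d / 2)" "lift x = 0" "lift y = 0" for x y
  proof -
    have "norm ((lift x - g \<bullet> x) - (lift y - g \<bullet> y)) \<le> B * norm (x - y)"
    proof (rule differentiable_bound[of "cball x0 (d / 2)" "\<lambda>x. lift x - g \<bullet> x" "\<lambda>x v. torus_grad S (torus_proj x) \<bullet> v - g \<bullet> v"])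
      fix z assume z: "z \<in> cball x0 (d / 2)"
      show "((\<lambda>x. lift x - g \<bullet> x) has_derivative (\<lambda>v. torus_grad S (torus_proj z) \<bullet> v - g \<bullet> v)) (at z within cball x0 (d / 2))"
        by (intro derivative_intros has_derivative_at_withinI[OF lift_has_derivative])
      have "dist z x0 < d" using z d(1) by (simp add: dist_commute)
      then have "norm (torus_grad S (torus_proj z) - g) \<le> B" using d(2)[of z] by (simp add: dist_norm)
      then have "norm (torus_grad S (torus_proj z) - g) * norm v \<le> B * norm v" for v :: "real ^ 'n"
        by (rule mult_right_mono) simp
      moreover have "norm (torus_grad S (torus_proj z) \<bullet> v - g \<bullet> v) \<le> norm (torus_grad S (torus_proj z) - g) * norm v" for v
        by (simp add: Cauchy_Schwarz_ineq2 flip: inner_diff_left)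
      ultimately show "onorm (\<lambda>v. torus_grad S (torus_proj z) \<bullet> v - g \<bullet> v) \<le> B"
        by (intro onorm_le) (rule order_trans)
    qed (use xy in auto)
    then show ?thesis using xy by (simp add: inner_diff_right inner_commute[of _ g])
  qed
  have main: "norm ((oblique_proj n x - oblique_proj n y) - (x - y)) \<le> \<delta> * norm (x - y)"
    if xy: "x \<in> cball x0 (d / 2)" "y \<in> cball x0 (d / 2)" "lift x = 0" "lift y = 0" for x y
  proof -
    have frac: "(v \<bullet> n) / (\<omega> \<bullet> n) = (v \<bullet> g) / (\<omega> \<bullet> g)" for v
      using g by (simp add: n_def flip: g_def)
    have "(oblique_proj n x - oblique_proj n y) - (x - y) = - (((x - y) \<bullet> g) / (\<omega> \<bullet> g)) *\<^sub>R \<omega>"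
      unfolding oblique_proj_def frac by (simp add: inner_diff_left diff_divide_distrib scaleR_diff_left)
    then have "norm ((oblique_proj n x - oblique_proj n y) - (x - y)) = \<bar>(x - y) \<bullet> g\<bar> * (norm \<omega> / \<bar>\<omega> \<bullet> g\<bar>)"
      by (simp add: abs_divide)
    also have "\<dots> \<le> (B * norm (x - y)) * (norm \<omega> / \<bar>\<omega> \<bullet> g\<bar>)"
      by (intro mult_right_mono key xy) simp
    also have "\<dots> = \<delta> * norm (x - y)" using wg omega_nz by (simp add: B_def)
    finally show ?thesis .
  qed
  have "dist (oblique_proj n x) (oblique_proj n y) \<le> c * dist x y \<and> dist x y \<le> c * dist (oblique_proj n x) (oblique_proj n y)"
    if xy: "x \<in> cball x0 (d / 2)" "y \<in> cball x0 (d / 2)" "lift x = 0" "lift y = 0" for x y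
  proof
    let ?p = "oblique_proj n x - oblique_proj n y"
    have "norm ?p \<le> norm (x - y) + norm (?p - (x - y))" using norm_triangle_ineq[of "x - y" "?p - (x - y)"] by simp
    also have "\<dots> \<le> (1 + \<delta>) * norm (x - y)" using main[OF xy] by (simp add: algebra_simps)
    also have "\<dots> \<le> c * norm (x - y)" by (intro mult_right_mono \<delta>) simp
    finally show "dist (oblique_proj n x) (oblique_proj n y) \<le> c * dist x y" by (simp add: dist_norm)
    have "norm (x - y) \<le> norm ?p + norm (?p - (x - y))" using norm_triangle_ineq4[of ?p "?p - (x - y)"] by simp
    then have "(1 - \<delta>) * norm (x - y) \<le> norm ?p" using main[OF xy] by (simp add: algebra_simps)
    then show "dist x y \<le> c * dist (oblique_proj n x) (oblique_proj n y)"
      using c unfolding \<delta>(3) by (simp add: dist_norm field_simps)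
  qed
  then show ?thesis using d(1) by (intro exI[of _ "d / 2"]) auto
qed

text \<open>Each line in direction \<open>\<omega>\<close> that meets \<open>A'\<close> does so exactly once, and the weight in the
  flow time relative to this point integrates to \<open>1\<close>.\<close>

lemma flux_local:
  fixes x0 n :: "real ^ 'n"
  defines "P \<equiv> oblique_proj n"
  assumes w: "\<omega> \<bullet> n \<noteq> 0" and r: "r \<le> pi / 4"
    and A: "A \<in> sets borel" "A \<subseteq> zero_set S" "A \<subseteq> torus_proj ` ball x0 r"
  defines "A' \<equiv> ball x0 r \<inter> torus_proj -` A"
  assumes inj: "inj_on P A'" and PA': "P ` A' \<in> sets borel"
  shows "emeasure flux A = ennreal \<bar>\<omega> \<bullet> n\<bar> * emeasure lborel {x. \<bar>x \<bullet> n\<bar> \<le> 1 / 2 \<and> P x \<in> P ` A'}"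
proof -
  note [measurable] = A(1)
  have A'b [measurable]: "A' \<in> sets borel"
    using measurable_sets[OF measurable_torus_proj A(1)] by (simp add: A'_def)
  define F' where "F' x = ennreal (weight (hit (torus_proj x)) * indicator tube (torus_proj x))
      * indicator A' (x + hit (torus_proj x) *\<^sub>R \<omega>)" for x
  have F'_meas [measurable]: "F' \<in> borel_measurable borel" unfolding F'_def[abs_def] by measurable
  \<comment> \<open>Two points of a ball of radius at most \<open>pi / 4\<close> never differ by a
    nonzero lattice vector, so every point of \<open>A\<close> has exactly one representative in
    \<open>A'\<close>.\<close>
  have unfold: "indicator A (torus_proj y) = (\<integral>\<^sup>+k. indicator A' (y + lattice_vec k) \<partial>count_space UNIV)" for y
  proof (cases "torus_proj y \<in> A")
    case True
    then obtain z where z: "torus_proj y = torus_proj z" "z \<in> ball x0 r" using A(3) by blast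
    then obtain k where k: "z = y + lattice_vec k" by (metis torus_proj_eq)
    have zA: "z \<in> A'" using z True by (simp add: A'_def)
    have "y + lattice_vec l \<in> A' \<longleftrightarrow> l = k" for l
    proof
      assume "y + lattice_vec l \<in> A'"
      then have "dist (y + lattice_vec l) z < 2 * (pi / 4)"
        using z(2) r dist_triangle2[of "y + lattice_vec l" z x0] by (auto simp: A'_def dist_commute)
      then have "dist (y + lattice_vec l) z < 2 * pi" using pi_gt_zero by linarith
      then have "norm (lattice_vec (l - k)) < 2 * pi"
        by (simp add: k dist_norm lattice_vec_def vec_eq_iff algebra_simps minus_vec_def)
      then show "l = k" using norm_lattice_vec[of "l - k"] by fastforce
    qed (use zA k in simp)
    then have "(\<lambda>l. indicator A' (y + lattice_vec l)) = (indicator {k} :: _ \<Rightarrow> ennreal)"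
      by (auto simp: fun_eq_iff indicator_def)
    then show ?thesis using True by simp
  next
    case False
    then have "indicator A' (y + lattice_vec k) = (0 :: ennreal)" for k by (simp add: A'_def)
    then show ?thesis using False by simp
  qed
  have "emeasure flux A = (\<integral>\<^sup>+x. F' x \<partial>lborel)"
    unfolding emeasure_flux[OF A(1)]
  proof (rule nn_integral_torus_unfold)
    fix x :: "real ^ 'n"
    show "ennreal (weight (hit (torus_proj x)) * indicator tube (torus_proj x)) * indicator A (foot (torus_proj x))
        = (\<integral>\<^sup>+k. F' (x + lattice_vec k) \<partial>count_space UNIV)"
      unfolding foot_def flow_proj unfold F'_def torus_proj_lattice
      by (subst nn_integral_cmult[symmetric]) (auto simp: algebra_simps)
  qed measurable
  also have "(\<integral>\<^sup>+x. F' x \<partial>lborel) = ennreal \<bar>\<omega> \<bullet> n\<bar> * (\<integral>\<^sup>+x. indicator {x. \<bar>x \<bullet> n\<bar> \<le> 1 / 2} x * (\<integral>\<^sup>+u. F' (x - u *\<^sub>R \<omega>) \<partial>lborel) \<partial>lborel)"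
    by (rule nn_integral_slab[OF F'_meas w])
  finally have flux_eq: "emeasure flux A = ennreal \<bar>\<omega> \<bullet> n\<bar> *
    (\<integral>\<^sup>+x. indicator {x. \<bar>x \<bullet> n\<bar> \<le> 1 / 2} x * (\<integral>\<^sup>+u. F' (x - u *\<^sub>R \<omega>) \<partial>lborel) \<partial>lborel)" .
  have inner: "(\<integral>\<^sup>+u. F' (x - u *\<^sub>R \<omega>) \<partial>lborel) = indicator (P -` P ` A') x" for x
  proof (cases "P x \<in> P ` A'")
    case True
    then obtain y where y: "y \<in> A'" "P x = P y" by blast
    then obtain u0 where u0: "x - y = u0 *\<^sub>R \<omega>" unfolding P_def oblique_proj_line by blast
    have "F' (x - u *\<^sub>R \<omega>) = ennreal (weight (u - u0))" for u
    proof -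
      let ?\<theta> = "torus_proj (x - u *\<^sub>R \<omega>)"
      have landing: "x - u *\<^sub>R \<omega> + (u - u0) *\<^sub>R \<omega> = y" using u0 by (simp add: algebra_simps)
      have zy: "S (torus_proj y) = 0" using y(1) A(2) by (auto simp: A'_def zero_set_def)
      show ?thesis
      proof (cases "\<bar>u - u0\<bar> < gap / 2")
        case True
        then have "u - u0 \<in> hits ?\<theta>" using zy landing by (simp add: hits_def)
        then have "?\<theta> \<in> tube" "hit ?\<theta> = u - u0" using hit_eq by (auto simp: tube_def)
        then show ?thesis using landing y(1) by (simp add: F'_def)
      next
        case False
        \<comment> \<open>A hit landing in \<open>A'\<close> would lie on the line through
          \<open>y\<close>, hence equal \<open>y\<close> by injectivity, and so occur at the time
          \<open>u - u0\<close>, which is outside the window.\<close>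
        have "F' (x - u *\<^sub>R \<omega>) = 0"
        proof (cases "?\<theta> \<in> tube \<and> x - u *\<^sub>R \<omega> + hit ?\<theta> *\<^sub>R \<omega> \<in> A'")
          case True
          define y' where "y' = x - u *\<^sub>R \<omega> + hit ?\<theta> *\<^sub>R \<omega>"
          have y'x: "y' = x + (hit ?\<theta> - u) *\<^sub>R \<omega>" by (simp add: y'_def algebra_simps)
          have "P y' = P y" unfolding y'x P_def oblique_proj_add[OF w] using y(2) by (simp add: P_def)
          then have "y' = y" using inj True y(1) by (auto simp: inj_on_def y'_def)
          then have "(hit ?\<theta> - (u - u0)) *\<^sub>R \<omega> = 0" using u0 by (simp add: y'x algebra_simps)
          then have "hit ?\<theta> = u - u0" using omega_nz by simp
          moreover have "\<bar>hit ?\<theta>\<bar> < gap / 2" using True hit_in[of ?\<theta>] by (simp add: tube_def hits_def)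
          ultimately show ?thesis using False by simp
        qed (auto simp: F'_def)
        moreover have "weight (u - u0) = 0" using False gap(1) by (intro weight(3)) linarith
        ultimately show ?thesis by simp
      qed
    qed
    then have "(\<integral>\<^sup>+u. F' (x - u *\<^sub>R \<omega>) \<partial>lborel) = (\<integral>\<^sup>+u. ennreal (weight (u + (- u0))) \<partial>lborel)" by simp
    also have "\<dots> = (\<integral>\<^sup>+u. ennreal (weight u) \<partial>lborel)"
      by (rule lborel_translate_nn_integral) measurable
    also have "\<dots> = 1"
      using nn_integral_eq_integral[OF weight(5)] by (simp add: weight(2,4))
    finally show ?thesis using True by simp
  next
    case False
    have "F' (x - u *\<^sub>R \<omega>) = 0" for u
    proof -
      let ?h = "hit (torus_proj (x - u *\<^sub>R \<omega>))"
      have "x - u *\<^sub>R \<omega> + ?h *\<^sub>R \<omega> \<notin> A'"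
      proof
        assume "x - u *\<^sub>R \<omega> + ?h *\<^sub>R \<omega> \<in> A'"
        moreover have "P (x - u *\<^sub>R \<omega> + ?h *\<^sub>R \<omega>) = P x"
          using oblique_proj_add[OF w, of x "?h - u"] by (simp add: P_def algebra_simps)
        ultimately show False using False by (metis image_eqI)
      qed
      then show ?thesis by (simp add: F'_def)
    qed
    then show ?thesis using False by simp
  qed
  have "(\<integral>\<^sup>+x. indicator {x. \<bar>x \<bullet> n\<bar> \<le> 1 / 2} x * (\<integral>\<^sup>+u. F' (x - u *\<^sub>R \<omega>) \<partial>lborel) \<partial>lborel)
      = (\<integral>\<^sup>+x. indicator {x. \<bar>x \<bullet> n\<bar> \<le> 1 / 2 \<and> P x \<in> P ` A'} x \<partial>lborel)"
    by (intro nn_integral_cong) (auto simp: inner indicator_def)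
  also have "\<dots> = emeasure lborel {x. \<bar>x \<bullet> n\<bar> \<le> 1 / 2 \<and> P x \<in> P ` A'}"
  proof (rule nn_integral_indicator)
    have "{x. \<bar>x \<bullet> n\<bar> \<le> 1 / 2} \<in> sets borel"
      by (intro borel_closed closed_Collect_le continuous_intros)
    moreover have "continuous_on UNIV P"
      unfolding P_def oblique_proj_def using w by (intro continuous_intros) auto
    then have "P -` P ` A' \<in> sets borel"
      using measurable_sets[OF borel_measurable_continuous_onI PA', of P] by simp
    ultimately have "{x. \<bar>x \<bullet> n\<bar> \<le> 1 / 2} \<inter> P -` P ` A' \<in> sets borel" by (intro sets.Int)
    then show "{x. \<bar>x \<bullet> n\<bar> \<le> 1 / 2 \<and> P x \<in> P ` A'} \<in> sets lborel"
      by (simp add: Collect_conj_eq vimage_def)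
  qed
  finally show ?thesis by (simp only: flux_eq)
qed

section \<open>Comparison of flux and surface measure\<close>

definition surface_flux :: "'n torus measure" where
  "surface_flux = density surface_measure (\<lambda>\<theta>. ennreal (speed \<theta>))"

lemma sets_surface_flux [simp, measurable_cong]: "sets surface_flux = sets borel"
  by (simp add: surface_flux_def)

lemma speed_bounds_near:
  assumes p: "S p = 0" and c: "1 < c"
  shows "\<exists>r>0. \<forall>\<theta>. dist \<theta> p < r \<longrightarrow> speed \<theta> \<le> c * speed p \<and> speed p \<le> c * speed \<theta>"
proof -
  have pos: "0 < speed p" using transverse[OF p] grad_nz[OF p] by (simp add: speed_def)
  have "isCont DS p" "isCont (torus_grad S) p"
    using continuous_on_DS continuous_on_grad by (auto simp: continuous_on_eq_continuous_at)
  then have cont: "(speed \<longlongrightarrow> speed p) (nhds p)"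
    unfolding speed_def[abs_def] using grad_nz[OF p]
    by (intro tendsto_intros) (auto simp: isCont_def tendsto_at_iff_tendsto_nhds)
  have "speed p < c * speed p" "speed p / c < speed p" using pos c by (auto simp: field_simps)
  then have "\<forall>\<^sub>F \<theta> in nhds p. speed \<theta> < c * speed p \<and> speed p / c < speed \<theta>"
    using order_tendstoD[OF cont] by (intro eventually_conj) auto
  then obtain r where "0 < r" "\<And>\<theta>. dist \<theta> p < r \<Longrightarrow> speed \<theta> < c * speed p \<and> speed p / c < speed \<theta>"
    unfolding eventually_nhds_metric by blast
  then show ?thesis using c by (intro exI[of _ r]) (auto simp: field_simps less_imp_le)
qed

lemma flux_compare_near:
  assumes p: "S p = 0" and c: "1 < c"
  shows "\<exists>U. open U \<and> p \<in> U \<and> (\<forall>A. A \<in> sets borel \<longrightarrow> A \<subseteq> zero_set S \<inter> U \<longrightarrow>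
    emeasure flux A \<le> ennreal c * emeasure surface_flux A \<and>
    emeasure surface_flux A \<le> ennreal c * emeasure flux A)"
proof -
  obtain x0 where x0: "p = torus_proj x0" by (rule torus_cases)
  let ?k = "CARD('n) - 1"
  let ?Hf = "hausdorff_outer ?k (unit_face :: (real ^ 'n) set)"
  \<comment> \<open>One factor \<open>c1\<close> is spent on the variation of the speed and
    \<open>?k\<close> factors on the distortion of the Hausdorff measure; together they make
    \<open>c\<close>.\<close>
  define c1 where "c1 = root (Suc ?k) c"
  have c1: "1 < c1" "c1 ^ Suc ?k = c" using c by (auto simp: c1_def real_root_pow_pos2 simp del: power_Suc)
  define g where "g = torus_grad S p"
  define n where "n = g /\<^sub>R norm g"
  have g: "g \<noteq> 0" using grad_nz[OF p] by (simp add: g_def)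
  have n: "norm n = 1" using g by (simp add: n_def)
  define a where "a = speed p"
  have wn: "\<omega> \<bullet> n \<noteq> 0" using transverse[OF p] g by (simp add: n_def D_along_def g_def)
  have a: "a = \<bar>\<omega> \<bullet> n\<bar>" using g by (simp add: a_def speed_def n_def D_along_def g_def abs_mult divide_inverse mult.commute)
  have a0: "0 < a" using wn by (simp add: a)
  have lx0: "lift x0 = 0" using p x0 by (simp add: lift_def)
  obtain r1 where r1: "0 < r1" "\<And>x y. x \<in> cball x0 r1 \<Longrightarrow> y \<in> cball x0 r1 \<Longrightarrow> lift x = 0 \<Longrightarrow> lift y = 0 \<Longrightarrow>
     dist (oblique_proj n x) (oblique_proj n y) \<le> c1 * dist x y \<and>
     dist x y \<le> c1 * dist (oblique_proj n x) (oblique_proj n y)"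
    using oblique_proj_near_isometry[OF lx0 c1(1)] unfolding n_def g_def x0 by blast
  obtain r2 where r2: "0 < r2" "\<And>\<theta>. dist \<theta> p < r2 \<Longrightarrow> speed \<theta> \<le> c1 * a \<and> a \<le> c1 * speed \<theta>"
    using speed_bounds_near[OF p c1(1)] unfolding a_def by blast
  \<comment> \<open>The bound \<open>pi / 4\<close> makes \<open>torus_proj\<close> isometric on the
    ball, so \<open>A\<close> and its lift \<open>A'\<close> have the same Hausdorff measure, and it
    meets the hypothesis of \<open>flux_local\<close>.\<close>
  define r where "r = min (min r1 r2) (pi / 4)"
  have r: "0 < r" "r \<le> r1" "r \<le> r2" "r \<le> pi / 4" using r1 r2 by (auto simp: r_def)
  let ?P = "oblique_proj n"
  have "emeasure flux A \<le> ennreal c * emeasure surface_flux A \<and> emeasure surface_flux A \<le> ennreal c * emeasure flux A"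
    if A: "A \<in> sets borel" "A \<subseteq> zero_set S \<inter> ball p r" for A
  proof -
    note [measurable] = A(1)
    have AU: "A \<subseteq> torus_proj ` ball x0 r" using A(2) by (auto simp: torus_proj_ball x0)
    define A' where "A' = ball x0 r \<inter> torus_proj -` A"
    have A'z: "lift x = 0" if "x \<in> A'" for x using that A(2) by (auto simp: A'_def lift_def zero_set_def)
    have A'r: "x \<in> cball x0 r1" if "x \<in> A'" for x using that r by (auto simp: A'_def)
    have A'b: "A' \<in> sets borel" using measurable_sets[OF measurable_torus_proj A(1)] by (simp add: A'_def)
    have near: "dist (?P x) (?P y) \<le> c1 * dist x y" "dist x y \<le> c1 * dist (?P x) (?P y)" if "x \<in> A'" "y \<in> A'" for x y
      using r1(2)[OF A'r[OF that(1)] A'r[OF that(2)] A'z[OF that(1)] A'z[OF that(2)]] by auto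
    have "A = torus_proj ` A'" using AU by (auto simp: A'_def)
    moreover have "hausdorff_outer ?k (torus_proj ` A') = hausdorff_outer ?k A'"
    proof (rule hausdorff_outer_isometric, rule dist_torus_proj_eq)
      fix x y assume "x \<in> A'" "y \<in> A'"
      then have "dist x y < 2 * (pi / 4)"
        using r dist_triangle2[of x y x0] by (auto simp: A'_def dist_commute)
      then show "dist x y \<le> pi" using pi_gt_zero by linarith
    qed
    ultimately have HA: "hausdorff_outer ?k A = hausdorff_outer ?k A'" by simp
    have c1pos: "0 < c1" using c1 by simp
    have up: "hausdorff_outer ?k (?P ` A') \<le> ennreal (c1 ^ ?k) * hausdorff_outer ?k A'"
      by (rule hausdorff_outer_lipschitz[OF c1pos near(1)])
    have inj: "inj_on ?P A'" by (rule hausdorff_outer_expansion(1)[OF c1pos near(2)])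
    have down: "hausdorff_outer ?k A' \<le> ennreal (c1 ^ ?k) * hausdorff_outer ?k (?P ` A')"
      by (rule hausdorff_outer_expansion(2)[OF c1pos near(2)])
    have PA': "?P ` A' \<in> sets borel"
    proof (rule injective_image_borel[of "cball x0 r1 \<inter> {x. lift x = 0}"])
      have "continuous_on UNIV lift"
        unfolding lift_def by (intro continuous_on_compose2[OF continuous_on_S] continuous_on_torus_proj_UNIV) auto
      then show "compact (cball x0 r1 \<inter> {x. lift x = 0})"
        by (intro compact_Int_closed closed_Collect_eq continuous_intros compact_cball) auto
      show "continuous_on (cball x0 r1 \<inter> {x. lift x = 0}) ?P"
        unfolding oblique_proj_def using wn by (intro continuous_intros) auto
      show "inj_on ?P (cball x0 r1 \<inter> {x. lift x = 0})"
        by (rule hausdorff_outer_expansion(1)[OF c1pos]) (use r1(2) in auto)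
    qed (use A'b A'z A'r in auto)
    define V where "V = emeasure lborel {x. \<bar>x \<bullet> n\<bar> \<le> 1 / 2 \<and> ?P x \<in> ?P ` A'}"
    have flux: "emeasure flux A = ennreal a * V"
      unfolding V_def a A'_def
      by (rule flux_local[OF wn r(4) A(1) _ AU]) (use A(2) inj PA' in \<open>auto simp: A'_def\<close>)
    have HP: "hausdorff_outer ?k (?P ` A') = ?Hf * V"
      unfolding V_def oblique_proj_def[of n]
      by (rule hausdorff_hyperplane[OF n wn PA'[unfolded oblique_proj_def]])
         (use oblique_proj_inner[OF wn] in \<open>auto simp: oblique_proj_def\<close>)
    have Hf: "?Hf \<noteq> 0" "?Hf \<noteq> top"
      using hausdorff_unit_face_pos[where 'n = 'n] hausdorff_unit_face_finite[where 'n = 'n] by auto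
    define \<sigma> where "\<sigma> = emeasure surface_measure A"
    \<comment> \<open>Dividing by the unit face removes the unknown normalisation: \<open>V\<close>
      and \<open>\<sigma>\<close> now compare exactly as the Hausdorff measures of the projection
      and of \<open>A'\<close>.\<close>
    have V: "V = hausdorff_outer ?k (?P ` A') / ?Hf"
      unfolding HP by (subst mult.commute) (rule mult_divide_eq_ennreal[OF Hf, symmetric])
    have \<sigma>: "\<sigma> = hausdorff_outer ?k A' / ?Hf" by (simp only: \<sigma>_def emeasure_surface_measure[OF A(1)] HA)
    have V\<sigma>: "V \<le> ennreal (c1 ^ ?k) * \<sigma>" "\<sigma> \<le> ennreal (c1 ^ ?k) * V"
      unfolding V \<sigma> ennreal_times_divide using up down by (auto intro!: divide_right_mono_ennreal)
    have M: "emeasure surface_flux A = (\<integral>\<^sup>+\<theta>. ennreal (speed \<theta>) * indicator A \<theta> \<partial>surface_measure)"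
      unfolding surface_flux_def by (rule emeasure_density) auto
    have sp: "speed \<theta> \<le> c1 * a" "a \<le> c1 * speed \<theta>" if "\<theta> \<in> A" for \<theta>
      using r2(2)[of \<theta>] that A(2) r(3) by (auto simp: dist_commute)
    have "emeasure surface_flux A \<le> (\<integral>\<^sup>+\<theta>. ennreal (c1 * a) * indicator A \<theta> \<partial>surface_measure)"
      unfolding M by (intro nn_integral_mono) (auto simp: indicator_def sp intro!: ennreal_leI)
    also have "\<dots> = ennreal (c1 * a) * \<sigma>" by (simp add: \<sigma>_def nn_integral_cmult)
    finally have M1: "emeasure surface_flux A \<le> ennreal (c1 * a) * \<sigma>" .
    have "ennreal a * \<sigma> = (\<integral>\<^sup>+\<theta>. ennreal a * indicator A \<theta> \<partial>surface_measure)" by (simp add: \<sigma>_def nn_integral_cmult)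
    also have "\<dots> \<le> (\<integral>\<^sup>+\<theta>. ennreal c1 * (ennreal (speed \<theta>) * indicator A \<theta>) \<partial>surface_measure)"
    proof (rule nn_integral_mono)
      fix \<theta>
      show "ennreal a * indicator A \<theta> \<le> ennreal c1 * (ennreal (speed \<theta>) * indicator A \<theta>)"
      proof (cases "\<theta> \<in> A")
        case True
        have "ennreal a \<le> ennreal (c1 * speed \<theta>)" by (intro ennreal_leI sp True)
        also have "\<dots> = ennreal c1 * ennreal (speed \<theta>)" using c1pos by (intro ennreal_mult) (auto simp: speed_def)
        finally show ?thesis using True by simp
      qed simp
    qed
    also have "\<dots> = ennreal c1 * emeasure surface_flux A" unfolding M by (rule nn_integral_cmult) auto
    finally have M2: "ennreal a * \<sigma> \<le> ennreal c1 * emeasure surface_flux A" .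
    have c_eq: "ennreal (c1 ^ ?k) * ennreal c1 = ennreal c"
    proof -
      have "c1 ^ ?k * c1 = c" using c1(2) by (simp only: power_Suc2)
      then show ?thesis using c1pos by (subst ennreal_mult[symmetric]) auto
    qed
    show ?thesis
    proof
      have "emeasure flux A \<le> ennreal a * (ennreal (c1 ^ ?k) * \<sigma>)" unfolding flux by (intro mult_left_mono V\<sigma>) simp
      also have "\<dots> = ennreal (c1 ^ ?k) * (ennreal a * \<sigma>)" by (simp add: ac_simps)
      also have "\<dots> \<le> ennreal (c1 ^ ?k) * (ennreal c1 * emeasure surface_flux A)" by (intro mult_left_mono M2) simp
      finally show "emeasure flux A \<le> ennreal c * emeasure surface_flux A" by (simp only: mult.assoc[symmetric] c_eq)
      have "emeasure surface_flux A \<le> ennreal (c1 * a) * (ennreal (c1 ^ ?k) * V)"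
        using M1 by (rule order_trans) (intro mult_left_mono V\<sigma>, simp)
      also have "ennreal (c1 * a) = ennreal c1 * ennreal a" using c1pos a0 by (intro ennreal_mult) auto
      also have "ennreal c1 * ennreal a * (ennreal (c1 ^ ?k) * V) = (ennreal (c1 ^ ?k) * ennreal c1) * emeasure flux A"
        unfolding flux by (simp add: ac_simps)
      finally show "emeasure surface_flux A \<le> ennreal c * emeasure flux A" by (simp only: c_eq)
    qed
  qed
  then show ?thesis using r(1) by (intro exI[of _ "ball p r"]) auto
qed

text \<open>By Lindelof countably many of the neighbourhoods from \<open>flux_compare_near\<close>
  cover the zero set. Made disjoint, they cut \<open>A\<close> into pieces whose estimates, all with
  the same \<open>c\<close>, can be summed.\<close>

lemma flux_compare:
  assumes c: "1 < c" and A: "A \<in> sets borel" "A \<subseteq> zero_set S"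
  shows "emeasure flux A \<le> ennreal c * emeasure surface_flux A"
    "emeasure surface_flux A \<le> ennreal c * emeasure flux A"
proof -
  define good where "good U \<longleftrightarrow> open U \<and> (\<forall>A. A \<in> sets borel \<longrightarrow> A \<subseteq> zero_set S \<inter> U \<longrightarrow>
    emeasure flux A \<le> ennreal c * emeasure surface_flux A \<and>
    emeasure surface_flux A \<le> ennreal c * emeasure flux A)" for U
  have cov: "\<exists>U. good U \<and> p \<in> U" if "p \<in> zero_set S" for p
    using flux_compare_near[OF _ c, of p] that unfolding good_def zero_set_def by blast
  obtain \<U> where \<U>: "\<U> \<subseteq> Collect good" "countable \<U>" "\<Union>\<U> = \<Union>(Collect good)"
    using Lindelof[of "Collect good"] by (auto simp: good_def)
  have "\<U> \<noteq> {}" using cov nonempty \<U>(3) by blast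
  define V where "V = disjointed (from_nat_into \<U>)"
  have good: "good (from_nat_into \<U> i)" for i using from_nat_into[OF \<open>\<U> \<noteq> {}\<close>, of i] \<U>(1) by auto
  have "range (from_nat_into \<U>) = \<U>" by (rule range_from_nat_into[OF \<open>\<U> \<noteq> {}\<close> \<U>(2)])
  then have UV: "(\<Union>i. V i) = \<Union>\<U>" unfolding V_def by (simp add: UN_disjointed_eq)
  have "A \<subseteq> (\<Union>i. V i)"
  proof
    fix p assume "p \<in> A"
    then obtain U where "good U" "p \<in> U" using cov[of p] A(2) by auto
    then have "p \<in> \<Union>(Collect good)" by auto
    then show "p \<in> (\<Union>i. V i)" by (simp only: UV \<U>(3))
  qed
  then have AV: "A = (\<Union>i. A \<inter> V i)" by auto
  have Vb: "V i \<in> sets borel" for i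
  proof -
    have "range (from_nat_into \<U>) \<subseteq> sets borel" using good by (auto simp: good_def)
    then show ?thesis unfolding V_def using sets.range_disjointed_sets[of "from_nat_into \<U>" borel] by auto
  qed
  have AVb: "A \<inter> V i \<in> sets borel" for i using A Vb by simp
  have disj: "disjoint_family (\<lambda>i. A \<inter> V i)"
    using disjoint_family_disjointed[of "from_nat_into \<U>"] unfolding V_def disjoint_family_on_def by blast
  have sum: "(\<Sum>i. emeasure M (A \<inter> V i)) = emeasure M A" if "sets M = sets borel" for M :: "'n torus measure"
    using suminf_emeasure[of "\<lambda>i. A \<inter> V i" M] that AVb disj AV[symmetric] by (simp add: image_subset_iff)
  have AVU: "A \<inter> V i \<subseteq> zero_set S \<inter> from_nat_into \<U> i" for i
    using A(2) disjointed_subset[of "from_nat_into \<U>" i] unfolding V_def by blast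
  have piece: "emeasure flux (A \<inter> V i) \<le> ennreal c * emeasure surface_flux (A \<inter> V i)"
    "emeasure surface_flux (A \<inter> V i) \<le> ennreal c * emeasure flux (A \<inter> V i)" for i
    using good[of i] AVb[of i] AVU[of i] by (auto simp: good_def)
  have "(\<Sum>i. emeasure flux (A \<inter> V i)) \<le> (\<Sum>i. ennreal c * emeasure surface_flux (A \<inter> V i))"
    by (intro suminf_le piece) auto
  then show "emeasure flux A \<le> ennreal c * emeasure surface_flux A" by (simp add: sum)
  have "(\<Sum>i. emeasure surface_flux (A \<inter> V i)) \<le> (\<Sum>i. ennreal c * emeasure flux (A \<inter> V i))"
    by (intro suminf_le piece) auto
  then show "emeasure surface_flux A \<le> ennreal c * emeasure flux A" by (simp add: sum)
qed

text \<open>On the zero set the factor \<open>c\<close> in \<open>flux_compare\<close> can be any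
  number above 1, which forces equality; off the zero set both sides vanish.\<close>

theorem flux_eq_density:
  "flux = density surface_measure (\<lambda>\<theta>. ennreal (speed \<theta>) * indicator (zero_set S) \<theta>)"
proof (rule measure_eqI)
  fix A assume "A \<in> sets flux"
  then have A [measurable]: "A \<in> sets borel" by simp
  have Z: "A \<inter> zero_set S \<in> sets borel" by simp
  have "emeasure flux A = emeasure flux (A \<inter> zero_set S)"
  proof (rule antisym)
    have "emeasure flux A \<le> emeasure flux (A \<inter> zero_set S \<union> - zero_set S)" by (rule emeasure_mono) auto
    also have "\<dots> \<le> emeasure flux (A \<inter> zero_set S) + emeasure flux (- zero_set S)"
      by (rule emeasure_subadditive) auto
    finally show "emeasure flux A \<le> emeasure flux (A \<inter> zero_set S)" by (simp add: flux_off_zero_set)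
  qed (intro emeasure_mono, auto)
  also have "\<dots> = emeasure surface_flux (A \<inter> zero_set S)"
    by (rule antisym; rule ennreal_le_of_le_mult, rule flux_compare[OF _ Z]) auto
  also have "\<dots> = (\<integral>\<^sup>+\<theta>. ennreal (speed \<theta>) * indicator (A \<inter> zero_set S) \<theta> \<partial>surface_measure)"
    unfolding surface_flux_def by (rule emeasure_density) auto
  also have "\<dots> = (\<integral>\<^sup>+\<theta>. ennreal (speed \<theta>) * indicator (zero_set S) \<theta> * indicator A \<theta> \<partial>surface_measure)"
    by (intro nn_integral_cong) (auto simp: indicator_def)
  also have "\<dots> = emeasure (density surface_measure (\<lambda>\<theta>. ennreal (speed \<theta>) * indicator (zero_set S) \<theta>)) A"
    by (rule emeasure_density[symmetric]) auto
  finally show "emeasure flux A = emeasure (density surface_measure (\<lambda>\<theta>. ennreal (speed \<theta>) * indicator (zero_set S) \<theta>)) A" .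
qed simp

lemma integral_flux_surface:
  fixes h :: "'n torus \<Rightarrow> real"
  assumes [measurable]: "h \<in> borel_measurable borel"
  shows "(LINT \<theta>:zero_set S|surface_measure. speed \<theta> * h \<theta>) = (LINT \<theta>|torus_lebesgue. smear h \<theta>)"
proof -
  have "flux = density surface_measure (\<lambda>\<theta>. ennreal (speed \<theta> * indicator (zero_set S) \<theta>))"
    unfolding flux_eq_density by (intro arg_cong[where f = "density surface_measure"] ext) (auto simp: indicator_def)
  then have "(LINT \<theta>|flux. h \<theta>) = (LINT \<theta>|surface_measure. (speed \<theta> * indicator (zero_set S) \<theta>) *\<^sub>R h \<theta>)"
  proof (simp only:, intro integral_density)
    show "AE \<theta> in surface_measure. 0 \<le> speed \<theta> * indicator (zero_set S) \<theta>" by (simp add: speed_def)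
  qed measurable
  also have "\<dots> = (LINT \<theta>:zero_set S|surface_measure. speed \<theta> * h \<theta>)"
    unfolding set_lebesgue_integral_def by (simp add: ac_simps)
  finally show ?thesis by (simp add: integral_flux)
qed

lemma emeasure_flux_UNIV: "emeasure flux UNIV = ennreal mass"
proof -
  have "emeasure flux UNIV = (\<integral>\<^sup>+\<theta>. ennreal (smear (\<lambda>_. 1) \<theta>) \<partial>torus_lebesgue)"
    by (subst emeasure_flux) (simp_all add: smear_foot)
  also have "\<dots> = ennreal mass"
    unfolding mass_def
    by (intro nn_integral_eq_integral torus_continuous_integrable continuous_on_smear continuous_intros)
       (simp add: smear_foot weight(2))
  finally show ?thesis .
qed

end

section \<open>Normals to the zero set\<close>

context transversal begin

lemma tangent_orthogonal_grad:
  assumes "v \<in> tangent_vectors (zero_set S) \<theta>"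
  shows "torus_grad S \<theta> \<bullet> v = 0"
proof -
  obtain \<gamma> :: "real \<Rightarrow> real ^ 'n" and \<epsilon> where \<gamma>: "0 < \<epsilon>" "torus_proj (\<gamma> 0) = \<theta>"
    "\<And>t. \<bar>t\<bar> < \<epsilon> \<Longrightarrow> torus_proj (\<gamma> t) \<in> zero_set S" "(\<gamma> has_vector_derivative v) (at 0)"
    using assms unfolding tangent_vectors_def by blast
  have "((\<lambda>t. lift (\<gamma> t)) has_derivative (\<lambda>h. torus_grad S (torus_proj (\<gamma> 0)) \<bullet> (h *\<^sub>R v))) (at 0)"
    using \<gamma>(4) unfolding has_vector_derivative_def
    by (rule has_derivative_compose[OF _ lift_has_derivative])
  moreover have "((\<lambda>t. lift (\<gamma> t)) has_derivative (\<lambda>h. 0)) (at 0)"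
  proof (rule has_derivative_transform_within[OF has_derivative_const \<gamma>(1)])
    show "0 = lift (\<gamma> t)" if "dist t 0 < \<epsilon>" for t
      using \<gamma>(3)[of t] that by (simp add: lift_def zero_set_def dist_real_def)
  qed simp
  ultimately have "(\<lambda>h. torus_grad S (torus_proj (\<gamma> 0)) \<bullet> (h *\<^sub>R v)) = (\<lambda>h. 0)"
    by (rule has_derivative_unique)
  then have "torus_grad S (torus_proj (\<gamma> 0)) \<bullet> (1 *\<^sub>R v) = 0" by (rule fun_cong)
  then show ?thesis using \<gamma>(2) by simp
qed

text \<open>At \<open>u = \<plusminus> e * \<bar>t\<bar>\<close> the linear part of \<open>lift\<close> dominates and has opposite signs, so the
  intermediate value theorem gives \<open>u\<close>.\<close>

lemma tangent_correction:
  assumes x0: "lift x0 = 0" and v: "torus_grad S (torus_proj x0) \<bullet> v = 0" and e: "0 < e"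
  shows "\<exists>d>0. \<forall>t. \<bar>t\<bar> < d \<longrightarrow> (\<exists>u. \<bar>u\<bar> \<le> e * \<bar>t\<bar> \<and> lift (x0 + t *\<^sub>R v + u *\<^sub>R \<omega>) = 0)"
proof -
  define g where "g = torus_grad S (torus_proj x0)"
  define D where "D = \<omega> \<bullet> g"
  have D: "D \<noteq> 0" using transverse[of "torus_proj x0"] x0 by (simp add: D_def g_def D_along_def lift_def)
  define C where "C = norm v + e * norm \<omega>"
  have C: "0 < C" using e omega_nz by (auto simp: C_def intro!: add_nonneg_pos)
  \<comment> \<open>The displacement is at most \<open>\<bar>t\<bar> * C\<close>, so with this
    \<open>\<eta>\<close> the linearisation error is at most half of
    \<open>e * \<bar>t\<bar> * \<bar>D\<bar>\<close>, the size of the linear term at the two test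
    points.\<close>
  define \<eta> where "\<eta> = e * \<bar>D\<bar> / (2 * C)"
  have \<eta>: "0 < \<eta>" using e D C by (simp add: \<eta>_def)
  obtain d0 where d0: "0 < d0" "\<And>y. norm y < d0 \<Longrightarrow> \<bar>lift (x0 + y) - g \<bullet> y\<bar> \<le> \<eta> * norm y"
  proof -
    have "\<exists>d>0. \<forall>y. norm (y - x0) < d \<longrightarrow> norm (lift y - lift x0 - g \<bullet> (y - x0)) \<le> \<eta> * norm (y - x0)"
      using lift_has_derivative[of x0] \<eta> unfolding has_derivative_at_alt g_def by blast
    then obtain d where "0 < d" "\<forall>y. norm (y - x0) < d \<longrightarrow> norm (lift y - lift x0 - g \<bullet> (y - x0)) \<le> \<eta> * norm (y - x0)"
      by blast
    then show ?thesis using x0 by (intro that[of d]) (auto dest: spec[of _ "x0 + _"])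
  qed
  have "\<exists>u. \<bar>u\<bar> \<le> e * \<bar>t\<bar> \<and> lift (x0 + t *\<^sub>R v + u *\<^sub>R \<omega>) = 0" if t: "\<bar>t\<bar> < d0 / C" for t
  proof -
    define s where "s = (if 0 < D then 1 else - 1 :: real)"
    have sD: "s * D = \<bar>D\<bar>" "s = 1 \<or> s = -1" using D by (auto simp: s_def)
    define F where "F u = s * lift (x0 + t *\<^sub>R v + u *\<^sub>R \<omega>)" for u
    have est: "\<bar>F u - u * \<bar>D\<bar>\<bar> \<le> e * \<bar>t\<bar> * \<bar>D\<bar>" if u: "\<bar>u\<bar> = e * \<bar>t\<bar>" for u
    proof -
      let ?y = "t *\<^sub>R v + u *\<^sub>R \<omega>"
      have ny: "norm ?y \<le> \<bar>t\<bar> * C"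
        using norm_triangle_ineq[of "t *\<^sub>R v" "u *\<^sub>R \<omega>"] u by (simp add: C_def algebra_simps)
      also have "\<dots> < d0" using t C by (simp add: field_simps)
      finally have "\<bar>lift (x0 + ?y) - g \<bullet> ?y\<bar> \<le> \<eta> * norm ?y" by (rule d0(2))
      also have "\<dots> \<le> \<eta> * (\<bar>t\<bar> * C)" using ny \<eta> by (intro mult_left_mono) auto
      also have "\<dots> = e * \<bar>t\<bar> * \<bar>D\<bar> / 2" using C by (simp add: \<eta>_def)
      also have "g \<bullet> ?y = u * D" using v by (simp add: g_def D_def inner_add_right inner_commute)
      finally have "\<bar>lift (x0 + ?y) - u * D\<bar> \<le> e * \<bar>t\<bar> * \<bar>D\<bar> / 2" .
      moreover have "F u - u * \<bar>D\<bar> = s * (lift (x0 + ?y) - u * D)"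
        unfolding F_def sD(1)[symmetric] by (simp add: algebra_simps)
      then have "\<bar>F u - u * \<bar>D\<bar>\<bar> = \<bar>lift (x0 + ?y) - u * D\<bar>" using sD(2) by (auto simp: abs_mult)
      moreover have "0 \<le> e * \<bar>t\<bar> * \<bar>D\<bar>" using e by simp
      ultimately show ?thesis by linarith
    qed
    have "0 \<le> e * \<bar>t\<bar>" using e by simp
    then have "\<bar>- (e * \<bar>t\<bar>)\<bar> = e * \<bar>t\<bar>" "\<bar>e * \<bar>t\<bar>\<bar> = e * \<bar>t\<bar>" by simp_all
    from est[OF this(1)] est[OF this(2)] have "F (- (e * \<bar>t\<bar>)) \<le> 0" "0 \<le> F (e * \<bar>t\<bar>)"
      by (simp_all only: abs_le_iff mult_minus_left) linarith+
    moreover have "continuous_on UNIV lift"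
      unfolding lift_def by (intro continuous_on_compose2[OF continuous_on_S] continuous_on_torus_proj_UNIV) auto
    then have "continuous_on {- (e * \<bar>t\<bar>)..e * \<bar>t\<bar>} (\<lambda>u. lift (x0 + t *\<^sub>R v + u *\<^sub>R \<omega>))"
      by (rule continuous_on_compose2) (intro continuous_intros, simp)
    then have "continuous_on {- (e * \<bar>t\<bar>)..e * \<bar>t\<bar>} F"
      unfolding F_def by (rule continuous_on_mult_left)
    moreover have "- (e * \<bar>t\<bar>) \<le> e * \<bar>t\<bar>" using e by simp
    ultimately obtain u where "- (e * \<bar>t\<bar>) \<le> u" "u \<le> e * \<bar>t\<bar>" "F u = 0"
      using IVT'[of F "- (e * \<bar>t\<bar>)" 0 "e * \<bar>t\<bar>"] by blast
    then show ?thesis using sD(2) by (intro exI[of _ u]) (auto simp: F_def abs_le_iff)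
  qed
  then show ?thesis using d0(1) C by (intro exI[of _ "d0 / C"]) auto
qed

text \<open>The straight line \<open>x0 + t *\<^sub>R v\<close> is moved onto the zero set along
  \<open>\<omega>\<close>. By \<open>tangent_correction\<close> the time needed is
  \<open>o(t)\<close>, so the velocity at 0 is still \<open>v\<close>. Taking \<open>hit\<close> for
  this time gives one curve that serves all \<open>e\<close> at once.\<close>

lemma grad_orthogonal_tangent:
  assumes \<theta>: "S \<theta> = 0" and v: "torus_grad S \<theta> \<bullet> v = 0"
  shows "v \<in> tangent_vectors (zero_set S) \<theta>"
proof -
  obtain x0 where x0: "\<theta> = torus_proj x0" by (rule torus_cases)
  have lx0: "lift x0 = 0" using \<theta> x0 by (simp add: lift_def)
  define k where "k t = hit (torus_proj (x0 + t *\<^sub>R v))" for t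
  have corr: "\<exists>d>0. \<forall>t. \<bar>t\<bar> < d \<longrightarrow> \<bar>k t\<bar> \<le> e * \<bar>t\<bar> \<and> lift (x0 + t *\<^sub>R v + k t *\<^sub>R \<omega>) = 0" if e: "0 < e" for e
  proof -
    obtain d where d: "0 < d" "\<And>t. \<bar>t\<bar> < d \<Longrightarrow> \<exists>u. \<bar>u\<bar> \<le> e * \<bar>t\<bar> \<and> lift (x0 + t *\<^sub>R v + u *\<^sub>R \<omega>) = 0"
      using tangent_correction[OF lx0 v[unfolded x0] e] by blast
    have "\<bar>k t\<bar> \<le> e * \<bar>t\<bar> \<and> lift (x0 + t *\<^sub>R v + k t *\<^sub>R \<omega>) = 0" if t: "\<bar>t\<bar> < min d (gap / (2 * e))" for t
    proof -
      obtain u where u: "\<bar>u\<bar> \<le> e * \<bar>t\<bar>" "lift (x0 + t *\<^sub>R v + u *\<^sub>R \<omega>) = 0" using d(2)[of t] t by auto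
      have "\<bar>t\<bar> < gap / (2 * e)" using t by simp
      then have "e * \<bar>t\<bar> < gap / 2" using e by (simp add: field_simps)
      then have "u \<in> hits (torus_proj (x0 + t *\<^sub>R v))" using u by (simp add: hits_def lift_def)
      then have "k t = u" unfolding k_def by (rule hit_eq)
      then show ?thesis using u by simp
    qed
    then show ?thesis using d(1) gap(1) e by (intro exI[of _ "min d (gap / (2 * e))"]) auto
  qed
  have k0: "k 0 = 0"
  proof -
    obtain d where "0 < d" "\<forall>t. \<bar>t\<bar> < d \<longrightarrow> \<bar>k t\<bar> \<le> 1 * \<bar>t\<bar> \<and> lift (x0 + t *\<^sub>R v + k t *\<^sub>R \<omega>) = 0"
      using corr[of 1] by auto
    then show ?thesis by (auto dest: spec[of _ 0])
  qed
  have "(k has_real_derivative 0) (at 0)"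
    unfolding DERIV_def LIM_def
  proof (intro allI impI)
    fix e :: real assume e: "0 < e"
    obtain d where d: "0 < d" "\<And>t. \<bar>t\<bar> < d \<Longrightarrow> \<bar>k t\<bar> \<le> e / 2 * \<bar>t\<bar>"
      using corr[of "e / 2"] e by auto
    have "dist ((k (0 + h) - k 0) / h) 0 < e" if "h \<noteq> 0 \<and> dist h 0 < d" for h
    proof -
      have "\<bar>k h\<bar> / \<bar>h\<bar> \<le> e / 2" using d(2)[of h] that by (simp add: pos_divide_le_eq)
      moreover have "dist ((k (0 + h) - k 0) / h) 0 = \<bar>k h\<bar> / \<bar>h\<bar>" by (simp add: k0 dist_real_def)
      ultimately show ?thesis using e by linarith
    qed
    then show "\<exists>d>0. \<forall>h. h \<noteq> 0 \<and> dist h 0 < d \<longrightarrow> dist ((k (0 + h) - k 0) / h) 0 < e" using d(1) by blast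
  qed
  then have "((\<lambda>t. x0 + t *\<^sub>R v + k t *\<^sub>R \<omega>) has_vector_derivative 0 + 1 *\<^sub>R v + 0 *\<^sub>R \<omega>) (at 0)"
    by (intro has_vector_derivative_add has_vector_derivative_const)
       (auto intro!: derivative_eq_intros simp: has_vector_derivative_def has_field_derivative_def)
  moreover obtain d where "0 < d" "\<And>t. \<bar>t\<bar> < d \<Longrightarrow> lift (x0 + t *\<^sub>R v + k t *\<^sub>R \<omega>) = 0"
    using corr[of 1] by auto
  ultimately show ?thesis
    unfolding tangent_vectors_def
    by (intro CollectI exI[of _ "\<lambda>t. x0 + t *\<^sub>R v + k t *\<^sub>R \<omega>"] exI[of _ d])
       (auto simp: k0 x0 zero_set_def lift_def)
qed

lemma unit_normal_exists: "\<exists>n. unit_normal (zero_set S) n"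
proof
  show "unit_normal (zero_set S) (\<lambda>\<theta>. torus_grad S \<theta> /\<^sub>R norm (torus_grad S \<theta>))"
    unfolding unit_normal_def using grad_nz by (auto simp: zero_set_def tangent_orthogonal_grad)
qed

text \<open>The part \<open>v\<close> of the normal orthogonal to the gradient is a tangent vector,
  hence orthogonal to the normal and so to itself. Thus the normal is the normalised gradient up to
  sign, and the absolute value hides the sign.\<close>

lemma unit_normal_speed:
  assumes n: "unit_normal (zero_set S) n" and \<theta>: "\<theta> \<in> zero_set S"
  shows "\<bar>\<omega> \<bullet> n \<theta>\<bar> = speed \<theta>"
proof -
  let ?g = "torus_grad S \<theta>"
  have S\<theta>: "S \<theta> = 0" using \<theta> by (simp add: zero_set_def)
  have g: "?g \<noteq> 0" by (rule grad_nz[OF S\<theta>])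
  define c where "c = (n \<theta> \<bullet> ?g) / (?g \<bullet> ?g)"
  define v where "v = n \<theta> - c *\<^sub>R ?g"
  have gv: "?g \<bullet> v = 0" using g by (simp add: v_def c_def inner_diff_right inner_commute)
  have "n \<theta> \<bullet> v = 0" using n \<theta> grad_orthogonal_tangent[OF S\<theta> gv] by (simp add: unit_normal_def)
  then have "v \<bullet> v = 0" using gv unfolding v_def by (simp add: inner_diff_left v_def)
  then have nc: "n \<theta> = c *\<^sub>R ?g" by (simp add: v_def)
  have "\<bar>c\<bar> * norm ?g = 1" using n \<theta> nc unfolding unit_normal_def by (metis norm_scaleR)
  then have "\<bar>c\<bar> = 1 / norm ?g" using g by (simp add: field_simps)
  then show ?thesis by (simp add: nc speed_def D_along_def abs_mult)
qed

section \<open>The sequence of zeros\<close>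

abbreviation line_fun :: "real \<Rightarrow> real" where
  "line_fun \<equiv> flow_fun S \<omega>"

lemma finite_zeros_upto: "finite (zeros_upto line_fun L)"
  unfolding zeros_upto_eq by (rule finite_zeros_in)


definition rate :: real where
  "rate = mass / (2 * pi) ^ CARD('n)"

lemma rate_pos: "0 < rate"
  using mass_pos by (simp add: rate_def)

text \<open>A bounded count would have density 0, but the density is positive.\<close>

lemma card_zeros_unbounded: "\<exists>L. N \<le> card (zeros_upto line_fun L)"
proof (rule ccontr)
  assume "\<not> ?thesis"
  then have less: "card (zeros_upto line_fun L) \<le> N" for L by (simp add: not_le less_imp_le)
  have "((\<lambda>L. real (card (zeros_upto line_fun L)) / L) \<longlongrightarrow> 0) at_top"
  proof (rule Lim_null_comparison)
    show "\<forall>\<^sub>F L in at_top. norm (real (card (zeros_upto line_fun L)) / L) \<le> real N * (1 / L)"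
      using eventually_gt_at_top[of 0]
      by eventually_elim (use less in \<open>auto simp: divide_right_mono\<close>)
    show "((\<lambda>L. real N * (1 / L)) \<longlongrightarrow> 0) at_top"
      by (intro tendsto_mult_right_zero tendsto_divide_0[OF tendsto_const]
          filterlim_at_top_imp_at_infinity filterlim_ident)
  qed
  from tendsto_unique[OF _ this zero_density] show False using rate_pos by (simp add: rate_def)
qed

text \<open>The number \<open>c t\<close> of positive zeros up to \<open>t\<close> maps the positive
  zeros in increasing order onto the positive integers; the enumeration is its inverse.\<close>

lemma positive_zeros_listed: "\<exists>x. lists_positive_zeros line_fun x"
proof -
  define P where "P = {t. 0 < t \<and> line_fun t = 0}"
  define Q where "Q t = {s\<in>P. s \<le> t}" for t
  have Qfin: "finite (Q t)" for t
    by (rule finite_subset[OF _ finite_zeros_upto[of t]]) (auto simp: Q_def P_def zeros_upto_def)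
  define c where "c t = card (Q t)" for t
  have mono: "c s < c t" if "s \<in> P" "t \<in> P" "s < t" for s t
  proof -
    have "Q s \<subseteq> Q t" "t \<in> Q t" "t \<notin> Q s" using that by (auto simp: Q_def)
    then have "Q s \<subset> Q t" by blast
    then show ?thesis unfolding c_def by (rule psubset_card_mono[OF Qfin])
  qed
  have inj: "inj_on c P"
  proof (rule inj_onI)
    fix s t assume "s \<in> P" "t \<in> P" "c s = c t"
    then show "s = t" using mono[of s t] mono[of t s] by (cases s t rule: linorder_cases) auto
  qed
  have pos: "1 \<le> c t" if "t \<in> P" for t
  proof -
    have "Q t \<noteq> {}" using that by (auto simp: Q_def)
    then show ?thesis using Qfin by (simp add: c_def Suc_le_eq card_gt_0_iff)
  qed
  \<comment> \<open>The count skips no value: the largest positive zero before \<open>t\<close> has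
    count \<open>c t - 1\<close>.\<close>
  have down: "n \<in> c ` P" if "t \<in> P" "1 \<le> n" "n \<le> c t" for t n
    using that
  proof (induction "c t - n" arbitrary: t)
    case 0
    then have "n = c t" by linarith
    then show ?case using 0 by blast
  next
    case (Suc j)
    have Qe: "Q t = insert t (Q t - {t})" "t \<in> Q t" using Suc.prems by (auto simp: Q_def)
    have "2 \<le> c t" using Suc by linarith
    have ne: "Q t - {t} \<noteq> {}"
    proof
      assume "Q t - {t} = {}"
      then have "Q t = {t}" using Qe(2) by blast
      then show False using \<open>2 \<le> c t\<close> by (simp add: c_def)
    qed
    define s where "s = Max (Q t - {t})"
    have sQ: "s \<in> Q t - {t}" unfolding s_def using Qfin ne by (intro Max_in) auto
    have "Q s = Q t - {t}"
    proof (intro set_eqI iffI)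
      fix y assume "y \<in> Q t - {t}"
      then show "y \<in> Q s" using Max_ge[of "Q t - {t}" y] Qfin[of t] by (auto simp: s_def Q_def)
    qed (use sQ in \<open>auto simp: Q_def\<close>)
    then have cs: "Suc (c s) = c t" unfolding c_def by (simp only: card_Suc_Diff1[OF Qfin Qe(2)])
    have "s \<in> P" using sQ by (simp add: Q_def)
    moreover have "j = c s - n" "n \<le> c s" using Suc.hyps(2) cs by linarith+
    ultimately show ?case using Suc.hyps(1) Suc.prems(2) by blast
  qed
  have range: "c ` P = {1..}"
  proof (intro set_eqI iffI)
    fix n :: nat assume n: "n \<in> {1..}"
    \<comment> \<open>One more than \<open>n\<close>, because \<open>zeros_upto\<close> may include
      the zero at 0, which is not positive.\<close>
    obtain L where L: "Suc n \<le> card (zeros_upto line_fun L)" using card_zeros_unbounded by blast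
    have "zeros_upto line_fun L \<subseteq> insert 0 (Q L)" by (auto simp: zeros_upto_def Q_def P_def)
    then have "card (zeros_upto line_fun L) \<le> card (insert 0 (Q L))" by (rule card_mono[rotated]) (simp add: Qfin)
    also have "\<dots> \<le> Suc (card (Q L))" by (simp add: card_insert_if Qfin)
    finally have "card (zeros_upto line_fun L) \<le> Suc (card (Q L))" .
    then have nQ: "n \<le> card (Q L)" using L by simp
    then have ne: "Q L \<noteq> {}" using n by auto
    define t where "t = Max (Q L)"
    have tQ: "t \<in> Q L" unfolding t_def using Qfin ne by (intro Max_in)
    have "Q t = Q L"
    proof (intro set_eqI iffI)
      fix y assume "y \<in> Q L"
      then show "y \<in> Q t" using Max_ge[of "Q L" y] Qfin by (auto simp: t_def Q_def)
    qed (use tQ in \<open>auto simp: Q_def\<close>)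
    then show "n \<in> c ` P" using down[of t n] tQ nQ n by (auto simp: c_def Q_def)
  qed (use pos in auto)
  define x where "x = inv_into P c"
  have x: "x n \<in> P" "c (x n) = n" if "1 \<le> n" for n
    using that range by (auto simp: x_def inv_into_into f_inv_into_f)
  have "strict_mono_on {1..} x"
  proof (rule strict_mono_onI)
    fix m n :: nat assume mn: "m \<in> {1..}" "n \<in> {1..}" "m < n"
    show "x m < x n"
    proof (rule ccontr)
      assume "\<not> x m < x n"
      then consider "x n < x m" | "x m = x n" by linarith
      then show False using mono[of "x n" "x m"] x[of m] x[of n] mn by cases auto
    qed
  qed
  moreover have "x ` {1..} = P"
  proof (intro set_eqI iffI)
    fix t assume "t \<in> P"
    then have "x (c t) = t" "1 \<le> c t" using inj pos by (auto simp: x_def)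
    then show "t \<in> x ` {1..}" by (metis atLeast_iff image_eqI)
  qed (use x in auto)
  ultimately show ?thesis unfolding lists_positive_zeros_def P_def by blast
qed

section \<open>Averages over the enumerated zeros\<close>

context
  fixes x :: "nat \<Rightarrow> real"
  assumes x: "lists_positive_zeros line_fun x"
begin

lemma listed_pos: "1 \<le> n \<Longrightarrow> 0 < x n" "1 \<le> n \<Longrightarrow> line_fun (x n) = 0"
  using x unfolding lists_positive_zeros_def by blast+

lemma listed_mono: "1 \<le> m \<Longrightarrow> m < n \<Longrightarrow> x m < x n"
  using x unfolding lists_positive_zeros_def by (auto simp: strict_mono_on_def)

lemma listed_inj: "inj_on x {1..N}"
proof (rule inj_onI)
  fix m n assume "m \<in> {1..N}" "n \<in> {1..N}" "x m = x n"
  then show "m = n" using listed_mono[of m n] listed_mono[of n m] by (cases m n rule: linorder_cases) auto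
qed

text \<open>The density counts a possible zero at 0, the enumeration does not; this single term
  disappears in the averages.\<close>

lemma zeros_upto_listed:
  assumes "1 \<le> N"
  shows "zeros_upto line_fun (x N) = x ` {1..N} \<union> (if line_fun 0 = 0 then {0} else {})"
proof (intro set_eqI iffI)
  fix t assume t: "t \<in> zeros_upto line_fun (x N)"
  show "t \<in> x ` {1..N} \<union> (if line_fun 0 = 0 then {0} else {})"
  proof (cases "t = 0")
    case False
    then have "t \<in> {t. 0 < t \<and> line_fun t = 0}" using t by (auto simp: zeros_upto_def)
    then have "t \<in> x ` {1..}" using x by (simp only: lists_positive_zeros_def)
    then obtain n where n: "1 \<le> n" "t = x n" by auto
    have "n \<le> N" using listed_mono[OF assms, of n] t n(2) by (force simp: zeros_upto_def not_le[symmetric])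
    then show ?thesis using n by auto
  qed (use t in \<open>auto simp: zeros_upto_def\<close>)
next
  fix t assume t: "t \<in> x ` {1..N} \<union> (if line_fun 0 = 0 then {0} else {})"
  show "t \<in> zeros_upto line_fun (x N)"
  proof (cases "t \<in> x ` {1..N}")
    case True
    then obtain n where n: "1 \<le> n" "n \<le> N" "t = x n" by auto
    then have "x n \<le> x N" using listed_mono[of n N] by (cases "n = N") auto
    then show ?thesis using listed_pos[of n] n by (auto simp: zeros_upto_def)
  next
    case False
    then show ?thesis using t listed_pos[OF assms] by (auto simp: zeros_upto_def split: if_splits)
  qed
qed

lemma sum_zeros_upto_listed:
  assumes "1 \<le> N"
  shows "(\<Sum>z\<in>zeros_upto line_fun (x N). F z) = (\<Sum>n=1..N. F (x n)) + (if line_fun 0 = 0 then F 0 else (0 :: real))"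
proof -
  have "(\<Sum>z\<in>x ` {1..N} \<union> (if line_fun 0 = 0 then {0} else {}). F z)
      = (\<Sum>z\<in>x ` {1..N}. F z) + (\<Sum>z\<in>(if line_fun 0 = 0 then {0} else {}). F z)"
  proof (rule sum.union_disjoint)
    have "0 \<notin> x ` {1..N}"
    proof
      assume "0 \<in> x ` {1..N}"
      then obtain n where "1 \<le> n" "x n = 0" by auto
      then show False using listed_pos(1)[of n] by simp
    qed
    then show "x ` {1..N} \<inter> (if line_fun 0 = 0 then {0} else {}) = {}" by auto
  qed auto
  then show ?thesis using listed_inj by (simp add: zeros_upto_listed[OF assms] sum.reindex)
qed

text \<open>Only finitely many zeros lie in \<open>{0..L}\<close>, while the first \<open>N\<close>
  listed ones are distinct.\<close>

lemma listed_at_top: "filterlim x at_top sequentially"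
  unfolding filterlim_at_top
proof
  fix L
  have "L \<le> x N" if N: "card (zeros_upto line_fun L) < N" for N
  proof (rule ccontr)
    assume "\<not> L \<le> x N"
    then have "zeros_upto line_fun (x N) \<subseteq> zeros_upto line_fun L" by (auto simp: zeros_upto_def)
    then have "x ` {1..N} \<subseteq> zeros_upto line_fun L" using zeros_upto_listed[of N] N by auto
    then have "card (x ` {1..N}) \<le> card (zeros_upto line_fun L)" by (intro card_mono finite_zeros_upto)
    moreover have "card (x ` {1..N}) = N" by (subst card_image[OF listed_inj]) simp
    ultimately show False using N by linarith
  qed
  then show "\<forall>\<^sub>F N in sequentially. L \<le> x N"
    unfolding eventually_sequentially by (meson Suc_le_eq)
qed

text \<open>Take \<open>L = x N\<close> in \<open>zero_average_tendsto\<close> for \<open>h\<close>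
  and for the constant 1, and divide; the second gives the limit of \<open>N / x N\<close>, which is
  positive.\<close>

lemma listed_average_tendsto:
  assumes h: "continuous_on UNIV h"
  shows "(\<lambda>N. (\<Sum>n=1..N. h (torus_proj (x n *\<^sub>R \<omega>))) / real N) \<longlonglongrightarrow> (LINT \<theta>|torus_lebesgue. smear h \<theta>) / mass"
proof -
  have quot: "(\<lambda>N. (\<Sum>n=1..N. h (torus_proj (x n *\<^sub>R \<omega>))) / x N)
      \<longlonglongrightarrow> (LINT \<theta>|torus_lebesgue. smear h \<theta>) / (2 * pi) ^ CARD('n)"
    if h: "continuous_on UNIV h" for h
  proof -
    define h0 where "h0 = (if line_fun 0 = 0 then h (torus_proj (0 *\<^sub>R \<omega>)) else 0)"
    have "(\<lambda>N. (\<Sum>z\<in>zeros_upto line_fun (x N). h (torus_proj (z *\<^sub>R \<omega>))) / x N)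
      \<longlonglongrightarrow> (LINT \<theta>|torus_lebesgue. smear h \<theta>) / (2 * pi) ^ CARD('n)"
      by (rule filterlim_compose[OF zero_average_tendsto[OF h] listed_at_top])
    moreover have "(\<lambda>N. h0 / x N) \<longlonglongrightarrow> 0"
      by (intro tendsto_divide_0[OF tendsto_const] filterlim_at_top_imp_at_infinity listed_at_top)
    ultimately have "(\<lambda>N. (\<Sum>z\<in>zeros_upto line_fun (x N). h (torus_proj (z *\<^sub>R \<omega>))) / x N - h0 / x N)
      \<longlonglongrightarrow> (LINT \<theta>|torus_lebesgue. smear h \<theta>) / (2 * pi) ^ CARD('n) - 0"
      by (rule tendsto_diff)
    moreover have "\<forall>\<^sub>F N in sequentially. (\<Sum>z\<in>zeros_upto line_fun (x N). h (torus_proj (z *\<^sub>R \<omega>))) / x N - h0 / x N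
        = (\<Sum>n=1..N. h (torus_proj (x n *\<^sub>R \<omega>))) / x N"
      using eventually_ge_at_top[of 1]
      by eventually_elim (simp add: sum_zeros_upto_listed h0_def add_divide_distrib)
    ultimately show ?thesis by (auto elim: Lim_transform_eventually)
  qed
  have q1: "(\<lambda>N. real N / x N) \<longlonglongrightarrow> rate"
    using quot[of "\<lambda>_. 1"] by (simp add: rate_def mass_def)
  have "(\<lambda>N. (\<Sum>n=1..N. h (torus_proj (x n *\<^sub>R \<omega>))) / x N / (real N / x N))
      \<longlonglongrightarrow> (LINT \<theta>|torus_lebesgue. smear h \<theta>) / (2 * pi) ^ CARD('n) / rate"
    by (rule tendsto_divide[OF quot[OF h] q1]) (use rate_pos in simp)
  moreover have "\<forall>\<^sub>F N in sequentially. (\<Sum>n=1..N. h (torus_proj (x n *\<^sub>R \<omega>))) / x N / (real N / x N)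
      = (\<Sum>n=1..N. h (torus_proj (x n *\<^sub>R \<omega>))) / real N"
    using eventually_ge_at_top[of 1]
  proof eventually_elim
    case (elim N)
    then show ?case using listed_pos(1)[of N] by simp
  qed
  ultimately have "(\<lambda>N. (\<Sum>n=1..N. h (torus_proj (x n *\<^sub>R \<omega>))) / real N)
      \<longlonglongrightarrow> (LINT \<theta>|torus_lebesgue. smear h \<theta>) / (2 * pi) ^ CARD('n) / rate"
    by (rule Lim_transform_eventually)
  then show ?thesis by (simp add: rate_def)
qed

end

end

section \<open>Empirical measures\<close>

text \<open>As an image of the uniform measure on the indices, the empirical measure is visibly a
  probability measure, and its integrals are finite averages.\<close>

lemma empirical_measure_eq:
  assumes N: "1 \<le> N" and \<Theta>: "\<And>n. 1 \<le> n \<Longrightarrow> \<Theta> n \<in> X"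
  shows "empirical_measure X \<Theta> N = distr (uniform_count_measure {1..N}) (restrict_space borel X) \<Theta>"
proof -
  let ?R = "restrict_space borel X" and ?U = "uniform_count_measure {1..N}"
  have spR: "space ?R = X" by (simp add: space_restrict_space)
  have meas: "\<Theta> \<in> ?U \<rightarrow>\<^sub>M ?R"
    using \<Theta> by (auto simp: measurable_def space_uniform_count_measure sets_uniform_count_measure spR)
  have eq: "ennreal (1 / real N) * (\<Sum>n=1..N. emeasure (return ?R (\<Theta> n)) A) = emeasure (distr ?U ?R \<Theta>) A"
    if A: "A \<in> sets ?R" for A
  proof -
    have "(\<Sum>n=1..N. emeasure (return ?R (\<Theta> n)) A) = (\<Sum>n\<in>{1..N}. if n \<in> \<Theta> -` A then 1 else 0)"
      using A by (intro sum.cong) (auto simp: indicator_def)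
    also have "\<dots> = of_nat (card (\<Theta> -` A \<inter> {1..N}))"
      by (simp add: sum.If_cases Int_commute vimage_def Collect_conj_eq)
    finally have "ennreal (1 / real N) * (\<Sum>n=1..N. emeasure (return ?R (\<Theta> n)) A)
       = ennreal (real (card (\<Theta> -` A \<inter> {1..N})) / real N)"
      by (simp add: ennreal_of_nat_eq_real_of_nat flip: ennreal_mult)
    moreover have "emeasure (distr ?U ?R \<Theta>) A = ennreal (real (card (\<Theta> -` A \<inter> {1..N})) / real N)"
      by (subst emeasure_distr[OF meas A]) (simp add: space_uniform_count_measure emeasure_uniform_count_measure)
    ultimately show ?thesis by simp
  qed
  have sub: "sets ?R \<subseteq> Pow X" using sets.space_closed[of ?R] spR by simp
  have "empirical_measure X \<Theta> N = measure_of X (sets ?R) (emeasure (distr ?U ?R \<Theta>))"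
    unfolding empirical_measure_def
  proof (rule measure_of_eq[OF sub])
    fix A assume "A \<in> sigma_sets X (sets ?R)"
    then have "A \<in> sets ?R" using sets.sigma_sets_eq[of ?R] spR by simp
    then show "ennreal (1 / real N) * (\<Sum>n=1..N. emeasure (return ?R (\<Theta> n)) A) = emeasure (distr ?U ?R \<Theta>) A"
      by (rule eq)
  qed
  also have "\<dots> = distr ?U ?R \<Theta>"
    using measure_of_of_measure[of "distr ?U ?R \<Theta>"] spR by simp
  finally show ?thesis .
qed

lemma empirical_measure_prob:
  assumes N: "1 \<le> N" and \<Theta>: "\<And>n. 1 \<le> n \<Longrightarrow> \<Theta> n \<in> X"
  shows "empirical_measure X \<Theta> N \<in> borel_prob X"
proof -
  have "\<Theta> \<in> uniform_count_measure {1..N} \<rightarrow>\<^sub>M restrict_space borel X"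
    using \<Theta> by (auto simp: measurable_def space_uniform_count_measure sets_uniform_count_measure space_restrict_space)
  then have "prob_space (distr (uniform_count_measure {1..N}) (restrict_space borel X) \<Theta>)"
    using N by (intro prob_space.prob_space_distr prob_space_uniform_count_measure) auto
  then show ?thesis
    by (simp add: borel_prob_def empirical_measure_eq[where X = X, OF N \<Theta>] space_restrict_space)
qed

lemma empirical_measure_integral:
  fixes f :: "'a::topological_space \<Rightarrow> real"
  assumes N: "1 \<le> N" and \<Theta>: "\<And>n. 1 \<le> n \<Longrightarrow> \<Theta> n \<in> X" and f: "continuous_on X f"
  shows "(LINT \<theta>|empirical_measure X \<Theta> N. f \<theta>) = (\<Sum>n=1..N. f (\<Theta> n)) / real N"
proof -
  have meas: "\<Theta> \<in> uniform_count_measure {1..N} \<rightarrow>\<^sub>M restrict_space borel X"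
    using \<Theta> by (auto simp: measurable_def space_uniform_count_measure sets_uniform_count_measure space_restrict_space)
  have eq: "empirical_measure X \<Theta> N = distr (uniform_count_measure {1..N}) (restrict_space borel X) \<Theta>"
    by (rule empirical_measure_eq[OF N \<Theta>])
  have "(LINT \<theta>|empirical_measure X \<Theta> N. f \<theta>) = (LINT n|uniform_count_measure {1..N}. f (\<Theta> n))"
    unfolding eq
    by (rule integral_distr[OF meas borel_measurable_continuous_on_restrict[OF f]])
  also have "\<dots> = (\<Sum>n=1..N. f (\<Theta> n)) / real N"
    unfolding uniform_count_measure_def
    by (subst lebesgue_integral_point_measure_finite) (auto simp: sum_divide_distrib)
  finally show ?thesis .
qed

section \<open>The limit measure and weak convergence\<close>

context transversal begin

lemma limit_measure_eq:
  "limit_measure S \<omega> rate = density (restrict_space surface_measure (zero_set S)) (\<lambda>\<theta>. ennreal (speed \<theta> / mass))"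
proof -
  have "1 / ((2 * pi) ^ CARD('n) * rate) * (\<bar>DS \<theta>\<bar> / norm (torus_grad S \<theta>)) = speed \<theta> / mass" for \<theta>
    by (simp add: rate_def speed_def)
  then show ?thesis unfolding limit_measure_def by simp
qed

lemma limit_measure_sets:
  "space (limit_measure S \<omega> rate) = zero_set S"
  "sets (limit_measure S \<omega> rate) = sets (restrict_space borel (zero_set S))"
  unfolding limit_measure_eq
  by (simp_all add: space_restrict_space sets_restrict_space)

text \<open>The density divides that of \<open>flux\<close> by \<open>mass\<close>, which is the
  total mass of \<open>flux\<close>.\<close>

lemma limit_measure_prob: "limit_measure S \<omega> rate \<in> borel_prob (zero_set S)"
proof -
  let ?R = "restrict_space surface_measure (zero_set S)"
  have sm: "speed \<in> borel_measurable ?R"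
    by (rule measurable_restrict_space1) measurable
  have "emeasure (limit_measure S \<omega> rate) (zero_set S)
      = (\<integral>\<^sup>+\<theta>. ennreal (speed \<theta> / mass) * indicator (zero_set S) \<theta> \<partial>?R)"
    unfolding limit_measure_eq
    by (rule emeasure_density) (use sm in \<open>auto simp: sets_restrict_space\<close>)
  also have "\<dots> = (\<integral>\<^sup>+\<theta>. ennreal (speed \<theta> / mass) * indicator (zero_set S) \<theta> \<partial>surface_measure)"
    by (subst nn_integral_restrict_space) (auto simp: indicator_def intro!: nn_integral_cong)
  also have "\<dots> = (\<integral>\<^sup>+\<theta>. ennreal (1 / mass) * (ennreal (speed \<theta>) * indicator (zero_set S) \<theta>) \<partial>surface_measure)"
  proof (intro nn_integral_cong)
    fix \<theta>
    have "ennreal (speed \<theta> / mass) = ennreal (1 / mass) * ennreal (speed \<theta>)"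
      using mass_pos by (subst ennreal_mult[symmetric]) (auto simp: speed_def)
    then show "ennreal (speed \<theta> / mass) * indicator (zero_set S) \<theta>
        = ennreal (1 / mass) * (ennreal (speed \<theta>) * indicator (zero_set S) \<theta>)" by (simp add: mult.assoc)
  qed
  also have "\<dots> = ennreal (1 / mass) * emeasure flux UNIV"
    by (subst nn_integral_cmult) (auto simp: flux_eq_density emeasure_density)
  also have "\<dots> = 1"
    using mass_pos by (simp add: emeasure_flux_UNIV flip: ennreal_mult)
  finally have "prob_space (limit_measure S \<omega> rate)"
    by (intro prob_spaceI) (simp add: limit_measure_sets)
  then show ?thesis by (simp add: borel_prob_def limit_measure_sets)
qed

lemma limit_measure_integral:
  assumes h: "continuous_on UNIV h"
  shows "(LINT \<theta>|limit_measure S \<omega> rate. h \<theta>) = (LINT \<theta>|torus_lebesgue. smear h \<theta>) / mass"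
proof -
  let ?R = "restrict_space surface_measure (zero_set S)"
  have hm [measurable]: "h \<in> borel_measurable borel" by (rule borel_measurable_continuous_onI[OF h])
  have "(LINT \<theta>|limit_measure S \<omega> rate. h \<theta>) = (LINT \<theta>|?R. (speed \<theta> / mass) *\<^sub>R h \<theta>)"
    unfolding limit_measure_eq
  proof (rule integral_density)
    show "h \<in> borel_measurable ?R" "(\<lambda>\<theta>. speed \<theta> / mass) \<in> borel_measurable ?R"
      by (rule measurable_restrict_space1, measurable)+
    show "AE \<theta> in ?R. 0 \<le> speed \<theta> / mass" using mass_pos by (simp add: speed_def)
  qed
  also have "\<dots> = (LINT \<theta>:zero_set S|surface_measure. (speed \<theta> / mass) *\<^sub>R h \<theta>)"
    unfolding set_lebesgue_integral_def by (rule integral_restrict_space) simp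
  also have "\<dots> = (LINT \<theta>:zero_set S|surface_measure. speed \<theta> * h \<theta>) / mass"
    unfolding set_lebesgue_integral_def by (simp add: mult.commute mult.left_commute)
  finally show ?thesis by (simp add: integral_flux_surface)
qed

lemma rate_normal:
  assumes "unit_normal (zero_set S) n"
  shows "rate = 1 / (2 * pi) ^ CARD('n) * (LINT \<theta>:zero_set S|surface_measure. \<bar>\<omega> \<bullet> n \<theta>\<bar>)"
proof -
  have "(LINT \<theta>:zero_set S|surface_measure. \<bar>\<omega> \<bullet> n \<theta>\<bar>) = (LINT \<theta>:zero_set S|surface_measure. speed \<theta> * 1)"
    unfolding set_lebesgue_integral_def
    by (intro Bochner_Integration.integral_cong) (auto simp: indicator_def unit_normal_speed[OF assms])
  also have "\<dots> = mass" unfolding mass_def by (rule integral_flux_surface) simp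
  finally show ?thesis by (simp add: rate_def)
qed

lemma listed_on_zero_set:
  assumes "lists_positive_zeros line_fun x" "1 \<le> n"
  shows "torus_proj (x n *\<^sub>R \<omega>) \<in> zero_set S"
  using listed_pos(2)[OF assms] by (simp add: zero_set_def flow_fun_def)

text \<open>Test functions live on the zero set only, whereas \<open>listed_average_tendsto\<close>
  needs them on the whole torus; Tietze extends them from the closed zero set.\<close>

lemma empirical_weakly_converges:
  assumes x: "lists_positive_zeros line_fun x"
  shows "weakly_converges (zero_set S) (empirical_measure (zero_set S) (\<lambda>n. torus_proj (x n *\<^sub>R \<omega>)))
    (limit_measure S \<omega> rate)"
  unfolding weakly_converges_def
proof (intro allI impI, elim conjE)
  fix f :: "'n torus \<Rightarrow> real" assume f: "continuous_on (zero_set S) f" "bounded (f ` zero_set S)"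
  obtain h where h: "continuous_on UNIV h" "\<And>\<theta>. \<theta> \<in> zero_set S \<Longrightarrow> h \<theta> = f \<theta>"
  proof -
    obtain B where "\<And>\<theta>. \<theta> \<in> zero_set S \<Longrightarrow> norm (f \<theta>) \<le> B" "0 \<le> B"
      using f(2) unfolding bounded_pos by (metis imageI less_imp_le)
    moreover have "closedin (top_of_set UNIV) (zero_set S)" using zero_set_closed by simp
    ultimately show ?thesis using Tietze[OF f(1), of UNIV B] that by metis
  qed
  have "\<forall>\<^sub>F N in sequentially. (\<Sum>n=1..N. h (torus_proj (x n *\<^sub>R \<omega>))) / real N
     = (LINT \<theta>|empirical_measure (zero_set S) (\<lambda>n. torus_proj (x n *\<^sub>R \<omega>)) N. f \<theta>)"
    using eventually_ge_at_top[of 1]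
  proof eventually_elim
    case (elim N)
    then show ?case
      using listed_on_zero_set[OF x] h(2) f(1) by (subst empirical_measure_integral) auto
  qed
  then have "(\<lambda>N. LINT \<theta>|empirical_measure (zero_set S) (\<lambda>n. torus_proj (x n *\<^sub>R \<omega>)) N. f \<theta>)
      \<longlonglongrightarrow> (LINT \<theta>|torus_lebesgue. smear h \<theta>) / mass"
    by (rule Lim_transform_eventually[OF listed_average_tendsto[OF x h(1)]])
  moreover have "(LINT \<theta>|limit_measure S \<omega> rate. f \<theta>) = (LINT \<theta>|limit_measure S \<omega> rate. h \<theta>)"
    by (intro Bochner_Integration.integral_cong) (auto simp: limit_measure_sets h(2))
  ultimately show "(\<lambda>N. LINT \<theta>|empirical_measure (zero_set S) (\<lambda>n. torus_proj (x n *\<^sub>R \<omega>)) N. f \<theta>)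
      \<longlonglongrightarrow> (LINT \<theta>|limit_measure S \<omega> rate. f \<theta>)"
    by (simp add: limit_measure_integral[OF h(1)])
qed

end

text \<open>The first three conjuncts give the others their content: \<open>card\<close> of an
  infinite set is 0, and normals and enumerations are universally quantified below.\<close>

theorem theorem7p1:
  fixes \<omega> :: "real ^ 'n" and S :: "'n torus \<Rightarrow> real"
  assumes "nonresonant \<omega>"
    and "torus_smooth S"
    and "zero_set S \<noteq> {}"
    and "\<forall>\<theta>\<in>zero_set S. D_along \<omega> S \<theta> \<noteq> 0"
  shows "(\<forall>L. finite (zeros_upto (flow_fun S \<omega>) L)) \<and>
    (\<exists>n. unit_normal (zero_set S) n) \<and>
    (\<exists>x. lists_positive_zeros (flow_fun S \<omega>) x) \<and>
    (\<exists>\<rho>::real.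
      ((\<lambda>L. real (card (zeros_upto (flow_fun S \<omega>) L)) / L) \<longlongrightarrow> \<rho>) at_top \<and>
      (\<exists>I. has_delta_integral S (\<lambda>\<theta>. \<bar>D_along \<omega> S \<theta>\<bar>) I \<and> \<rho> = 1 / (2 * pi) ^ CARD('n) * I) \<and>
      (\<forall>n. unit_normal (zero_set S) n \<longrightarrow>
        \<rho> = 1 / (2 * pi) ^ CARD('n) * (LINT \<theta>:zero_set S|surface_measure. \<bar>\<omega> \<bullet> n \<theta>\<bar>)) \<and>
      limit_measure S \<omega> \<rho> \<in> borel_prob (zero_set S) \<and>
      (\<forall>x. lists_positive_zeros (flow_fun S \<omega>) x \<longrightarrow>
        (let \<mu> = empirical_measure (zero_set S) (\<lambda>n. torus_proj (x n *\<^sub>R \<omega>)) in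
          (\<forall>N\<ge>1. \<mu> N \<in> borel_prob (zero_set S)) \<and>
          weakly_converges (zero_set S) \<mu> (limit_measure S \<omega> \<rho>))))"
proof -
  interpret transversal \<omega> S
    using assms by unfold_locales (auto simp: zero_set_def)
  have "((\<lambda>L. real (card (zeros_upto (flow_fun S \<omega>) L)) / L) \<longlongrightarrow> rate) at_top"
    unfolding rate_def by (rule zero_density)
  moreover have "\<exists>I. has_delta_integral S (\<lambda>\<theta>. \<bar>D_along \<omega> S \<theta>\<bar>) I \<and> rate = 1 / (2 * pi) ^ CARD('n) * I"
    by (intro exI[of _ mass] conjI has_delta_integral_mass) (simp add: rate_def)
  moreover have "(let \<mu> = empirical_measure (zero_set S) (\<lambda>n. torus_proj (x n *\<^sub>R \<omega>)) in
          (\<forall>N\<ge>1. \<mu> N \<in> borel_prob (zero_set S)) \<and>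
          weakly_converges (zero_set S) \<mu> (limit_measure S \<omega> rate))"
    if "lists_positive_zeros (flow_fun S \<omega>) x" for x
    unfolding Let_def
    using that by (intro conjI allI impI empirical_measure_prob empirical_weakly_converges listed_on_zero_set)
  ultimately show ?thesis
    using finite_zeros_upto unit_normal_exists positive_zeros_listed rate_normal limit_measure_prob by blast
qed

end
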